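(* Let $f\colon\mathbb{D}\to\mathbb{D}$ be a non-elliptic map with Denjoy--Wolff point $\tau\in\partial\mathbb{D}$, Koenigs function $h$ and Koenigs domain $\Omega$. Let $V\subseteq\mathbb{D}$ be a fundamental domain of $f$ with the following properties: $h$ is univalent on $V$; $h(V)$ is starlike at infinity; $\bigcup_{t\geq0}( h(V)-t)=\bigcup_{n\in\mathbb{N}}( \Omega-n)$; and, if $f$ is hyperbolic or parabolic of zero hyperbolic step, then any sequence $\{z_n\}\subseteq\mathbb{D}$ converging non-tangentially to $\tau$ is eventually contained in $V$ and satisfies $\lim_{n\to+\infty}\lambda_{\mathbb{D}}(z_n)/\lambda_V(z_n)=1$. Let $(\phi_t)_{t\ge0}$ be the semigroup-fication of $f$ in $V$, that is, $\phi_t(z)=(h|_V)^{-1}(h|_V(z)+t)$ for $z\in V$, $t\ge0$. For any $z\in\mathbb{D}$, there exists some $n_0\in\mathbb{N}$ such that $\eta_z\colon [0,+\infty)\to \mathbb{D}$ with $\eta_z(t)=\phi_t(f^{n_0}(z))$ is a well-defined, Lipschitz curve that lands at $\tau$ and satisfies: (a) $f^n(z)=\eta_z(n-n_0)$, for all $n\geq n_0$; (b) $f(\eta_z([0,+\infty)))\subseteq \eta_z([0,+\infty))$; and (c) $\mathrm{Slope}_{\mathbb{D}}(f^n(z))=\mathrm{Slope}_{\mathbb{D}}(\eta_z)$. Moreover, $\eta_z$ is a hyperbolic quasi-geodesic of $\mathbb{D}$ if and only if $\{f^n(z)\}$ converges to $\tau$ non-tangentially.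
   Context: $\mathbb{D}$ is the open unit disc and $\mathbb{N}=\{1,2,\dots\}$. A holomorphic map $f\colon\mathbb{D}\to\mathbb{D}$ is non-elliptic if it has no fixed point in $\mathbb{D}$; then there is a unique $\tau\in\partial\mathbb{D}$, the Denjoy--Wolff point of $f$, such that the iterates $f^n(z)$ converge to $\tau$ for all $z\in\mathbb{D}$. A domain $\Omega\subseteq\mathbb{C}$ is starlike at infinity if $\Omega+t\subseteq\Omega$ for all $t\ge 0$; it is asymptotically starlike at infinity if $\Omega+1\subseteq\Omega$ and $\widetilde{\Omega}:=\bigcup_{n=1}^\infty(\Omega-n)$ is starlike at infinity. A simply connected domain $U\subseteq\mathbb{D}$ is a fundamental domain of $f$ if $f$ is univalent on $U$, $f(U)\subseteq U$ and $\bigcup_{n\in\mathbb{N}}f^{-n}(U)=\mathbb{D}$, where $f^{-n}(U)$ is the preimage of $U$ under $f^n$. For a non-elliptic $f$, a Koenigs domain and a Koenigs function are a domain $\Omega$ asymptotically starlike at infinity and an onto holomorphic map $h\colon\mathbb{D}\to\Omega$ with $h\circ f=h+1$ and such that $h$ is univalent on some fundamental domain of $f$. Such a pair exists and is unique up to translation. The map $f$ is hyperbolic if $\widetilde{\Omega}$ is a horizontal strip, parabolic of positive hyperbolic step if $\widetilde\Omega$ is a horizontal half-plane, and parabolic of zero hyperbolic step if $\widetilde\Omega=\mathbb{C}$; these are the only possibilities. A sequence $\{z_n\}\subseteq\mathbb{D}$ converging to $\sigma\in\partial\mathbb{D}$ converges non-tangentially if there is $R>1$ with $|\sigma-z_n|<R(1-|z_n|)$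 for all $n$. A curve $\gamma\colon[0,+\infty)\to\mathbb{D}$ lands at $\sigma\in\partial\mathbb{D}$ if $\lim_{t\to+\infty}\gamma(t)=\sigma$. For $\{z_n\}\subseteq\mathbb{D}$ converging to $\sigma\in\partial\mathbb{D}$, $\mathrm{Slope}_{\mathbb{D}}(z_n)\subseteq[-\frac{\pi}{2},\frac{\pi}{2}]$ is the set of accumulation points (subsequential limits) of the sequence $\{\arg(1-\overline{\sigma}z_n)\}$. For a curve $\gamma$ landing at $\sigma$, $\mathrm{Slope}_{\mathbb{D}}(\gamma)$ is the cluster set of $\arg(1-\overline{\sigma}\gamma(t))$ as $t\to+\infty$. Lipschitz means with respect to the Euclidean distances. The hyperbolic metric is $\lambda_{\mathbb{D}}(z)|dz|=\frac{|dz|}{1-|z|^2}$, and for a simply connected domain $D\subsetneq\mathbb{C}$, $\lambda_D$ is given by $\lambda_D(\pi(z))|\pi'(z)|=\lambda_{\mathbb{D}}(z)$ for any Riemann map $\pi\colon\mathbb{D}\to D$. $d_{\mathbb{D}}$ is the induced distance, and $\ell_{\mathbb{D}}(\gamma;[t_1,t_2])=\int_{t_1}^{t_2}\lambda_{\mathbb{D}}(\gamma(t))|\gamma'(t)|dt$ for a piecewise $C^1$ curve. A curve $\gamma\colon[0,+\infty)\to\mathbb{D}$ is a hyperbolic quasi-geodesic of $\mathbb{D}$ if there exist $A\ge1$, $B\ge0$ with $\ell_{\mathbb{D}}(\gamma;[t_1,t_2])\le A\,d_{\mathbb{D}}(\gamma(t_1),\gamma(t_2))+B$ for all $0\le t_1<t_2$.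 *)

theory Defs
  imports "HOL-Complex_Analysis.Complex_Analysis"
begin

abbreviation disc :: "complex set" where
  "disc \<equiv> ball 0 1"

definition domain :: "complex set \<Rightarrow> bool" where
  "domain D \<longleftrightarrow> open D \<and> connected D \<and> D \<noteq> {}"

definition univalent_on :: "(complex \<Rightarrow> complex) \<Rightarrow> complex set \<Rightarrow> bool" where
  "univalent_on g D \<longleftrightarrow> g holomorphic_on D \<and> inj_on g D"


subsection \<open>Non-elliptic maps and Koenigs pairs\<close>

definition non_elliptic :: "(complex \<Rightarrow> complex) \<Rightarrow> bool" where
  "non_elliptic f \<longleftrightarrow> f holomorphic_on disc \<and> f ` disc \<subseteq> disc \<and> (\<forall>z\<in>disc. f z \<noteq> z)"

definition is_Denjoy_Wolff_point :: "(complex \<Rightarrow> complex) \<Rightarrow> complex \<Rightarrow> bool" where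
  "is_Denjoy_Wolff_point f \<tau> \<longleftrightarrow>
     \<tau> \<in> sphere 0 1 \<and> (\<forall>z\<in>disc. (\<lambda>n. (f ^^ n) z) \<longlonglongrightarrow> \<tau>)"

definition starlike_at_infinity :: "complex set \<Rightarrow> bool" where
  "starlike_at_infinity D \<longleftrightarrow>
     domain D \<and> (\<forall>t::real\<ge>0. (\<lambda>w. w + of_real t) ` D \<subseteq> D)"

definition left_saturation :: "complex set \<Rightarrow> complex set" where
  "left_saturation D = (\<Union>n\<in>{1::nat..}. (\<lambda>w. w - of_nat n) ` D)"

definition asymptotically_starlike_at_infinity :: "complex set \<Rightarrow> bool" where
  "asymptotically_starlike_at_infinity D \<longleftrightarrow>
     domain D \<and> (\<lambda>w. w + 1) ` D \<subseteq> D \<and> starlike_at_infinity (left_saturation D)"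

definition fundamental_domain :: "(complex \<Rightarrow> complex) \<Rightarrow> complex set \<Rightarrow> bool" where
  "fundamental_domain f U \<longleftrightarrow>
     domain U \<and> simply_connected U \<and> U \<subseteq> disc \<and> univalent_on f U \<and> f ` U \<subseteq> U \<and>
     (\<Union>n\<in>{1::nat..}. {z \<in> disc. (f ^^ n) z \<in> U}) = disc"

definition Koenigs_pair ::
  "(complex \<Rightarrow> complex) \<Rightarrow> (complex \<Rightarrow> complex) \<Rightarrow> complex set \<Rightarrow> bool" where
  "Koenigs_pair f h \<Omega> \<longleftrightarrow>
     asymptotically_starlike_at_infinity \<Omega> \<and>
     h holomorphic_on disc \<and> h ` disc = \<Omega> \<and>
     (\<forall>z\<in>disc. h (f z) = h z + 1) \<and>
     (\<exists>U. fundamental_domain f U \<and> univalent_on h U)"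

text \<open>The Koenigs pair of a non-elliptic map is unique up to translation, so the existential
  quantifiers below could equally well be universal ones.\<close>

definition hyperbolic_map :: "(complex \<Rightarrow> complex) \<Rightarrow> bool" where
  "hyperbolic_map f \<longleftrightarrow> non_elliptic f \<and>
     (\<exists>h \<Omega>. Koenigs_pair f h \<Omega> \<and>
        (\<exists>a b. a < b \<and> left_saturation \<Omega> = {w. a < Im w \<and> Im w < b}))"

definition parabolic_zero_step :: "(complex \<Rightarrow> complex) \<Rightarrow> bool" where
  "parabolic_zero_step f \<longleftrightarrow> non_elliptic f \<and>
     (\<exists>h \<Omega>. Koenigs_pair f h \<Omega> \<and> left_saturation \<Omega> = UNIV)"

definition semigroup_fication ::
  "(complex \<Rightarrow> complex) \<Rightarrow> complex set \<Rightarrow> real \<Rightarrow> complex \<Rightarrow> complex" where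
  "semigroup_fication h V t z = inv_into V h (h z + of_real t)"


subsection \<open>Boundary behaviour of sequences and curves in the disc\<close>

definition converges_nontangentially :: "(nat \<Rightarrow> complex) \<Rightarrow> complex \<Rightarrow> bool" where
  "converges_nontangentially z \<sigma> \<longleftrightarrow>
     (\<forall>n. z n \<in> disc) \<and> z \<longlonglongrightarrow> \<sigma> \<and>
     (\<exists>R>1. \<forall>n. norm (\<sigma> - z n) < R * (1 - norm (z n)))"

definition disc_curve :: "(real \<Rightarrow> complex) \<Rightarrow> bool" where
  "disc_curve \<gamma> \<longleftrightarrow> continuous_on {0..} \<gamma> \<and> \<gamma> ` {0..} \<subseteq> disc"

definition lands_at :: "(real \<Rightarrow> complex) \<Rightarrow> complex \<Rightarrow> bool" where
  "lands_at \<gamma> \<sigma> \<longleftrightarrow> \<sigma> \<in> sphere 0 1 \<and> (\<gamma> \<longlongrightarrow> \<sigma>) at_top"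

definition slope_seq :: "complex \<Rightarrow> (nat \<Rightarrow> complex) \<Rightarrow> real set" where
  "slope_seq \<sigma> z =
     {\<theta>. \<exists>r::nat \<Rightarrow> nat. strict_mono r \<and> (\<lambda>n. Arg (1 - cnj \<sigma> * z (r n))) \<longlonglongrightarrow> \<theta>}"

definition slope_curve :: "complex \<Rightarrow> (real \<Rightarrow> complex) \<Rightarrow> real set" where
  "slope_curve \<sigma> \<gamma> =
     {\<theta>. \<exists>s::nat \<Rightarrow> real. (\<forall>n. 0 \<le> s n) \<and> filterlim s at_top sequentially \<and>
          (\<lambda>n. Arg (1 - cnj \<sigma> * \<gamma> (s n))) \<longlonglongrightarrow> \<theta>}"


subsection \<open>Hyperbolic geometry\<close>

definition disc_density :: "complex \<Rightarrow> real" where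
  "disc_density z = 1 / (1 - (norm z)\<^sup>2)"

definition Riemann_map :: "(complex \<Rightarrow> complex) \<Rightarrow> complex set \<Rightarrow> bool" where
  "Riemann_map p D \<longleftrightarrow> univalent_on p disc \<and> p ` disc = D"

definition hyperbolic_density :: "complex set \<Rightarrow> complex \<Rightarrow> real" where
  "hyperbolic_density D w =
     (THE l. \<forall>p. Riemann_map p D \<longrightarrow>
        (\<forall>z\<in>disc. p z = w \<longrightarrow> l * norm (deriv p z) = disc_density z))"

text \<open>The library's \<open>piecewise_C1_differentiable_on\<close> lets the derivative blow up at the
  exceptional points, so that a curve may have infinite length, for which \<open>integral\<close> would return
  \<open>0\<close>. Here the curve has to be continuously differentiable up to the endpoints on each piece.\<close>

definition piecewise_C1_on :: "(real \<Rightarrow> complex) \<Rightarrow> real \<Rightarrow> real \<Rightarrow> bool" where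
  "piecewise_C1_on \<gamma> a b \<longleftrightarrow>
     continuous_on {a..b} \<gamma> \<and>
     (\<exists>P. finite P \<and>
        (\<forall>c d. a \<le> c \<and> c < d \<and> d \<le> b \<and> {c<..<d} \<inter> P = {} \<longrightarrow>
           (\<exists>\<gamma>'. continuous_on {c..d} \<gamma>' \<and>
              (\<forall>t\<in>{c..d}. (\<gamma> has_vector_derivative \<gamma>' t) (at t within {c..d})))))"

definition hyperbolic_length :: "(real \<Rightarrow> complex) \<Rightarrow> real \<Rightarrow> real \<Rightarrow> real" where
  "hyperbolic_length \<gamma> a b =
     integral {a..b} (\<lambda>t. disc_density (\<gamma> t) * norm (vector_derivative \<gamma> (at t)))"

definition hyperbolic_dist :: "complex \<Rightarrow> complex \<Rightarrow> real" where
  "hyperbolic_dist z w =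
     Inf {hyperbolic_length \<gamma> 0 1 | \<gamma>.
            piecewise_C1_on \<gamma> 0 1 \<and> \<gamma> ` {0..1} \<subseteq> disc \<and> \<gamma> 0 = z \<and> \<gamma> 1 = w}"

definition hyperbolic_quasi_geodesic :: "(real \<Rightarrow> complex) \<Rightarrow> bool" where
  "hyperbolic_quasi_geodesic \<gamma> \<longleftrightarrow>
     disc_curve \<gamma> \<and> (\<forall>T>0. piecewise_C1_on \<gamma> 0 T) \<and>
     (\<exists>A\<ge>1. \<exists>B\<ge>0. \<forall>s t. 0 \<le> s \<and> s < t \<longrightarrow>
        hyperbolic_length \<gamma> s t \<le> A * hyperbolic_dist (\<gamma> s) (\<gamma> t) + B)"

end

theory Submission
  imports Defs
begin

text \<open>The Koenigs function \<open>h\<close> turns \<open>f\<close> into the translation by \<open>1\<close> and \<open>\<eta>\<close> into a horizontal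
half-line \<open>w0 + [0, \<infinity>)\<close> in \<open>D = h ` V\<close>; the Cayley transform takes the disc to the
right half-plane and \<open>\<tau>\<close> to infinity. So one studies the curve \<open>orbit t = g (w0 + t)\<close> in
the half-plane, where \<open>g\<close> is the inverse of \<open>h\<close> on \<open>V\<close>, followed by the Cayley transform. As \<open>D\<close> is
starlike at infinity, it contains balls of a fixed radius around all points \<open>w0 + t\<close>, so the
hyperbolic speed of the orbit is bounded (\<open>bounded_speed\<close>). This makes \<open>\<eta>\<close> Lipschitz, and
it makes the behaviour at integer times, that is of the iterates of \<open>f\<close>, decisive: \<open>\<eta>\<close>
lands at \<open>\<tau>\<close> since the iterates converge to \<open>\<tau>\<close>. Non-tangential convergence means that
\<open>|orbit t| / Re (orbit t)\<close> is bounded.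

A quasi-geodesic is non-tangential (\<open>quasi_geodesic_imp_sector\<close>). This is the stability of
quasi-geodesics in the hyperbolic plane. One end of the geodesic is at infinity, and the
classical proof, by contraction of the projection onto the geodesic, needs that excursions
are finite; this follows from Julia's lemma (\<open>julia_rhp\<close>), by which the real part of the orbit
is bounded from below.

For the other claims let \<open>S\<close> be the union of all left translates of \<open>D\<close>. It is invariant under
real translations, so it is a strip, a half-plane or the plane
(\<open>translation_invariant_cases\<close>).

If \<open>S\<close> is a strip or a half-plane, the hyperbolic distance of \<open>orbit t\<close> and \<open>orbit (t + j)\<close> tends
to the distance of \<open>w0\<close> and \<open>w0 + j\<close> in \<open>S\<close> (\<open>displacement_limit\<close>). On the other hand \<open>F\<close>, the
conjugate of \<open>f\<close>, acts in sectors asymptotically like multiplication by its angular derivative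
(\<open>julia_wolff_caratheodory\<close>). For \<open>j = 1\<close> and \<open>j = 2\<close> this gives two equations for the angular
derivative and for a limit direction of the orbit. In a half-plane they have no solution,
hence the convergence is tangential (\<open>halfplane_slope\<close>). In a strip they determine the
direction up to its sign (\<open>strip_slope\<close>), and continuity fixes the sign. In both cases the
angle of the whole curve converges, and both slopes consist of its limit. In a strip the
orbit is always a quasi-geodesic, since \<open>h\<close> contracts and the distance in \<open>S\<close> of points of the
half-line is proportional to the time between them.

If \<open>S\<close> is the plane, then the speed of the orbit tends to \<open>0\<close>, so between consecutive integer
times the angle changes by less and less, and the slopes agree (\<open>plane_slow_variation\<close>).
Suppose that the iterates converge non-tangentially. By hypothesis the densities of \<open>V\<close> and of
the disc are comparable in sectors. If \<open>\<delta> t\<close> is the Euclidean distance from \<open>w0 + t\<close> to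
the complement of \<open>D\<close>, then the piece of the orbit over \<open>[t, t + T \<delta> t]\<close> has length at
most \<open>T\<close>, but for a suitable constant \<open>T\<close> the modulus doubles along it (\<open>plane_doubling\<close>).
Therefore length is bounded linearly by the change of \<open>ln |orbit t|\<close>, hence by the hyperbolic
distance.\<close>

section \<open>The hyperbolic distance of the right half-plane\<close>

definition rhp :: "complex set" where
  "rhp = {z. 0 < Re z}"

text \<open>The pseudo-hyperbolic distance of the right half-plane: if \<open>d\<close> is the hyperbolic distance of
curvature \<open>-4\<close>, the one for which the disc has density \<open>1 / (1 - |z|\<^sup>2)\<close>, then
\<open>rho = tanh d\<close>.\<close>

definition rho :: "complex \<Rightarrow> complex \<Rightarrow> real" where
  "rho x y = norm (x - y) / norm (x + cnj y)"

text \<open>In the same notation \<open>hsq = 4 sinh\<^sup>2 d\<close>. It is an increasing function of \<open>rho\<close> and behaves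
well under scaling, which makes it convenient for sequences that tend to infinity.\<close>

definition hsq :: "complex \<Rightarrow> complex \<Rightarrow> real" where
  "hsq x y = (norm (x - y))\<^sup>2 / (Re x * Re y)"

lemma open_rhp [simp, intro]: "open rhp"
  unfolding rhp_def by (rule open_halfspace_Re_gt)

lemma in_rhp [simp]: "z \<in> rhp \<longleftrightarrow> 0 < Re z"
  by (simp add: rhp_def)

lemma norm_add_cnj_sq: "(norm (x + cnj y))\<^sup>2 = (norm (x - y))\<^sup>2 + 4 * Re x * Re y"
  unfolding cmod_power2 by (simp add: power2_eq_square algebra_simps)

lemma add_cnj_nonzero: "0 < Re x \<Longrightarrow> 0 < Re y \<Longrightarrow> x + cnj y \<noteq> 0"
  by (metis add_pos_pos cnj.sel(1) less_irrefl plus_complex.sel(1) zero_complex.sel(1))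

lemma rho_lt_1:
  assumes "0 < Re x" "0 < Re y"
  shows "rho x y < 1"
proof -
  have "(norm (x - y))\<^sup>2 < (norm (x + cnj y))\<^sup>2"
    using assms by (simp add: norm_add_cnj_sq)
  then have "norm (x - y) < norm (x + cnj y)"
    by (rule power2_less_imp_less) simp
  moreover have "0 < norm (x + cnj y)"
    using add_cnj_nonzero[OF assms] by simp
  ultimately show ?thesis
    by (simp add: rho_def)
qed

lemma rho_nonneg: "0 \<le> rho x y"
  by (simp add: rho_def)

lemma rho_sq:
  assumes "0 < Re x" "0 < Re y"
  shows "(rho x y)\<^sup>2 = hsq x y / (hsq x y + 4)"
proof -
  define m where "m = Re x * Re y"
  have m: "m > 0" using assms by (simp add: m_def)
  then show ?thesis
    unfolding rho_def hsq_def power_divide norm_add_cnj_sq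
    by (simp add: m_def[symmetric] mult.assoc field_simps)
qed

lemma hsq_eq_rho:
  assumes "0 < Re x" "0 < Re y"
  shows "hsq x y = 4 * (rho x y)\<^sup>2 / (1 - (rho x y)\<^sup>2)"
proof -
  have "hsq x y \<ge> 0" using assms by (simp add: hsq_def)
  then show ?thesis
    unfolding rho_sq[OF assms] by (simp add: field_simps)
qed

lemma hsq_nonneg: "0 < Re x \<Longrightarrow> 0 < Re y \<Longrightarrow> 0 \<le> hsq x y"
  by (simp add: hsq_def)

lemma hsq_le_iff_rho_le:
  assumes "0 < Re x" "0 < Re y" "0 < Re u" "0 < Re v"
  shows "hsq x y \<le> hsq u v \<longleftrightarrow> rho x y \<le> rho u v"
proof -
  have "rho x y \<le> rho u v \<longleftrightarrow> (rho x y)\<^sup>2 \<le> (rho u v)\<^sup>2"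
    by (simp add: rho_nonneg abs_le_square_iff[symmetric])
  also have "\<dots> \<longleftrightarrow> hsq x y \<le> hsq u v"
    unfolding rho_sq[OF assms(1,2)] rho_sq[OF assms(3,4)]
    using hsq_nonneg[OF assms(1,2)] hsq_nonneg[OF assms(3,4)]
    by (simp add: field_simps)
  finally show ?thesis by simp
qed

section \<open>The Schwarz--Pick lemma\<close>

text \<open>The Schwarz lemma, applied to \<open>G\<close> followed by the map \<open>(x - a) / (x + cnj a)\<close> with \<open>a = G c\<close>,
which takes the half-plane to the disc and \<open>a\<close> to \<open>0\<close>.\<close>

lemma schwarz_pick_ball:
  assumes hol: "G holomorphic_on ball c r" and r: "0 < r"
    and G: "\<And>w. w \<in> ball c r \<Longrightarrow> 0 < Re (G w)"
  shows "w \<in> ball c r \<Longrightarrow> rho (G w) (G c) \<le> dist c w / r"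
    and "norm (deriv G c) \<le> 2 * Re (G c) / r"
proof -
  define g where "g = (\<lambda>u::complex. G (c + of_real r * u))"
  have in_ball: "c + of_real r * u \<in> ball c r" if "norm u < 1" for u
    using that r by (simp add: dist_norm norm_mult)
  have gpos: "0 < Re (g u)" if "norm u < 1" for u
    using G[OF in_ball[OF that]] by (simp add: g_def)
  have g_hol: "g holomorphic_on ball 0 1"
    unfolding g_def
    by (rule holomorphic_on_compose_gen[OF _ hol, unfolded o_def])
       (use in_ball in \<open>auto intro!: holomorphic_intros\<close>)
  have nz: "g u + cnj (g 0) \<noteq> 0" if "norm u < 1" for u
    using add_cnj_nonzero gpos[OF that] gpos[of 0] by simp
  define s where "s = (\<lambda>u. (g u - g 0) / (g u + cnj (g 0)))"
  have s_hol: "s holomorphic_on ball 0 1"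
    unfolding s_def using nz by (auto intro!: holomorphic_intros g_hol)
  have s0: "s 0 = 0" by (simp add: s_def)
  have s_rho: "norm (s u) = rho (g u) (g 0)" for u
    by (simp add: s_def rho_def norm_divide)
  have s_lt: "norm (s u) < 1" if "norm u < 1" for u
    unfolding s_rho using gpos[OF that] gpos[of 0] by (simp add: rho_lt_1)
  { assume w: "w \<in> ball c r"
    define u where "u = (w - c) / of_real r"
    have u: "norm u < 1" "w = c + of_real r * u"
      using w r by (auto simp: u_def norm_divide dist_norm norm_minus_commute)
    have "norm (s u) \<le> norm u"
      by (rule Schwarz_Lemma(1)[OF s_hol s0 s_lt u(1)]) 
    then have "rho (g u) (g 0) \<le> norm u" by (simp add: s_rho)
    moreover have "norm u = dist c w / r"
      using r by (simp add: u_def norm_divide dist_norm norm_minus_commute)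
    ultimately show "rho (G w) (G c) \<le> dist c w / r"
      by (simp add: g_def u(2)) }
  have "norm (deriv s 0) \<le> 1"
    by (rule Schwarz_Lemma(2)[OF s_hol s0 s_lt, of 0]) auto
  moreover have "(s has_field_derivative deriv G c * of_real r / (G c + cnj (G c))) (at 0)"
  proof -
    have dG: "(G has_field_derivative deriv G c) (at c)"
      using hol r by (simp add: holomorphic_derivI)
    have dG': "(G has_field_derivative deriv G c) (at (c + of_real r * 0))"
      using dG by simp
    have dg: "(g has_field_derivative deriv G c * of_real r) (at 0)"
      unfolding g_def
      by (rule DERIV_chain'[where f = "\<lambda>u. c + of_real r * u" and g = G, OF _ dG']) (auto intro!: derivative_eq_intros)
    have g0: "g 0 = G c" by (simp add: g_def)
    have nz0: "g 0 + cnj (g 0) \<noteq> 0" using nz[of 0] by simp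
    show ?thesis
      unfolding s_def
      by (rule derivative_eq_intros dg refl nz0)+ (use nz0 in \<open>simp add: g0 power2_eq_square\<close>)
  qed
  then have "deriv s 0 = deriv G c * of_real r / (G c + cnj (G c))"
    by (rule DERIV_imp_deriv)
  ultimately have "norm (deriv G c) * r / norm (G c + cnj (G c)) \<le> 1"
    using r by (simp add: norm_divide norm_mult)
  moreover have Gc: "0 < Re (G c)" using G r by simp
  moreover have "G c + cnj (G c) = of_real (2 * Re (G c))"
    by (simp add: complex_eq_iff)
  then have "norm (G c + cnj (G c)) = 2 * Re (G c)"
    using Gc by (simp only: norm_of_real)
  ultimately show "norm (deriv G c) \<le> 2 * Re (G c) / r"
    using r by (simp add: field_simps)
qed

text \<open>The map \<open>u \<mapsto> (y + cnj y u) / (1 - u)\<close> from the disc onto the half-plane that sends \<open>0\<close>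
to \<open>y\<close>, with its inverse \<open>x \<mapsto> (x - y) / (x + cnj y)\<close>.\<close>

lemma rhp_from_disc:
  assumes y: "0 < Re y"
  shows "(\<lambda>u. (y + cnj y * u) / (1 - u)) holomorphic_on ball 0 1"
    and "norm u < 1 \<Longrightarrow> 0 < Re ((y + cnj y * u) / (1 - u))"
    and "0 < Re x \<Longrightarrow> norm ((x - y) / (x + cnj y)) < 1"
    and "0 < Re x \<Longrightarrow>
      (y + cnj y * ((x - y) / (x + cnj y))) / (1 - (x - y) / (x + cnj y)) = x"
proof -
  show "(\<lambda>u. (y + cnj y * u) / (1 - u)) holomorphic_on ball 0 1"
    by (auto intro!: holomorphic_intros)
  have "Re ((y + cnj y * u) * cnj (1 - u)) = Re y * (1 - (norm u)\<^sup>2)"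
    unfolding cmod_power2 by (simp add: algebra_simps power2_eq_square)
  moreover have "0 < Re y * (1 - (norm u)\<^sup>2)" if "norm u < 1"
    using that y by (simp add: abs_square_less_1)
  moreover have "1 - u \<noteq> 0" if "norm u < 1"
    using that by auto
  ultimately show "0 < Re ((y + cnj y * u) / (1 - u))" if "norm u < 1"
    unfolding complex_div_cnj[of _ "1 - u"] Re_divide_of_real of_real_power[symmetric]
    using that by (intro divide_pos_pos) auto
  assume x: "0 < Re x"
  show "norm ((x - y) / (x + cnj y)) < 1"
    using rho_lt_1[OF x y] by (simp add: rho_def norm_divide)
  have nz: "x + cnj y \<noteq> 0" using add_cnj_nonzero[OF x y] .
  have nz2: "y + cnj y \<noteq> 0" using add_cnj_nonzero[OF y y] .
  have 1: "1 - (x - y) / (x + cnj y) = (y + cnj y) / (x + cnj y)"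
    using nz by (simp add: divide_simps)
  have 2: "y + cnj y * ((x - y) / (x + cnj y)) = x * (y + cnj y) / (x + cnj y)"
    using nz by (simp add: divide_simps) (simp add: algebra_simps)
  show "(y + cnj y * ((x - y) / (x + cnj y))) / (1 - (x - y) / (x + cnj y)) = x"
    unfolding 1 2 using nz nz2 by simp
qed

lemma schwarz_pick_rhp:
  assumes hol: "F holomorphic_on rhp" and F: "\<And>z. 0 < Re z \<Longrightarrow> 0 < Re (F z)"
    and x: "0 < Re x" and y: "0 < Re y"
  shows "hsq (F x) (F y) \<le> hsq x y"
proof -
  define \<psi> where "\<psi> = (\<lambda>u. (y + cnj y * u) / (1 - u))"
  define u where "u = (x - y) / (x + cnj y)"
  have u: "norm u < 1" "\<psi> u = x"
    using rhp_from_disc(3,4)[OF y x] by (auto simp: u_def \<psi>_def)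
  have "F \<circ> \<psi> holomorphic_on ball 0 1"
    unfolding \<psi>_def
    by (rule holomorphic_on_compose_gen[OF rhp_from_disc(1)[OF y] hol])
       (auto simp: rhp_from_disc(2)[OF y])
  moreover have "\<And>w. w \<in> ball 0 1 \<Longrightarrow> 0 < Re ((F \<circ> \<psi>) w)"
    unfolding \<psi>_def o_def using F rhp_from_disc(2)[OF y] by simp
  ultimately have "rho ((F \<circ> \<psi>) u) ((F \<circ> \<psi>) 0) \<le> dist 0 u / 1"
    using u by (intro schwarz_pick_ball(1)) (auto simp del: o_apply)
  moreover have "\<psi> 0 = y" by (simp add: \<psi>_def)
  ultimately have "rho (F x) (F y) \<le> rho x y"
    using u by (simp add: u_def rho_def norm_divide)
  then show ?thesis
    using F x y by (simp add: hsq_le_iff_rho_le)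
qed

lemma moebius_deriv_0:
  fixes z :: complex
  shows "((\<lambda>u. (u + z) / (1 + cnj z * u)) has_field_derivative of_real (1 - (norm z)\<^sup>2)) (at 0)"
proof -
  have "z * cnj z = of_real ((norm z)\<^sup>2)" by (simp add: complex_norm_square del: of_real_power)
  then show ?thesis
    by (auto intro!: derivative_eq_intros simp: algebra_simps)
qed

lemma moebius_disc:
  assumes z: "norm z < 1"
  shows "(\<lambda>u. (u + z) / (1 + cnj z * u)) holomorphic_on ball 0 1"
    and "norm u < 1 \<Longrightarrow> norm ((u + z) / (1 + cnj z * u)) < 1"
  using Moebius_function_holomorphic[of "-z" 0] Moebius_function_norm_lt_1[of "-z" u 0] z
  by (auto simp: Moebius_function_def)

text \<open>Infinitesimal Schwarz--Pick with the sharp constant at every point of the disc: move \<open>z\<close> to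
the centre by a disc automorphism first.\<close>

lemma schwarz_pick_disc_rhp:
  assumes hol: "Q holomorphic_on disc" and Q: "\<And>w. w \<in> disc \<Longrightarrow> 0 < Re (Q w)"
    and z: "z \<in> disc"
  shows "norm (deriv Q z) \<le> 2 * Re (Q z) * disc_density z"
proof -
  have nz: "norm z < 1" using z by simp
  define m where "m = (\<lambda>u. (u + z) / (1 + cnj z * u))"
  have m: "m holomorphic_on disc" "\<And>u. norm u < 1 \<Longrightarrow> norm (m u) < 1"
    using moebius_disc[OF nz] by (auto simp: m_def)
  have "Q \<circ> m holomorphic_on disc"
    by (rule holomorphic_on_compose_gen[OF m(1) hol]) (use m(2) in auto)
  then have "norm (deriv (Q \<circ> m) 0) \<le> 2 * Re ((Q \<circ> m) 0) / 1"
    by (rule schwarz_pick_ball(2)) (use m(2) Q in auto)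
  moreover have "((Q \<circ> m) has_field_derivative deriv Q z * of_real (1 - (norm z)\<^sup>2)) (at 0)"
  proof (rule DERIV_chain)
    show "(Q has_field_derivative deriv Q z) (at (m 0))"
      using hol z by (simp add: holomorphic_derivI m_def)
    show "(m has_field_derivative complex_of_real (1 - (cmod z)\<^sup>2)) (at 0)"
      unfolding m_def by (rule moebius_deriv_0)
  qed
  then have "deriv (Q \<circ> m) 0 = deriv Q z * of_real (1 - (norm z)\<^sup>2)"
    by (rule DERIV_imp_deriv)
  moreover have "0 < 1 - (norm z)\<^sup>2"
    using nz by (simp add: abs_square_less_1)
  moreover have "m 0 = z" by (simp add: m_def)
  ultimately have "norm (deriv Q z) * (1 - (norm z)\<^sup>2) \<le> 2 * Re (Q z)"
    by (simp add: norm_mult del: of_real_diff)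
  then show ?thesis
    using \<open>0 < 1 - (norm z)\<^sup>2\<close> by (simp add: disc_density_def field_simps)
qed

section \<open>The Cayley transform\<close>

text \<open>The Cayley transform of the disc onto the right half-plane that sends \<open>\<tau>\<close> to infinity.\<close>

definition cay :: "complex \<Rightarrow> complex \<Rightarrow> complex" where
  "cay \<tau> z = (1 + cnj \<tau> * z) / (1 - cnj \<tau> * z)"

definition icay :: "complex \<Rightarrow> complex \<Rightarrow> complex" where
  "icay \<tau> \<zeta> = \<tau> * ((\<zeta> - 1) / (\<zeta> + 1))"

lemma tau_cnj: "norm \<tau> = 1 \<Longrightarrow> cnj \<tau> * \<tau> = 1" "norm \<tau> = 1 \<Longrightarrow> \<tau> * cnj \<tau> = 1"
  using complex_norm_square[of \<tau>] by (auto simp: mult.commute)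

lemma cay_den_nonzero:
  assumes "norm \<tau> = 1" "norm z < 1" shows "1 - cnj \<tau> * z \<noteq> 0"
proof
  assume "1 - cnj \<tau> * z = 0"
  then have "norm (cnj \<tau> * z) = 1" by (metis eq_iff_diff_eq_0 norm_one)
  then show False using assms by (simp add: norm_mult)
qed

lemma cay_holomorphic:
  assumes "norm \<tau> = 1" shows "cay \<tau> holomorphic_on disc"
  unfolding cay_def using cay_den_nonzero[OF assms] by (auto intro!: holomorphic_intros)

lemma cay_deriv:
  assumes "norm \<tau> = 1" "norm z < 1"
  shows "(cay \<tau> has_field_derivative 2 * cnj \<tau> / (1 - cnj \<tau> * z)\<^sup>2) (at z)"
  unfolding cay_def using cay_den_nonzero[OF assms]
  by (auto intro!: derivative_eq_intros simp: power2_eq_square field_simps)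

lemma Re_cay:
  assumes "norm \<tau> = 1"
  shows "Re (cay \<tau> z) = (1 - (norm z)\<^sup>2) / (norm (1 - cnj \<tau> * z))\<^sup>2"
proof -
  have "Re (cay \<tau> z) = Re ((1 + cnj \<tau> * z) * cnj (1 - cnj \<tau> * z)) / (norm (1 - cnj \<tau> * z))\<^sup>2"
    unfolding cay_def by (subst complex_div_cnj) (simp only: Re_divide_of_real)
  also have "Re ((1 + cnj \<tau> * z) * cnj (1 - cnj \<tau> * z)) = 1 - (norm (cnj \<tau> * z))\<^sup>2"
    unfolding cmod_power2 by (simp add: algebra_simps power2_eq_square)
  finally show ?thesis using assms by (simp add: norm_mult)
qed

lemma cay_pos:
  assumes "norm \<tau> = 1" "norm z < 1" shows "0 < Re (cay \<tau> z)"
  unfolding Re_cay[OF assms(1)] using cay_den_nonzero[OF assms] assms(2)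
  by (simp add: abs_square_less_1)

lemma disc_density_cay:
  assumes "norm \<tau> = 1" "norm z < 1"
  shows "disc_density z = norm (deriv (cay \<tau>) z) / (2 * Re (cay \<tau> z))"
proof -
  have "deriv (cay \<tau>) z = 2 * cnj \<tau> / (1 - cnj \<tau> * z)\<^sup>2"
    by (rule DERIV_imp_deriv[OF cay_deriv[OF assms]])
  then have d: "norm (deriv (cay \<tau>) z) = 2 / (norm (1 - cnj \<tau> * z))\<^sup>2"
    using assms by (simp add: norm_divide norm_mult norm_power)
  have "0 < 1 - (norm z)\<^sup>2" using assms(2) by (simp add: abs_square_less_1)
  moreover have "norm (1 - cnj \<tau> * z) \<noteq> 0" using cay_den_nonzero[OF assms] by simp
  ultimately show ?thesis
    unfolding d Re_cay[OF assms(1)] disc_density_def by (simp add: divide_simps)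
qed

lemma icay_holomorphic: "icay \<tau> holomorphic_on rhp"
  unfolding icay_def
proof (intro holomorphic_intros)
  fix z assume "z \<in> rhp"
  then have "Re (z + 1) \<noteq> 0" by simp
  then show "z + 1 \<noteq> 0" by force
qed

lemma norm_icay:
  assumes "norm \<tau> = 1" "0 < Re \<zeta>" shows "norm (icay \<tau> \<zeta>) < 1"
  using rho_lt_1[OF assms(2), of 1] assms(1)
  by (simp add: icay_def norm_mult norm_divide rho_def)

lemma cay_icay:
  assumes "norm \<tau> = 1" "0 < Re \<zeta>" shows "cay \<tau> (icay \<tau> \<zeta>) = \<zeta>"
proof -
  have nz: "\<zeta> + 1 \<noteq> 0" using assms(2) by (metis add_pos_pos less_irrefl one_complex.sel(1) plus_complex.sel(1) zero_complex.sel(1) zero_less_one)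
  have e: "cnj \<tau> * icay \<tau> \<zeta> = (\<zeta> - 1) / (\<zeta> + 1)"
    unfolding icay_def by (simp add: tau_cnj[OF assms(1)] mult.assoc[symmetric] del: times_divide_eq_right)
  show ?thesis
    unfolding cay_def e using nz by (simp add: divide_simps)
qed

lemma icay_cay:
  assumes "norm \<tau> = 1" "norm z < 1" shows "icay \<tau> (cay \<tau> z) = z"
proof -
  have nz: "1 - cnj \<tau> * z \<noteq> 0" using cay_den_nonzero[OF assms] .
  have 1: "cay \<tau> z - 1 = 2 * (cnj \<tau> * z) / (1 - cnj \<tau> * z)" 
    and 2: "cay \<tau> z + 1 = 2 / (1 - cnj \<tau> * z)"
    unfolding cay_def using nz by (simp_all add: divide_simps)
  show ?thesis
    unfolding icay_def 1 2 using nz tau_cnj[OF assms(1)]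
    by (simp add: mult.assoc[symmetric])
qed

section \<open>Julia's lemma and the angular derivative\<close>

text \<open>Julia's lemma at the Denjoy--Wolff point, moved to infinity. Since the orbit \<open>X n\<close> tends to
infinity, \<open>Re (1 / X n)\<close> is positive and tends to \<open>0\<close>, so it decreases at infinitely many steps.
Along those steps the Schwarz--Pick inequality between \<open>y\<close> and \<open>X n\<close>, multiplied by a suitable
factor, has a limit, and the limit says that \<open>F\<close> maps every half-plane \<open>{Re > c}\<close> into itself.\<close>

lemma julia_rhp:
  assumes hol: "F holomorphic_on rhp" and F: "\<And>z. 0 < Re z \<Longrightarrow> 0 < Re (F z)"
    and x0: "0 < Re x0" and div: "filterlim (\<lambda>n. (F ^^ n) x0) at_infinity sequentially"
    and y: "0 < Re y"
  shows "Re y \<le> Re (F y)"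
proof -
  define X where "X = (\<lambda>n. (F ^^ n) x0)"
  have Xpos: "0 < Re (X n)" for n
    by (induction n) (auto simp: X_def x0 F)
  have XS: "X (Suc n) = F (X n)" for n by (simp add: X_def)
  have inv0: "(\<lambda>n. inverse (X n)) \<longlonglongrightarrow> 0"
    using div unfolding X_def by (rule filterlim_compose[OF tendsto_inverse_0])
  define q where "q = (\<lambda>n. Re (inverse (X n)))"
  have q_eq: "q n = Re (X n) / (norm (X n))\<^sup>2" for n
    by (simp add: q_def cmod_power2)
  have Xnz: "X n \<noteq> 0" for n using Xpos[of n] by force
  have qpos: "0 < q n" for n
    unfolding q_eq using Xpos[of n] Xnz[of n] by simp
  have q0: "q \<longlonglongrightarrow> 0"
    unfolding q_def using tendsto_Re[OF inv0] by simp
  have "\<exists>k\<ge>n. q (Suc k) \<le> q k" for n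
  proof (rule ccontr)
    assume "\<not> ?thesis"
    then have inc: "q k < q (Suc k)" if "k \<ge> n" for k using that by force
    have "q n \<le> q k" if "k \<ge> n" for k
      using that by (induction rule: dec_induct) (use inc in \<open>auto intro: order.trans less_imp_le\<close>)
    then have "q n \<le> 0"
      by (intro LIMSEQ_le_const[OF q0]) auto
    then show False using qpos[of n] by simp
  qed
  then obtain k where k: "\<And>n. k n \<ge> n" "\<And>n. q (Suc (k n)) \<le> q (k n)" by metis
  have klim: "filterlim k at_top sequentially"
    by (rule filterlim_at_top_mono[OF filterlim_ident]) (use k in auto)
  have kSlim: "filterlim (\<lambda>n. Suc (k n)) at_top sequentially"
    by (rule filterlim_compose[OF filterlim_Suc klim])
  have key: "(norm (F y * inverse (X (Suc m)) - 1))\<^sup>2 * Re y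
      \<le> (norm (y * inverse (X m) - 1))\<^sup>2 * Re (F y)" if m: "q (Suc m) \<le> q m" for m
  proof -
    have "(norm (F y - X (Suc m)))\<^sup>2 / (Re (F y) * Re (X (Suc m))) \<le> (norm (y - X m))\<^sup>2 / (Re y * Re (X m))"
      using schwarz_pick_rhp[OF hol F y Xpos[of m]] by (simp add: hsq_def XS)
    moreover have "(norm (F y - X (Suc m)))\<^sup>2 = (norm (F y * inverse (X (Suc m)) - 1))\<^sup>2 * (norm (X (Suc m)))\<^sup>2"
      using Xnz[of "Suc m"] by (simp add: power_mult_distrib[symmetric] norm_mult[symmetric] algebra_simps)
    moreover have "(norm (y - X m))\<^sup>2 = (norm (y * inverse (X m) - 1))\<^sup>2 * (norm (X m))\<^sup>2"
      using Xnz[of "m"] by (simp add: power_mult_distrib[symmetric] norm_mult[symmetric] algebra_simps)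
    ultimately have *: "(norm (F y * inverse (X (Suc m)) - 1))\<^sup>2 / (Re (F y) * q (Suc m))
        \<le> (norm (y * inverse (X m) - 1))\<^sup>2 / (Re y * q m)"
      by (simp add: q_eq)
    define a where "a = (norm (F y * inverse (X (Suc m)) - 1))\<^sup>2"
    define b where "b = (norm (y * inverse (X m) - 1))\<^sup>2"
    have "a * (Re y * q m) \<le> b * (Re (F y) * q (Suc m))"
      using * qpos[of m] qpos[of "Suc m"] y F[OF y] unfolding a_def[symmetric] b_def[symmetric]
      by (simp add: divide_simps mult.commute)
    also have "\<dots> \<le> b * (Re (F y) * q m)"
      using m F[OF y] by (intro mult_left_mono) (auto simp: b_def)
    finally have "(a * Re y) * q m \<le> (b * Re (F y)) * q m" by (simp add: mult_ac)
    then show ?thesis using qpos[of m] by (simp add: a_def b_def)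
  qed
  have l1: "(\<lambda>n. (norm (F y * inverse (X (Suc (k n))) - 1))\<^sup>2 * Re y) \<longlonglongrightarrow> (norm (F y * 0 - 1))\<^sup>2 * Re y"
    by (intro tendsto_intros filterlim_compose[OF inv0 kSlim])
  have l2: "(\<lambda>n. (norm (y * inverse (X (k n)) - 1))\<^sup>2 * Re (F y)) \<longlonglongrightarrow> (norm (y * 0 - 1))\<^sup>2 * Re (F y)"
    by (intro tendsto_intros filterlim_compose[OF inv0 klim])
  have "(norm (F y * 0 - 1))\<^sup>2 * Re y \<le> (norm (y * 0 - 1))\<^sup>2 * Re (F y)"
    by (rule LIMSEQ_le[OF l1 l2]) (use key k in auto)
  then show ?thesis by simp
qed

text \<open>The angular derivative at infinity is \<open>\<beta> = inf (Re F / Re)\<close>. For small \<open>d > 0\<close> the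
function \<open>q z = F z - (\<beta> - d) z\<close> still has positive real part, but
\<open>Re (q w) \<le> 2 d Re w\<close> for some \<open>w\<close>. Schwarz--Pick between \<open>w\<close> and \<open>z\<close> then bounds \<open>|q z|\<close> by a
multiple of \<open>d |z|\<close> when \<open>z\<close> tends to infinity in a sector.\<close>

lemma julia_wolff_caratheodory:
  assumes hol: "F holomorphic_on rhp" and F: "\<And>z. 0 < Re z \<Longrightarrow> Re z \<le> Re (F z)"
  shows "\<exists>\<beta>::real\<ge>1. \<forall>K>0. \<forall>e>0. \<exists>R. \<forall>z. 0 < Re z \<longrightarrow> norm z \<le> K * Re z \<longrightarrow> R \<le> norm z \<longrightarrow>
           norm (F z / z - of_real \<beta>) \<le> e"
proof -
  define \<beta> where "\<beta> = (INF z\<in>rhp. Re (F z) / Re z)"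
  have low: "1 \<le> Re (F z) / Re z" if "0 < Re z" for z
    using F[OF that] that by simp
  have bdd: "bdd_below ((\<lambda>z. Re (F z) / Re z) ` rhp)"
    by (rule bdd_belowI[of _ 1]) (use low in auto)
  have ne: "rhp \<noteq> {}" using in_rhp[of 1] by force
  have b1: "1 \<le> \<beta>" unfolding \<beta>_def by (rule cINF_greatest[OF ne]) (use low in auto)
  have ble: "\<beta> * Re z \<le> Re (F z)" if "0 < Re z" for z
  proof -
    have "\<beta> \<le> Re (F z) / Re z"
      unfolding \<beta>_def by (rule cINF_lower[OF bdd]) (use that in auto)
    then show ?thesis using that by (simp add: field_simps)
  qed
  have main: "\<exists>R. \<forall>z. 0 < Re z \<longrightarrow> norm z \<le> K * Re z \<longrightarrow> R \<le> norm z \<longrightarrow>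
           norm (F z / z - of_real \<beta>) \<le> (2 + 32 * K) * d" if K: "0 < K" and d: "0 < d" for K d :: real
  proof -
    define q where "q = (\<lambda>z. F z - of_real (\<beta> - d) * z)"
    have q_hol: "q holomorphic_on rhp" unfolding q_def by (intro holomorphic_intros hol)
    have Req: "Re (q z) = Re (F z) - (\<beta> - d) * Re z" for z by (simp add: q_def)
    have qpos: "0 < Re (q z)" if "0 < Re z" for z
    proof -
      have "0 < d * Re z" using d that by simp
      then show ?thesis unfolding Req using ble[OF that] by (simp add: algebra_simps)
    qed
    obtain w where w: "0 < Re w" "Re (F w) / Re w < \<beta> + d"
    proof -
      have "\<beta> < \<beta> + d" using d by simp
      then have "\<exists>w\<in>rhp. Re (F w) / Re w < \<beta> + d"
        using cINF_less_iff[OF ne bdd, of "\<beta> + d"] by (simp only: \<beta>_def[symmetric])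
      then show ?thesis using that by auto
    qed
    have qw: "Re (q w) \<le> 2 * d * Re w"
      using w unfolding Req by (simp add: field_simps)
    define R where "R = max (max 1 (norm w)) (2 * norm (q w) / d)"
    have "norm (F z / z - of_real \<beta>) \<le> (2 + 32 * K) * d"
      if z: "0 < Re z" "norm z \<le> K * Re z" "R \<le> norm z" for z
    proof -
      have nz: "0 < norm z" "norm w \<le> norm z" "2 * norm (q w) \<le> d * norm z"
        using z(3) d by (auto simp: R_def field_simps)
      have "hsq (q z) (q w) \<le> hsq z w"
        by (rule schwarz_pick_rhp[OF q_hol qpos z(1) w(1)])
      then have h: "(norm (q z - q w))\<^sup>2 \<le> (norm (z - w))\<^sup>2 / (Re z * Re w) * (Re (q z) * Re (q w))"
        using qpos[OF z(1)] qpos[OF w(1)] by (simp add: hsq_def pos_divide_le_eq)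
      have zw: "(norm (z - w))\<^sup>2 \<le> (2 * norm z)\<^sup>2"
        using nz norm_triangle_ineq4[of z w] by (intro power_mono) auto
      have "(norm (z - w))\<^sup>2 / (Re z * Re w) * (Re (q z) * Re (q w))
          \<le> (2 * norm z)\<^sup>2 / (Re z * Re w) * (Re (q z) * (2 * d * Re w))"
        using zw qw qpos[OF z(1)] qpos[OF w(1)] z w d
        by (intro mult_mono divide_right_mono mult_left_mono) auto
      also have "\<dots> = 8 * d * Re (q z) * norm z * (norm z / Re z)"
        using z w by (simp add: field_simps power2_eq_square)
      also have "\<dots> \<le> 8 * d * Re (q z) * norm z * K"
        using z d qpos[OF z(1)] by (intro mult_left_mono) (auto simp: field_simps)
      also have "\<dots> \<le> 8 * d * norm (q z) * norm z * K"
        using d K by (intro mult_right_mono mult_left_mono complex_Re_le_cmod) auto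
      finally have h2: "(norm (q z - q w))\<^sup>2 \<le> 8 * d * norm (q z) * norm z * K"
        using h by simp
      have "norm (q z) \<le> (1 + 32 * K) * d * norm z"
      proof (cases "norm (q z) \<le> 2 * norm (q w)")
        case True
        then have "norm (q z) \<le> d * norm z" using nz by simp
        also have "\<dots> \<le> (1 + 32 * K) * d * norm z" using d K nz by (simp add: algebra_simps)
        finally show ?thesis .
      next
        case False
        then have "norm (q z) / 2 \<le> norm (q z - q w)"
          using norm_triangle_ineq2[of "q z" "q w"] by simp
        then have "(norm (q z) / 2)\<^sup>2 \<le> (norm (q z - q w))\<^sup>2"
          by (intro power_mono) auto
        with h2 have "norm (q z) * norm (q z) \<le> norm (q z) * (32 * d * norm z * K)"
          by (simp add: power2_eq_square field_simps)
        moreover have "0 < norm (q z)" using False by (smt (verit) norm_ge_zero)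
        ultimately have "norm (q z) \<le> 32 * d * norm z * K" by simp
        also have "\<dots> \<le> (1 + 32 * K) * d * norm z" using d K nz by (simp add: algebra_simps)
        finally show ?thesis .
      qed
      moreover have "F z / z - of_real \<beta> = q z / z - of_real d"
        using nz by (auto simp: q_def field_simps)
      then have "norm (F z / z - of_real \<beta>) \<le> norm (q z) / norm z + d"
        using norm_triangle_ineq4[of "q z / z" "of_real d"] d by (simp add: norm_divide)
      moreover have "norm (q z) / norm z \<le> (1 + 32 * K) * d"
        using calculation(1) nz by (simp add: pos_divide_le_eq)
      ultimately show ?thesis by (simp add: algebra_simps)
    qed
    then show ?thesis by blast
  qed
  show ?thesis
  proof (rule exI[of _ \<beta>], intro conjI b1 allI impI)
    fix K e :: real assume K: "0 < K" and e: "0 < e"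
    have "0 < e / (2 + 32 * K)" using K e by simp
    from main[OF K this] show "\<exists>R. \<forall>z. 0 < Re z \<longrightarrow> norm z \<le> K * Re z \<longrightarrow> R \<le> norm z \<longrightarrow>
           norm (F z / z - of_real \<beta>) \<le> e"
      using K by simp
  qed
qed

section \<open>Hyperbolic density, length and distance\<close>

lemma disc_density_pos: "norm z < 1 \<Longrightarrow> 0 < disc_density z"
  by (simp add: disc_density_def abs_square_less_1)

lemma schwarz_pick_disc:
  assumes hol: "\<phi> holomorphic_on disc" and \<phi>: "\<And>w. w \<in> disc \<Longrightarrow> \<phi> w \<in> disc" and z: "z \<in> disc"
  shows "disc_density (\<phi> z) * norm (deriv \<phi> z) \<le> disc_density z"
proof -
  have "cay 1 \<circ> \<phi> holomorphic_on disc"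
    by (rule holomorphic_on_compose_gen[OF hol cay_holomorphic]) (use \<phi> in auto)
  then have "norm (deriv (cay 1 \<circ> \<phi>) z) \<le> 2 * Re ((cay 1 \<circ> \<phi>) z) * disc_density z"
    by (rule schwarz_pick_disc_rhp) (use \<phi> z cay_pos[of 1] in auto)
  moreover have "deriv (cay 1 \<circ> \<phi>) z = deriv (cay 1) (\<phi> z) * deriv \<phi> z"
    using hol cay_holomorphic[of 1] \<phi>[OF z] z
    by (intro deriv_chain) (auto simp: holomorphic_on_imp_differentiable_at)
  moreover have "0 < Re (cay 1 (\<phi> z))" using cay_pos[of 1] \<phi>[OF z] by auto
  moreover have "disc_density (\<phi> z) = norm (deriv (cay 1) (\<phi> z)) / (2 * Re (cay 1 (\<phi> z)))"
    using \<phi>[OF z] by (intro disc_density_cay) auto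
  ultimately have "norm (deriv (cay 1) (\<phi> z)) * norm (deriv \<phi> z) / (2 * Re (cay 1 (\<phi> z))) \<le> disc_density z"
    by (simp add: norm_mult pos_divide_le_eq mult_ac)
  then show ?thesis
    using \<open>disc_density (\<phi> z) = _\<close> by simp
qed

text \<open>Used in both directions, this shows that two Riemann maps of \<open>V\<close> assign the same density to a
point, so that the definite description in \<open>hyperbolic_density\<close> denotes something.\<close>

lemma Riemann_maps_density_le:
  assumes p: "Riemann_map p V" "Riemann_map q V" and z: "z \<in> disc" "u \<in> disc" "p z = q u"
  shows "disc_density z * norm (deriv q u) \<le> disc_density u * norm (deriv p z)"
proof -
  have p_hol: "p holomorphic_on disc" "inj_on p disc" "p ` disc = V"
    and q_hol: "q holomorphic_on disc" "q ` disc = V"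
    using p by (auto simp: Riemann_map_def univalent_on_def)
  obtain r where r: "r holomorphic_on (p ` disc)" "\<And>z. z \<in> disc \<Longrightarrow> deriv p z * deriv r (p z) = 1"
      "\<And>z. z \<in> disc \<Longrightarrow> r (p z) = z"
    using holomorphic_has_inverse[OF p_hol(1) open_ball p_hol(2)] by blast
  have oV: "open V"
    using open_mapping_thm3[OF p_hol(1) open_ball p_hol(2)] p_hol(3) by simp
  have rV: "r w \<in> disc" if "w \<in> V" for w using that r(3) p_hol(3) by auto
  have "disc_density ((r \<circ> q) u) * norm (deriv (r \<circ> q) u) \<le> disc_density u"
  proof (rule schwarz_pick_disc)
    show "r \<circ> q holomorphic_on disc"
      by (rule holomorphic_on_compose[OF q_hol(1)]) (use r(1) p_hol(3) q_hol(2) in simp)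
  qed (use rV q_hol(2) z in auto)
  moreover have "deriv (r \<circ> q) u = deriv r (q u) * deriv q u"
  proof (rule deriv_chain)
    show "q field_differentiable at u" using q_hol(1) z(2) by (auto simp: holomorphic_on_imp_differentiable_at)
    show "r field_differentiable at (q u)"
    proof (rule holomorphic_on_imp_differentiable_at[OF _ oV])
      show "r holomorphic_on V" using r(1) p_hol(3) by simp
      show "q u \<in> V" using q_hol(2) z(2) by blast
    qed
  qed
  ultimately have "disc_density z * (norm (deriv r (p z)) * norm (deriv q u)) \<le> disc_density u"
    using z r(3)[OF z(1)] by (simp add: norm_mult)
  then have "disc_density z * (norm (deriv r (p z)) * norm (deriv q u)) * norm (deriv p z)
      \<le> disc_density u * norm (deriv p z)"
    by (intro mult_right_mono) auto
  moreover have "norm (deriv p z) * norm (deriv r (p z)) = 1"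
    using r(2)[OF z(1)] by (simp add: norm_mult[symmetric])
  then have "disc_density z * (norm (deriv r (p z)) * norm (deriv q u)) * norm (deriv p z)
      = disc_density z * norm (deriv q u)"
    by (metis (no_types, lifting) mult.commute mult.left_commute mult_1)
  ultimately show ?thesis by simp
qed

text \<open>Schwarz--Pick for a map from \<open>V\<close> into the half-plane. This is how the density of \<open>V\<close> gets
bounded from below: a function \<open>Q\<close> that varies fast forces it to be large.\<close>

lemma hyperbolic_density_rhp:
  assumes V: "domain V" "simply_connected V" "V \<subseteq> disc" and w: "w \<in> V"
    and Q: "Q holomorphic_on V" "\<And>z. z \<in> V \<Longrightarrow> 0 < Re (Q z)"
  shows "norm (deriv Q w) \<le> 2 * Re (Q w) * hyperbolic_density V w"
proof -
  have oV: "open V" and neV: "V \<noteq> {}" using V by (auto simp: domain_def)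
  have "1 \<notin> disc" by simp
  then have "V \<noteq> UNIV" using V(3) by blast
  with Riemann_mapping_theorem[of V] oV V(2) neV
  obtain r p where rp: "r holomorphic_on V" "p holomorphic_on disc"
    "\<And>z. z \<in> V \<Longrightarrow> r z \<in> disc \<and> p (r z) = z" "\<And>z. z \<in> disc \<Longrightarrow> p z \<in> V \<and> r (p z) = z" by blast
  have p: "Riemann_map p V"
  proof -
    have "inj_on p disc" by (metis inj_onI rp(4))
    moreover have "p ` disc = V" using rp by force
    ultimately show ?thesis using rp(2) by (simp add: Riemann_map_def univalent_on_def)
  qed
  define z where "z = r w"
  have z: "z \<in> disc" "p z = w" using rp(3)[OF w] by (auto simp: z_def)
  have pz: "deriv p z \<noteq> 0"
    using holomorphic_injective_imp_regular[of p disc z] p z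
    by (auto simp: Riemann_map_def univalent_on_def)
  define l where "l = disc_density z / norm (deriv p z)"
  have "hyperbolic_density V w = l"
    unfolding hyperbolic_density_def
  proof (rule the_equality)
    show "\<forall>q. Riemann_map q V \<longrightarrow> (\<forall>u\<in>disc. q u = w \<longrightarrow> l * norm (deriv q u) = disc_density u)"
    proof (intro allI impI ballI)
      fix q u assume q: "Riemann_map q V" and u: "u \<in> disc" "q u = w"
      have "disc_density z * norm (deriv q u) = disc_density u * norm (deriv p z)"
        using Riemann_maps_density_le[OF p q z(1) u(1)] Riemann_maps_density_le[OF q p u(1) z(1)] z u
        by simp
      then show "l * norm (deriv q u) = disc_density u"
        using pz by (simp add: l_def field_simps)
    qed
  next
    fix l' assume "\<forall>q. Riemann_map q V \<longrightarrow> (\<forall>u\<in>disc. q u = w \<longrightarrow> l' * norm (deriv q u) = disc_density u)"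
    then have "l' * norm (deriv p z) = disc_density z" using p z by blast
    then show "l' = l" using pz by (simp add: l_def field_simps)
  qed
  moreover have "norm (deriv (Q \<circ> p) z) \<le> 2 * Re ((Q \<circ> p) z) * disc_density z"
  proof (rule schwarz_pick_disc_rhp[OF _ _ z(1)])
    show "Q \<circ> p holomorphic_on disc"
      by (rule holomorphic_on_compose_gen[OF rp(2) Q(1)]) (use rp(4) in auto)
  qed (use rp(4) Q(2) in auto)
  moreover have "deriv (Q \<circ> p) z = deriv Q w * deriv p z"
    using rp(2) Q(1) z w oV
    by (subst deriv_chain) (auto simp: holomorphic_on_imp_differentiable_at)
  ultimately have "norm (deriv Q w) * norm (deriv p z) \<le>
      (2 * Re (Q w) * hyperbolic_density V w) * norm (deriv p z)"
    using z pz by (simp add: l_def norm_mult)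
  then show ?thesis using pz by simp
qed

text \<open>Without integrability \<open>hyperbolic_length\<close> would be the default value \<open>0\<close> of the integral, and no
lower bound for it could hold. The induction splits the interval at the exceptional points.\<close>

lemma piecewise_C1_integrable:
  assumes "piecewise_C1_on \<gamma> a b" "\<gamma> ` {a..b} \<subseteq> disc"
  shows "(\<lambda>t. disc_density (\<gamma> t) * norm (vector_derivative \<gamma> (at t))) integrable_on {a..b}"
proof -
  let ?I = "\<lambda>t. disc_density (\<gamma> t) * norm (vector_derivative \<gamma> (at t))"
  have main: "?I integrable_on {a..b}"
    if "finite P" and "continuous_on {a..b} \<gamma>" and "\<gamma> ` {a..b} \<subseteq> disc"
      and "\<And>c d. a \<le> c \<Longrightarrow> c < d \<Longrightarrow> d \<le> b \<Longrightarrow> {c<..<d} \<inter> P = {} \<Longrightarrow>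
           (\<exists>\<gamma>'. continuous_on {c..d} \<gamma>' \<and>
              (\<forall>t\<in>{c..d}. (\<gamma> has_vector_derivative \<gamma>' t) (at t within {c..d})))"
    for P a b
    using that
  proof (induction P arbitrary: a b rule: finite_induct)
    case empty
    show ?case
    proof (cases "a < b")
      case False
      then show ?thesis
        using integrable_on_refl[where f = ?I and a = b] by (cases "a = b") auto
    next
      case True
      obtain \<gamma>' where g: "continuous_on {a..b} \<gamma>'"
          "\<forall>t\<in>{a..b}. (\<gamma> has_vector_derivative \<gamma>' t) (at t within {a..b})"
        using empty.prems(3)[of a b] True by auto
      have "(\<lambda>t. disc_density (\<gamma> t) * norm (\<gamma>' t)) integrable_on {a..b}"
      proof (rule integrable_continuous_interval)
        have "1 - (norm (\<gamma> t))\<^sup>2 \<noteq> 0" if "t \<in> {a..b}" for t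
          using empty.prems(2) that by (fastforce simp: abs_square_eq_1 image_subset_iff)
        then show "continuous_on {a..b} (\<lambda>t. disc_density (\<gamma> t) * norm (\<gamma>' t))"
          unfolding disc_density_def by (intro continuous_intros empty.prems g) auto
      qed
      then show ?thesis
      proof (rule integrable_spike_finite[rotated 2, where S="{a,b}"])
        fix t assume "t \<in> {a..b} - {a, b}"
        then have t: "t \<in> {a<..<b}" by auto
        then have "(\<gamma> has_vector_derivative \<gamma>' t) (at t)"
          using g(2) by (metis at_within_Icc_at greaterThanLessThan_iff less_imp_le atLeastAtMost_iff)
        then have "vector_derivative \<gamma> (at t) = \<gamma>' t" by (rule vector_derivative_at)
        then show "?I t = disc_density (\<gamma> t) * norm (\<gamma>' t)" by simp
      qed auto
    qed
  next
    case (insert p P)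
    show ?case
    proof (cases "a < p \<and> p < b")
      case False
      show ?thesis
      proof (rule insert.IH[OF insert.prems(1,2)])
        fix c d assume cd: "a \<le> c" "c < d" "d \<le> b" "{c<..<d} \<inter> P = {}"
        then have "{c<..<d} \<inter> insert p P = {}" using False by auto
        then show "\<exists>\<gamma>'. continuous_on {c..d} \<gamma>' \<and>
              (\<forall>t\<in>{c..d}. (\<gamma> has_vector_derivative \<gamma>' t) (at t within {c..d}))"
          by (rule insert.prems(3)[OF cd(1-3)])
      qed
    next
      case True
      have "?I integrable_on {a..p}"
      proof (rule insert.IH)
        fix c d assume cd: "a \<le> c" "c < d" "d \<le> p" "{c<..<d} \<inter> P = {}"
        then have "{c<..<d} \<inter> insert p P = {}" "d \<le> b" using True by auto
        then show "\<exists>\<gamma>'. continuous_on {c..d} \<gamma>' \<and>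
              (\<forall>t\<in>{c..d}. (\<gamma> has_vector_derivative \<gamma>' t) (at t within {c..d}))"
          using insert.prems(3)[OF cd(1-2)] by blast
      qed (use True insert.prems(1,2) in \<open>auto intro: continuous_on_subset\<close>)
      moreover have "?I integrable_on {p..b}"
      proof (rule insert.IH)
        fix c d assume cd: "p \<le> c" "c < d" "d \<le> b" "{c<..<d} \<inter> P = {}"
        then have "{c<..<d} \<inter> insert p P = {}" "a \<le> c" using True by auto
        then show "\<exists>\<gamma>'. continuous_on {c..d} \<gamma>' \<and>
              (\<forall>t\<in>{c..d}. (\<gamma> has_vector_derivative \<gamma>' t) (at t within {c..d}))"
          using insert.prems(3)[OF _ cd(2,3)] by blast
      qed (use True insert.prems(1,2) in \<open>auto intro: continuous_on_subset\<close>)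
      ultimately show ?thesis
        using True by (intro Henstock_Kurzweil_Integration.integrable_combine[where a = a and c = p and b = b]) auto
    qed
  qed
  show ?thesis
    using assms main unfolding piecewise_C1_on_def by blast
qed

lemma piecewise_C1_differentiable:
  assumes "piecewise_C1_on \<gamma> a b"
  obtains P where "finite P" "\<And>t. t \<in> {a<..<b} - P \<Longrightarrow> (\<gamma> has_vector_derivative vector_derivative \<gamma> (at t)) (at t)"
proof -
  obtain P where P: "finite P" "\<And>c d. a \<le> c \<and> c < d \<and> d \<le> b \<and> {c<..<d} \<inter> P = {} \<Longrightarrow>
           (\<exists>\<gamma>'. continuous_on {c..d} \<gamma>' \<and>
              (\<forall>t\<in>{c..d}. (\<gamma> has_vector_derivative \<gamma>' t) (at t within {c..d})))"
    using assms unfolding piecewise_C1_on_def by blast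
  show ?thesis
  proof (rule that[OF P(1)])
    fix t assume t: "t \<in> {a<..<b} - P"
    have "open ({a<..<b} - P)" using P(1) by (simp add: finite_imp_closed open_Diff)
    then obtain e where e: "e > 0" "cball t e \<subseteq> {a<..<b} - P" using t open_contains_cball by blast
    then have sub: "{t-e..t+e} \<subseteq> {a<..<b} - P" by (simp add: cball_eq_atLeastAtMost)
    have "t - e \<in> {t-e..t+e}" "t + e \<in> {t-e..t+e}" using e(1) by auto
    then have "t - e \<in> {a<..<b} - P" "t + e \<in> {a<..<b} - P" using sub by blast+
    then have ab: "a < t - e" "t + e < b" by auto
    have "{t-e<..<t+e} \<subseteq> {t-e..t+e}" by auto
    then have "{t-e<..<t+e} \<inter> P = {}" using sub by blast
    with P(2)[of "t-e" "t+e"] ab e(1)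
    obtain \<gamma>' where "\<forall>s\<in>{t-e..t+e}. (\<gamma> has_vector_derivative \<gamma>' s) (at s within {t-e..t+e})" by auto
    then have "(\<gamma> has_vector_derivative \<gamma>' t) (at t within {t-e..t+e})" using e(1) by simp
    then have "(\<gamma> has_vector_derivative \<gamma>' t) (at t)"
      using e(1) by (simp add: at_within_Icc_at)
    then show "(\<gamma> has_vector_derivative vector_derivative \<gamma> (at t)) (at t)"
      by (simp add: vector_derivative_at)
  qed
qed

text \<open>In the half-plane \<open>ln |x|\<close> changes at most twice as fast as hyperbolic arc length, because
\<open>|x| \<ge> Re x\<close>; and \<open>Q\<close> does not increase hyperbolic length.\<close>

lemma length_lower_bound:
  assumes \<gamma>: "piecewise_C1_on \<gamma> a b" "\<gamma> ` {a..b} \<subseteq> disc" and ab: "a \<le> b"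
    and Q: "Q holomorphic_on disc" "\<And>z. z \<in> disc \<Longrightarrow> 0 < Re (Q z)"
  shows "\<bar>ln (norm (Q (\<gamma> b))) - ln (norm (Q (\<gamma> a)))\<bar> \<le> 2 * hyperbolic_length \<gamma> a b"
proof -
  let ?v = "\<lambda>t. vector_derivative \<gamma> (at t)"
  obtain P where P: "finite P" "\<And>t. t \<in> {a<..<b} - P \<Longrightarrow> (\<gamma> has_vector_derivative ?v t) (at t)"
    using piecewise_C1_differentiable[OF \<gamma>(1)] by blast
  have cont: "continuous_on {a..b} \<gamma>" using \<gamma>(1) by (simp add: piecewise_C1_on_def)
  have in_disc: "\<gamma> t \<in> disc" if "t \<in> {a..b}" for t using \<gamma>(2) that by blast
  have nonneg: "Q z \<notin> \<real>\<^sub>\<le>\<^sub>0" if "z \<in> disc" for z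
    using Q(2)[OF that] by (simp add: complex_nonpos_Reals_iff)
  define \<phi> where "\<phi> = (\<lambda>t. Ln (Q (\<gamma> t)))"
  define d where "d = (\<lambda>t. ?v t * (deriv Q (\<gamma> t) / Q (\<gamma> t)))"
  have "(d has_integral (\<phi> b - \<phi> a)) {a..b}"
  proof (rule fundamental_theorem_of_calculus_interior_strong[OF P(1) ab])
    fix t assume t: "t \<in> {a<..<b} - P"
    then have tz: "\<gamma> t \<in> disc" using in_disc by auto
    have "(Q has_field_derivative deriv Q (\<gamma> t)) (at (\<gamma> t))"
      using Q(1) tz by (simp add: holomorphic_derivI)
    then have "((\<lambda>z. Ln (Q z)) has_field_derivative deriv Q (\<gamma> t) / Q (\<gamma> t)) (at (\<gamma> t))"
      using nonneg[OF tz] by (auto intro!: derivative_eq_intros simp: field_simps)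
    from field_vector_diff_chain_at[OF P(2)[OF t] this]
    show "(\<phi> has_vector_derivative d t) (at t)"
      by (simp add: \<phi>_def d_def o_def)
  next
    have "continuous_on disc (\<lambda>z. Ln (Q z))"
      using nonneg holomorphic_on_imp_continuous_on[OF Q(1)] by (intro continuous_intros) auto
    then show "continuous_on {a..b} \<phi>"
      unfolding \<phi>_def by (rule continuous_on_compose2[OF _ cont]) (use \<gamma>(2) in auto)
  qed
  then have d: "d integrable_on {a..b}" "integral {a..b} d = \<phi> b - \<phi> a"
    by (auto simp: integral_unique)
  have "norm (integral {a..b} d) \<le> integral {a..b} (\<lambda>t. 2 * (disc_density (\<gamma> t) * norm (?v t)))"
  proof (rule integral_norm_bound_integral[OF d(1)])
    show "(\<lambda>t. 2 * (disc_density (\<gamma> t) * norm (?v t))) integrable_on {a..b}"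
      using integrable_cmul[OF piecewise_C1_integrable[OF \<gamma>], of 2] by simp
    fix t assume "t \<in> {a..b}"
    then have z: "\<gamma> t \<in> disc" by (rule in_disc)
    have "norm (deriv Q (\<gamma> t)) \<le> 2 * Re (Q (\<gamma> t)) * disc_density (\<gamma> t)"
      by (rule schwarz_pick_disc_rhp[OF Q z])
    also have "\<dots> \<le> 2 * norm (Q (\<gamma> t)) * disc_density (\<gamma> t)"
      using disc_density_pos[of "\<gamma> t"] z by (intro mult_right_mono mult_left_mono complex_Re_le_cmod) auto
    finally have "norm (deriv Q (\<gamma> t)) / norm (Q (\<gamma> t)) \<le> 2 * disc_density (\<gamma> t)"
      using Q(2)[OF z] by (auto simp: divide_le_eq mult_ac)
    from mult_left_mono[OF this, of "norm (?v t)"]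
    show "norm (d t) \<le> 2 * (disc_density (\<gamma> t) * norm (?v t))"
      by (simp add: d_def norm_mult norm_divide mult_ac)
  qed
  then have "norm (\<phi> b - \<phi> a) \<le> 2 * hyperbolic_length \<gamma> a b"
    unfolding d(2) hyperbolic_length_def by simp
  moreover have "Re (\<phi> b - \<phi> a) = ln (norm (Q (\<gamma> b))) - ln (norm (Q (\<gamma> a)))"
  proof -
    have "Q (\<gamma> a) \<noteq> 0" "Q (\<gamma> b) \<noteq> 0" using Q(2)[OF in_disc[of a]] Q(2)[OF in_disc[of b]] ab by auto
    then show ?thesis by (simp add: \<phi>_def)
  qed
  ultimately show ?thesis
    using abs_Re_le_cmod[of "\<phi> b - \<phi> a"] by simp
qed

lemma hyperbolic_length_nonneg:
  assumes "piecewise_C1_on \<gamma> a b" "\<gamma> ` {a..b} \<subseteq> disc"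
  shows "0 \<le> hyperbolic_length \<gamma> a b"
  unfolding hyperbolic_length_def
proof (rule integral_nonneg[OF piecewise_C1_integrable[OF assms]])
  fix t assume "t \<in> {a..b}"
  then show "0 \<le> disc_density (\<gamma> t) * norm (vector_derivative \<gamma> (at t))"
    using disc_density_pos[of "\<gamma> t"] assms(2) by (auto simp: image_subset_iff intro!: mult_nonneg_nonneg)
qed

text \<open>The geodesic from \<open>z\<close> to \<open>w\<close> is the image of a radius \<open>[0, v]\<close> under a disc automorphism, so its
length is at most \<open>artanh |v| = ln ((1 + |v|) / (1 - |v|)) / 2\<close>. The stated bound uses
\<open>(1 + |v|)\<^sup>2 \<le> 4\<close> and is off by a bounded amount only. The condition on \<open>\<tau>\<close> is
inside the last conclusion so that the lemma also serves where only existence of a curve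
matters.\<close>

lemma geodesic_exists:
  assumes z: "z \<in> disc" and w: "w \<in> disc"
  obtains \<gamma> where "piecewise_C1_on \<gamma> 0 1" "\<gamma> ` {0..1} \<subseteq> disc" "\<gamma> 0 = z" "\<gamma> 1 = w"
    "norm \<tau> = 1 \<Longrightarrow> hyperbolic_length \<gamma> 0 1 \<le> ln (4 + hsq (cay \<tau> z) (cay \<tau> w)) / 2"
proof -
  define \<sigma> where "\<sigma> = (if norm \<tau> = 1 then \<tau> else 1)"
  have \<sigma>: "norm \<sigma> = 1" by (simp add: \<sigma>_def)
  define x where "x = cay \<sigma> z"
  define y where "y = cay \<sigma> w"
  have xy: "0 < Re x" "0 < Re y" using z w cay_pos[OF \<sigma>] by (auto simp: x_def y_def)
  define \<psi> where "\<psi> = (\<lambda>u. (x + cnj x * u) / (1 - u))"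
  define v where "v = (y - x) / (y + cnj x)"
  define M where "M = icay \<sigma> \<circ> \<psi>"
  have v: "norm v < 1" "\<psi> v = y"
    using rhp_from_disc(3,4)[OF xy] by (auto simp: v_def \<psi>_def)
  have M_hol: "M holomorphic_on disc"
    unfolding M_def \<psi>_def
    by (rule holomorphic_on_compose_gen[OF rhp_from_disc(1)[OF xy(1)] icay_holomorphic])
       (use rhp_from_disc(2)[OF xy(1)] in auto)
  have M_disc: "M u \<in> disc" if "u \<in> disc" for u
    unfolding M_def o_def \<psi>_def using rhp_from_disc(2)[OF xy(1)] norm_icay[OF \<sigma>] that by auto
  define \<gamma> where "\<gamma> = (\<lambda>s::real. M (of_real s * v))"
  have sv: "of_real s * v \<in> disc" if "s \<in> {0..1}" for s :: real
  proof -
    have "\<bar>s\<bar> * norm v \<le> 1 * norm v" using that by (intro mult_right_mono) auto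
    then show ?thesis using v(1) by (simp add: norm_mult)
  qed
  define \<gamma>' where "\<gamma>' = (\<lambda>s::real. v * deriv M (of_real s * v))"
  have \<gamma>': "(\<gamma> has_vector_derivative \<gamma>' s) (at s)" if "s \<in> {0..1}" for s
  proof -
    have "(M has_field_derivative deriv M (of_real s * v)) (at (of_real s * v))"
      using M_hol sv[OF that] by (simp add: holomorphic_derivI)
    moreover have "((\<lambda>s. of_real s * v) has_vector_derivative v) (at s)"
      by (auto intro!: derivative_eq_intros)
    ultimately show ?thesis
      unfolding \<gamma>_def \<gamma>'_def by (rule field_vector_diff_chain_at[unfolded o_def, rotated])
  qed
  have cM': "continuous_on disc (deriv M)"
    using M_hol by (intro holomorphic_on_imp_continuous_on holomorphic_deriv) auto
  have c\<gamma>': "continuous_on {0..1} \<gamma>'"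
    unfolding \<gamma>'_def by (intro continuous_intros continuous_on_compose2[OF cM']) (use sv in auto)
  have 1: "piecewise_C1_on \<gamma> 0 1"
    unfolding piecewise_C1_on_def
  proof (intro conjI exI[of _ "{}"] allI impI)
    show "continuous_on {0..1} \<gamma>"
      using has_vector_derivative_continuous[OF \<gamma>'] by (intro continuous_at_imp_continuous_on) auto
    fix c d :: real assume "0 \<le> c \<and> c < d \<and> d \<le> 1 \<and> {c<..<d} \<inter> {} = {}"
    then show "\<exists>\<gamma>'. continuous_on {c..d} \<gamma>' \<and> (\<forall>t\<in>{c..d}. (\<gamma> has_vector_derivative \<gamma>' t) (at t within {c..d}))"
      using \<gamma>' by (intro exI[of _ \<gamma>'])
        (auto intro: continuous_on_subset[OF c\<gamma>'] has_vector_derivative_at_within)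
  qed simp
  have 2: "\<gamma> ` {0..1} \<subseteq> disc" using M_disc sv by (auto simp: \<gamma>_def)
  have "\<psi> 0 = x" by (simp add: \<psi>_def)
  then have 3: "\<gamma> 0 = z" "\<gamma> 1 = w"
    using v icay_cay[OF \<sigma>] z w by (auto simp: \<gamma>_def M_def x_def y_def)
  define r where "r = norm v"
  have r: "0 \<le> r" "r < 1" using v by (auto simp: r_def)
  have rs: "r * s < 1" if "s \<in> {0..1}" for s :: real
  proof -
    have "r * s \<le> r * 1" using that r by (intro mult_left_mono) auto
    then show ?thesis using r by simp
  qed
  have rs0: "-1 < r * s" if "s \<in> {0..1}" for s :: real
    using r that by (smt (verit) atLeastAtMost_iff mult_nonneg_nonneg)
  have int: "((\<lambda>s. r / (1 - (r * s)\<^sup>2)) has_integral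
      ((ln (1 + r * 1) - ln (1 - r * 1)) / 2 - (ln (1 + r * 0) - ln (1 - r * 0)) / 2)) {0..1}"
  proof (rule fundamental_theorem_of_calculus)
    fix s :: real assume s: "s \<in> {0..1}"
    define x where "x = r * s"
    have nz: "0 < 1 + x" "0 < 1 - x"
      using rs[OF s] rs0[OF s] by (auto simp: x_def)
    have "1 - x\<^sup>2 = (1 + x) * (1 - x)"
      by (simp add: power2_eq_square algebra_simps)
    moreover have "r / (1 + x) + r / (1 - x) = 2 * r / ((1 + x) * (1 - x))"
      using nz by (simp add: add_divide_eq_iff divide_add_eq_iff) (simp add: algebra_simps)
    ultimately have e: "r / (1 - (r * s)\<^sup>2) = (r / (1 + r * s) + r / (1 - r * s)) / 2"
      by (simp add: x_def[symmetric])
    \<comment> \<open>the antiderivative of the density along a radius\<close>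
    have d1: "((\<lambda>s. ln (1 + r * s)) has_field_derivative r / (1 + r * s)) (at s)"
      by (rule DERIV_ln_divide[THEN DERIV_chain2, THEN DERIV_cong])
         (use nz in \<open>auto intro!: derivative_eq_intros simp: x_def\<close>)
    have d2: "((\<lambda>s. ln (1 - r * s)) has_field_derivative - (r / (1 - r * s))) (at s)"
      by (rule DERIV_ln_divide[THEN DERIV_chain2, THEN DERIV_cong])
         (use nz in \<open>auto intro!: derivative_eq_intros simp: x_def\<close>)
    have "((\<lambda>s. (ln (1 + r * s) - ln (1 - r * s)) / 2) has_field_derivative
        (r / (1 + r * s) - - (r / (1 - r * s))) / 2) (at s)"
      by (intro DERIV_cdivide DERIV_diff d1 d2)
    then have "((\<lambda>s. (ln (1 + r * s) - ln (1 - r * s)) / 2) has_field_derivative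
        (r / (1 + r * s) + r / (1 - r * s)) / 2) (at s)"
      by simp
    then show "((\<lambda>s. (ln (1 + r * s) - ln (1 - r * s)) / 2) has_vector_derivative
         r / (1 - (r * s)\<^sup>2)) (at s within {0..1})"
      unfolding e has_real_derivative_iff_has_vector_derivative by (rule has_vector_derivative_at_within)
  qed simp
  have "hyperbolic_length \<gamma> 0 1 \<le> integral {0..1} (\<lambda>s. r / (1 - (r * s)\<^sup>2))"
    unfolding hyperbolic_length_def
  proof (rule integral_le[OF piecewise_C1_integrable[OF 1 2]])
    show "(\<lambda>s. r / (1 - (r * s)\<^sup>2)) integrable_on {0..1}" using int by blast
    fix s :: real assume s: "s \<in> {0..1}"
    have "disc_density (\<gamma> s) * norm (deriv M (of_real s * v)) \<le> disc_density (of_real s * v)"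
      unfolding \<gamma>_def by (rule schwarz_pick_disc[OF M_hol M_disc sv[OF s]])
    then have "norm v * (disc_density (\<gamma> s) * norm (deriv M (of_real s * v))) \<le> norm v * disc_density (of_real s * v)"
      by (intro mult_left_mono) auto
    then show "disc_density (\<gamma> s) * norm (vector_derivative \<gamma> (at s)) \<le> r / (1 - (r * s)\<^sup>2)"
      using s unfolding vector_derivative_at[OF \<gamma>'[OF s]]
      by (simp add: \<gamma>'_def r_def disc_density_def norm_mult mult_ac)
  qed
  also have "\<dots> = (ln (1 + r) - ln (1 - r)) / 2"
    using integral_unique[OF int] by simp
  also have "ln (1 + r) - ln (1 - r) = ln ((1 + r) / (1 - r))"
    using r by (simp add: ln_div)
  also have "\<dots> \<le> ln (4 + hsq x y)"
  proof -
    have "hsq y x = 4 * r\<^sup>2 / (1 - r\<^sup>2)"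
      using hsq_eq_rho[OF xy(2,1)] by (simp add: r_def v_def rho_def norm_divide)
    moreover have "hsq x y = hsq y x" by (simp add: hsq_def norm_minus_commute mult.commute)
    ultimately have h: "4 + hsq x y = 4 / (1 - r\<^sup>2)"
      using r by (simp add: field_simps abs_square_eq_1)
    have "(1 + r) / (1 - r) = (1 + r)\<^sup>2 / (1 - r\<^sup>2)"
      using r by (simp add: divide_simps abs_square_eq_1) (simp add: power2_eq_square algebra_simps)
    also have "\<dots> \<le> 2\<^sup>2 / (1 - r\<^sup>2)"
      using r by (intro divide_right_mono power_mono) (auto simp: abs_square_le_1)
    finally have "(1 + r) / (1 - r) \<le> 4 + hsq x y" using h by simp
    then show ?thesis using r by (intro ln_mono) auto
  qed
  finally have "hyperbolic_length \<gamma> 0 1 \<le> ln (4 + hsq x y) / 2" by simp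
  then show ?thesis
    by (intro that[OF 1 2 3]) (simp add: x_def y_def \<sigma>_def)
qed

lemma hyperbolic_dist_upper:
  assumes z: "z \<in> disc" and w: "w \<in> disc" and \<tau>: "norm \<tau> = 1"
  shows "hyperbolic_dist z w \<le> ln (4 + hsq (cay \<tau> z) (cay \<tau> w)) / 2"
proof -
  obtain \<gamma> where \<gamma>: "piecewise_C1_on \<gamma> 0 1" "\<gamma> ` {0..1} \<subseteq> disc" "\<gamma> 0 = z" "\<gamma> 1 = w"
    "hyperbolic_length \<gamma> 0 1 \<le> ln (4 + hsq (cay \<tau> z) (cay \<tau> w)) / 2"
    using geodesic_exists[OF z w] \<tau> by metis
  have "hyperbolic_dist z w \<le> hyperbolic_length \<gamma> 0 1"
    unfolding hyperbolic_dist_def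
    by (rule cInf_lower) (use \<gamma> in \<open>auto intro!: bdd_belowI[of _ 0] hyperbolic_length_nonneg\<close>)
  then show ?thesis using \<gamma>(5) by simp
qed

lemma hyperbolic_dist_lower:
  assumes z: "z \<in> disc" and w: "w \<in> disc"
    and Q: "Q holomorphic_on disc" "\<And>z. z \<in> disc \<Longrightarrow> 0 < Re (Q z)"
  shows "\<bar>ln (norm (Q w)) - ln (norm (Q z))\<bar> \<le> 2 * hyperbolic_dist z w"
proof -
  let ?S = "{hyperbolic_length \<gamma> 0 1 | \<gamma>.
            piecewise_C1_on \<gamma> 0 1 \<and> \<gamma> ` {0..1} \<subseteq> disc \<and> \<gamma> 0 = z \<and> \<gamma> 1 = w}"
  obtain \<gamma> where \<gamma>: "piecewise_C1_on \<gamma> 0 1" "\<gamma> ` {0..1} \<subseteq> disc" "\<gamma> 0 = z" "\<gamma> 1 = w"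
    using geodesic_exists[OF z w] by metis
  have "\<bar>ln (norm (Q w)) - ln (norm (Q z))\<bar> / 2 \<le> Inf ?S"
  proof (rule cInf_greatest)
    show "?S \<noteq> {}" using \<gamma> by blast
    fix l assume "l \<in> ?S"
    then obtain \<gamma> where "l = hyperbolic_length \<gamma> 0 1" "piecewise_C1_on \<gamma> 0 1" "\<gamma> ` {0..1} \<subseteq> disc"
      "\<gamma> 0 = z" "\<gamma> 1 = w" by blast
    then show "\<bar>ln (norm (Q w)) - ln (norm (Q z))\<bar> / 2 \<le> l"
      using length_lower_bound[of \<gamma> 0 1 Q] Q by auto
  qed
  then show ?thesis by (simp add: hyperbolic_dist_def)
qed

section \<open>Quasi-geodesics in the half-plane\<close>

locale rhp_curve =
  fixes x x' :: "real \<Rightarrow> complex"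
  assumes pos: "\<And>t. 0 \<le> t \<Longrightarrow> 0 < Re (x t)"
    and vd: "\<And>t. 0 \<le> t \<Longrightarrow> (x has_vector_derivative x' t) (at t)"
    and cont': "continuous_on {0..} x'"
begin

definition speed :: "real \<Rightarrow> real" where
  "speed t = norm (x' t) / (2 * Re (x t))"

definition len :: "real \<Rightarrow> real \<Rightarrow> real" where
  "len s t = integral {s..t} speed"

lemma cont: "continuous_on {0..} x"
  using has_vector_derivative_continuous[OF vd] by (intro continuous_at_imp_continuous_on) auto

lemma cont_speed: "continuous_on {0..} speed"
  unfolding speed_def using pos by (intro continuous_intros cont cont') force

lemma speed_nonneg: "0 \<le> t \<Longrightarrow> 0 \<le> speed t"
  using pos[of t] by (simp add: speed_def)

lemma speed_integrable: "0 \<le> s \<Longrightarrow> speed integrable_on {s..t}"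
  by (rule integrable_continuous_interval[OF continuous_on_subset[OF cont_speed]]) auto

lemma len_nonneg: "0 \<le> s \<Longrightarrow> 0 \<le> len s t"
  unfolding len_def by (rule integral_nonneg[OF speed_integrable]) (auto intro: speed_nonneg)

lemma len_add: "0 \<le> s \<Longrightarrow> s \<le> t \<Longrightarrow> t \<le> u \<Longrightarrow> len s u = len s t + len t u"
  unfolding len_def by (rule Henstock_Kurzweil_Integration.integral_combine[symmetric]) (auto intro: speed_integrable)

lemma len_le:
  assumes "0 \<le> s" "s \<le> t" "\<And>u. s \<le> u \<Longrightarrow> u \<le> t \<Longrightarrow> speed u \<le> M"
  shows "len s t \<le> M * (t - s)"
proof -
  have "integral {s..t} speed \<le> integral {s..t} (\<lambda>_. M)"
    using assms by (intro integral_le speed_integrable) auto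
  then show ?thesis using assms by (simp add: len_def mult.commute)
qed

text \<open>The bound on the derivative is required in the open interval only: on an excursion out of a
sector it is clear inside, and at the end points it would need a separate limit argument.\<close>

lemma variation_le_len:
  fixes g :: "real \<Rightarrow> 'b::euclidean_space"
  assumes st: "0 \<le> s" "s \<le> t"
    and g: "\<And>u. s \<le> u \<Longrightarrow> u \<le> t \<Longrightarrow> (g has_vector_derivative g' u) (at u)"
    and le: "\<And>u. s < u \<Longrightarrow> u < t \<Longrightarrow> norm (g' u) \<le> M * speed u"
  shows "norm (g t - g s) \<le> M * len s t"
proof -
  have "(g' has_integral (g t - g s)) {s..t}"
    by (rule fundamental_theorem_of_calculus[OF st(2)])
       (use g in \<open>auto intro: has_vector_derivative_at_within\<close>)
  then have g': "(g' has_integral (g t - g s)) {s<..<t}"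
    by (simp add: has_integral_Icc_iff_Ioo)
  have sp: "speed integrable_on {s<..<t}"
    using speed_integrable[OF st(1), of t] by (simp add: integrable_on_Icc_iff_Ioo)
  have "norm (integral {s<..<t} g') \<le> integral {s<..<t} (\<lambda>u. M * speed u)"
    using le integrable_cmul[OF sp, of M]
    by (intro integral_norm_bound_integral) (use g' in auto)
  then show ?thesis
    using integral_unique[OF g'] by (simp add: len_def integral_open_interval_real)
qed

text \<open>Outside the sector \<open>|x| < K Re x\<close> it is expensive to change the modulus: hyperbolic length
exceeds the length of the radial projection by the factor \<open>K\<close>. This is the contraction
property of the projection to a geodesic.\<close>

lemma log_modulus_weighted:
  assumes st: "0 \<le> s" "s \<le> t" and K: "0 < K"
    and le: "\<And>u. s < u \<Longrightarrow> u < t \<Longrightarrow> K * Re (x u) \<le> norm (x u)"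
  shows "K * \<bar>ln (norm (x t)) - ln (norm (x s))\<bar> \<le> 2 * len s t"
proof -
  have nz: "x u \<noteq> 0" if "0 \<le> u" for u using pos[OF that] by force
  have "norm (Ln (x t) - Ln (x s)) \<le> (2 / K) * len s t"
  proof (rule variation_le_len[OF st])
    fix u assume u: "s \<le> u" "u \<le> t"
    have "x u \<notin> \<real>\<^sub>\<le>\<^sub>0" using pos[of u] u st by (simp add: complex_nonpos_Reals_iff)
    from field_vector_diff_chain_at[OF vd has_field_derivative_Ln[OF this]] u st
    show "((\<lambda>u. Ln (x u)) has_vector_derivative x' u * inverse (x u)) (at u)" by (simp add: o_def)
  next
    fix u assume u: "s < u" "u < t"
    have p: "0 < Re (x u)" using pos u st by simp
    have "norm (x' u) / norm (x u) \<le> norm (x' u) / (K * Re (x u))"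
      using le[OF u] K p by (intro divide_left_mono mult_pos_pos) (auto simp: nz)
    also have "\<dots> = (2 / K) * speed u" using K p by (simp add: speed_def field_simps)
    finally show "norm (x' u * inverse (x u)) \<le> (2 / K) * speed u"
      by (simp add: norm_mult norm_inverse divide_inverse)
  qed
  moreover have "\<bar>ln (norm (x t)) - ln (norm (x s))\<bar> \<le> norm (Ln (x t) - Ln (x s))"
    using abs_Re_le_cmod[of "Ln (x t) - Ln (x s)"] nz[of s] nz[of t] st by simp
  ultimately have "\<bar>ln (norm (x t)) - ln (norm (x s))\<bar> \<le> (2 / K) * len s t" by simp
  then show ?thesis using K by (simp add: field_simps)
qed

lemma log_modulus:
  assumes st: "0 \<le> s" "s \<le> t"
  shows "\<bar>ln (norm (x t)) - ln (norm (x s))\<bar> \<le> 2 * len s t"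
  using log_modulus_weighted[OF st, of 1] complex_Re_le_cmod by simp

lemma log_Re:
  assumes st: "0 \<le> s" "s \<le> t"
  shows "\<bar>ln (Re (x t)) - ln (Re (x s))\<bar> \<le> 2 * len s t"
proof -
  have "norm (ln (Re (x t)) - ln (Re (x s))) \<le> 2 * len s t"
  proof (rule variation_le_len[OF st])
    fix u assume u: "s \<le> u" "u \<le> t"
    have p: "0 < Re (x u)" using pos u st by simp
    have "((\<lambda>u. Re (x u)) has_vector_derivative Re (x' u)) (at u)"
      using bounded_linear.has_vector_derivative[OF bounded_linear_Re vd[of u]] u st by simp
    then have "((\<lambda>u. ln (Re (x u))) has_field_derivative inverse (Re (x u)) * Re (x' u)) (at u)"
      unfolding has_real_derivative_iff_has_vector_derivative[symmetric]
      using p by (intro DERIV_chain2[OF DERIV_ln]) auto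
    then show "((\<lambda>u. ln (Re (x u))) has_vector_derivative inverse (Re (x u)) * Re (x' u)) (at u)"
      by (simp add: has_real_derivative_iff_has_vector_derivative)
  next
    fix u assume u: "s < u" "u < t"
    have p: "0 < Re (x u)" using pos u st by simp
    then show "norm (inverse (Re (x u)) * Re (x' u)) \<le> 2 * speed u"
      using abs_Re_le_cmod[of "x' u"] by (simp add: speed_def abs_mult field_simps)
  qed
  then show ?thesis by simp
qed

text \<open>The Morse lemma for a curve that tends to infinity within a half-plane \<open>{Re \<ge> c}\<close>, with
respect to the geodesic \<open>(0, \<infinity>)\<close>. Put \<open>k = |x| / Re x\<close>, and let \<open>K\<close> be large compared
with \<open>A\<close> and at least \<open>k 0\<close>. A distance between points with \<open>Re \<ge> c\<close> is at most the logarithm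
of the larger modulus plus a constant, while an excursion into \<open>{k > K}\<close> costs at least \<open>K / 2\<close>
times the change of \<open>ln |x|\<close>; so no excursion lasts forever. At both ends of a finite
excursion \<open>k = K\<close>, so the distance of the ends is at most half the change of \<open>ln |x|\<close> plus a
constant, and comparison with the length shows that the length is bounded. Finally \<open>ln k\<close> is
Lipschitz with respect to arc length.\<close>

lemma quasi_geodesic_imp_sector:
  assumes c: "0 < c" "\<And>t. 0 \<le> t \<Longrightarrow> c \<le> Re (x t)"
    and inf: "filterlim x at_infinity at_top"
    and A: "1 \<le> A" and B: "0 \<le> B"
    and qg: "\<And>s t. 0 \<le> s \<Longrightarrow> s < t \<Longrightarrow> len s t \<le> A * (ln (4 + hsq (x s) (x t)) / 2) + B"
  shows "\<exists>K. \<forall>t\<ge>0. norm (x t) \<le> K * Re (x t)"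
proof -
  define k where "k = (\<lambda>t. norm (x t) / Re (x t))"
  define K where "K = max (4 * A) (k 0)"
  have K: "4 * A \<le> K" "k 0 \<le> K" "0 < K" using A by (auto simp: K_def)
  have nz: "0 < norm (x t)" if "0 \<le> t" for t using pos[OF that] by force
  have k_le: "k t \<le> M \<longleftrightarrow> norm (x t) \<le> M * Re (x t)" if "0 \<le> t" for t M
    using pos[OF that] by (simp add: k_def pos_divide_le_eq)
  have ck: "continuous_on {0..} k"
    unfolding k_def using pos by (intro continuous_intros cont) force
  have return: "\<exists>t\<ge>a. k t \<le> K" if a: "0 \<le> a" for a
  proof (rule ccontr)
    assume "\<not> ?thesis"
    then have big: "K < k t" if "a \<le> t" for t using that by force
    define C where "C = K * ln (norm (x a)) + A * ln (8 / c\<^sup>2) + 2 * B"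
    have bound: "ln (norm (x t)) \<le> C / (K - 2 * A)" if t: "a < t" "norm (x a) \<le> norm (x t)" for t
    proof -
      have "K * Re (x u) \<le> norm (x u)" if "a < u" for u
        using big[of u] that a pos[of u] by (simp add: k_def field_simps)
      then have 1: "K * \<bar>ln (norm (x t)) - ln (norm (x a))\<bar> \<le> 2 * len a t"
        using log_modulus_weighted[of a t K] a t K by simp
      have cx: "c \<le> norm (x t)" using c(2)[of t] complex_Re_le_cmod[of "x t"] a t by linarith
      have "hsq (x a) (x t) \<le> (2 * norm (x t))\<^sup>2 / (c * c)"
        unfolding hsq_def
      proof (rule frac_le)
        have "norm (x a - x t) \<le> 2 * norm (x t)"
          using norm_triangle_ineq4[of "x a" "x t"] t by simp
        then show "(norm (x a - x t))\<^sup>2 \<le> (2 * norm (x t))\<^sup>2" by (intro power_mono) auto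
        show "c * c \<le> Re (x a) * Re (x t)" using c(2)[of a] c(2)[of t] c(1) pos[of a] a t by (intro mult_mono) auto
      qed (use c in auto)
      moreover have "4 \<le> 4 * (norm (x t))\<^sup>2 / c\<^sup>2"
      proof -
        have "c\<^sup>2 \<le> (norm (x t))\<^sup>2" using cx c by (intro power_mono) auto
        then show ?thesis using c by (simp add: field_simps)
      qed
      ultimately have "4 + hsq (x a) (x t) \<le> (8 / c\<^sup>2) * (norm (x t))\<^sup>2"
        by (simp add: power2_eq_square)
      moreover have "0 \<le> hsq (x a) (x t)" using pos a t by (intro hsq_nonneg) auto
      ultimately have "ln (4 + hsq (x a) (x t)) \<le> ln ((8 / c\<^sup>2) * (norm (x t))\<^sup>2)"
        by (intro ln_mono) auto
      also have "\<dots> = ln (8 / c\<^sup>2) + 2 * ln (norm (x t))"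
      proof -
        have "ln ((8 / c\<^sup>2) * (norm (x t))\<^sup>2) = ln (8 / c\<^sup>2) + ln ((norm (x t))\<^sup>2)"
          using c(1) nz[of t] a t by (intro ln_mult_pos) auto
        then show ?thesis using nz[of t] a t by (simp add: ln_realpow)
      qed
      finally have "A * ln (4 + hsq (x a) (x t)) \<le> A * (ln (8 / c\<^sup>2) + 2 * ln (norm (x t)))"
        using A by (intro mult_left_mono) auto
      moreover have "2 * len a t \<le> A * ln (4 + hsq (x a) (x t)) + 2 * B"
        using qg[OF a t(1)] by simp
      moreover have "K * (ln (norm (x t)) - ln (norm (x a))) \<le> K * \<bar>ln (norm (x t)) - ln (norm (x a))\<bar>"
        using K by (intro mult_left_mono) auto
      ultimately have "(K - 2 * A) * ln (norm (x t)) \<le> C"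
        using 1 by (simp add: C_def algebra_simps)
      then show ?thesis using K A by (simp add: field_simps)
    qed
    have "eventually (\<lambda>t. max (norm (x a)) (exp (C / (K - 2 * A)) + 1) \<le> norm (x t)) at_top"
      using inf unfolding filterlim_at_infinity_conv_norm_at_top filterlim_at_top by blast
    then have "eventually (\<lambda>t. max (norm (x a)) (exp (C / (K - 2 * A)) + 1) \<le> norm (x t) \<and> a < t) at_top"
      by (intro eventually_conj eventually_gt_at_top)
    then obtain t where "max (norm (x a)) (exp (C / (K - 2 * A)) + 1) \<le> norm (x t) \<and> a < t"
      using eventually_happens'[OF trivial_limit_at_top_linorder] by blast
    then have t: "a < t" "norm (x a) \<le> norm (x t)" "exp (C / (K - 2 * A)) < norm (x t)" by auto
    have "ln (exp (C / (K - 2 * A))) < ln (norm (x t))"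
      using t(3) nz[of t] a t(1) by (intro ln_less_cancel_iff[THEN iffD2]) auto
    then show False using bound[OF t(1,2)] by simp
  qed
  define C where "C = A / 2 * ln (8 * K\<^sup>2) + B"
  have K1: "1 \<le> K" using K A by simp
  have C0: "0 \<le> C"
  proof -
    have "1 \<le> K\<^sup>2" using K1 by simp
    then show ?thesis using A B by (simp add: C_def)
  qed
  have excursion: "len a b \<le> 2 * C" if a: "0 \<le> a" "a < b" and kab: "k a \<le> K" "k b \<le> K"
    and out: "\<And>u. a < u \<Longrightarrow> u < b \<Longrightarrow> K \<le> k u" for a b
  proof -
    define \<Delta> where "\<Delta> = \<bar>ln (norm (x b)) - ln (norm (x a))\<bar>"
    have na: "0 < norm (x a)" "0 < norm (x b)" using nz a by auto
    have "K * Re (x u) \<le> norm (x u)" if "a < u" "u < b" for u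
      using out[OF that] that a pos[of u] by (simp add: k_def field_simps)
    then have 1: "K * \<Delta> \<le> 2 * len a b"
      unfolding \<Delta>_def using a K by (intro log_modulus_weighted) auto
    define m where "m = max (norm (x a)) (norm (x b))"
    define n where "n = min (norm (x a)) (norm (x b))"
    have mn: "0 < n" "n \<le> m" "m * n = norm (x a) * norm (x b)" "norm (x a) \<le> m" "norm (x b) \<le> m"
      using na by (auto simp: m_def n_def max_def min_def)
    have "\<Delta> = ln m - ln n"
      using na unfolding \<Delta>_def m_def n_def by (auto simp: max_def min_def abs_if)
    then have eD: "exp \<Delta> = m / n" using mn by (simp add: exp_diff)
    have "hsq (x a) (x b) \<le> (2 * m)\<^sup>2 / (m * n / K\<^sup>2)"
      unfolding hsq_def
    proof (rule frac_le)
      have "norm (x a - x b) \<le> 2 * m"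
        using norm_triangle_ineq4[of "x a" "x b"] mn by simp
      then show "(norm (x a - x b))\<^sup>2 \<le> (2 * m)\<^sup>2" by (intro power_mono) auto
      have "norm (x a) * norm (x b) \<le> (K * Re (x a)) * (K * Re (x b))"
        using kab a k_le[of a K] k_le[of b K] pos[of a] K by (intro mult_mono) auto
      then show "m * n / K\<^sup>2 \<le> Re (x a) * Re (x b)"
        using K mn(3) by (simp add: field_simps power2_eq_square)
    qed (use mn(1,2) K in \<open>auto intro!: divide_pos_pos mult_pos_pos\<close>)
    also have "\<dots> = 4 * K\<^sup>2 * exp \<Delta>" using mn(1,2) K by (simp add: eD power2_eq_square)
    finally have hsq_le: "hsq (x a) (x b) \<le> 4 * K\<^sup>2 * exp \<Delta>" .
    have "4 + hsq (x a) (x b) \<le> 8 * K\<^sup>2 * exp \<Delta>"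
    proof -
      have "1 * 1 \<le> K\<^sup>2 * exp \<Delta>" using K1 by (intro mult_mono) (auto simp: \<Delta>_def)
      then show ?thesis using hsq_le by simp
    qed
    moreover have "0 \<le> hsq (x a) (x b)" using pos a by (intro hsq_nonneg) auto
    ultimately have "ln (4 + hsq (x a) (x b)) \<le> ln (8 * K\<^sup>2 * exp \<Delta>)"
      by (intro ln_mono) auto
    also have "\<dots> = ln (8 * K\<^sup>2) + \<Delta>" using K by (simp add: ln_mult)
    finally have "A / 2 * ln (4 + hsq (x a) (x b)) \<le> A / 2 * (ln (8 * K\<^sup>2) + \<Delta>)"
      using A by (intro mult_left_mono) auto
    then have "len a b \<le> C + A / 2 * \<Delta>"
      using qg[OF a] by (simp add: C_def algebra_simps)
    moreover have "4 * A * \<Delta> \<le> K * \<Delta>" using K by (intro mult_right_mono) (auto simp: \<Delta>_def)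
    ultimately have "len a b \<le> C + len a b / 4" using 1 by simp
    then show ?thesis using C0 by simp
  qed
  have "k t \<le> K * exp (8 * C)" if t: "0 \<le> t" for t
  proof (cases "k t \<le> K")
    case True
    moreover have "K * 1 \<le> K * exp (8 * C)" using K C0 by (intro mult_left_mono) auto
    ultimately show ?thesis by simp
  next
    case False
    \<comment> \<open>\<open>a\<close> is the last and \<open>b\<close> the first time around \<open>t\<close> at which the curve is in the sector\<close>
    obtain t2 where t2: "t \<le> t2" "k t2 \<le> K" using return[OF t] by blast
    have cl: "compact {u\<in>{p..q}. k u \<le> K}" if "0 \<le> p" for p q
    proof -
      have "continuous_on {p..q} k" by (rule continuous_on_subset[OF ck]) (use that in auto)
      then have "closed ({p..q} \<inter> k -` {..K})" by (intro continuous_closed_preimage) auto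
      moreover have "{p..q} \<inter> k -` {..K} = {u\<in>{p..q}. k u \<le> K}" by auto
      ultimately show ?thesis
        by (metis (no_types, lifting) bounded_closed_interval bounded_subset compact_eq_bounded_closed mem_Collect_eq subsetI)
    qed
    have "{u\<in>{0..t}. k u \<le> K} \<noteq> {}" using K t by auto
    from compact_attains_sup[OF cl this]
    obtain a where a: "0 \<le> a" "a \<le> t" "k a \<le> K" "\<And>u. 0 \<le> u \<Longrightarrow> u \<le> t \<Longrightarrow> k u \<le> K \<Longrightarrow> u \<le> a" by auto
    have "{u\<in>{t..t2}. k u \<le> K} \<noteq> {}" using t2 by auto
    from compact_attains_inf[OF cl[OF t] this]
    obtain b where b: "t \<le> b" "b \<le> t2" "k b \<le> K" "\<And>u. t \<le> u \<Longrightarrow> u \<le> t2 \<Longrightarrow> k u \<le> K \<Longrightarrow> b \<le> u" by auto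
    have ab: "a < t" "t < b" using a(2,3) b(1,3) False by (auto simp: less_le)
    have "len a b \<le> 2 * C"
    proof (rule excursion)
      fix u assume u: "a < u" "u < b"
      show "K \<le> k u"
      proof (rule ccontr)
        assume "\<not> ?thesis"
        then have "k u \<le> K" by simp
        then show False using a(4)[of u] b(4)[of u] b(2) u a(1) by (cases "u \<le> t") auto
      qed
    qed (use a b ab in auto)
    then have "len a t \<le> 2 * C" using len_add[of a t b] len_nonneg[of t b] ab a t by simp
    then have "\<bar>ln (norm (x t)) - ln (norm (x a))\<bar> \<le> 4 * C" "\<bar>ln (Re (x t)) - ln (Re (x a))\<bar> \<le> 4 * C"
      using log_modulus[of a t] log_Re[of a t] ab a by auto
    moreover have "ln (k s) = ln (norm (x s)) - ln (Re (x s))" if "0 \<le> s" for s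
      using nz[OF that] pos[OF that] by (simp add: k_def ln_div)
    ultimately have "ln (k t) \<le> ln (k a) + 8 * C" using t a by auto
    also have "\<dots> \<le> ln K + 8 * C"
      using a(1,3) nz[of a] pos[of a] K by (auto simp: k_def intro!: ln_mono)
    also have "\<dots> = ln (K * exp (8 * C))" using K by (simp add: ln_mult)
    finally show ?thesis using nz[OF t] pos[OF t] K by (subst (asm) ln_le_cancel_iff) (auto simp: k_def)
  qed
  then show ?thesis using k_le by blast
qed

text \<open>If a time step \<open>T \<delta> t\<close> at least doubles the modulus, and has length at most \<open>T\<close> because
the speed is at most \<open>1 / \<delta>\<close>, then length is at most linear in the change of \<open>ln |x|\<close>:
count the steps. As \<open>\<delta>\<close> does not decrease, finitely many steps exhaust any interval,
which is what the induction on \<open>m\<close> expresses.\<close>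

lemma doubling_imp_linear_length:
  assumes T: "0 < T" and t0: "0 \<le> t0"
    and \<delta>0: "0 < \<delta> 0" and mono: "\<And>s t. 0 \<le> s \<Longrightarrow> s \<le> t \<Longrightarrow> \<delta> s \<le> \<delta> t"
    and sp: "\<And>t. 0 \<le> t \<Longrightarrow> speed t \<le> 1 / \<delta> t"
    and dbl: "\<And>t. t0 \<le> t \<Longrightarrow> 2 * norm (x t) \<le> norm (x (t + T * \<delta> t))"
  shows "\<exists>A\<ge>1. \<exists>B\<ge>0. \<forall>s t. 0 \<le> s \<longrightarrow> s < t \<longrightarrow>
    len s t \<le> A * (\<bar>ln (norm (x t)) - ln (norm (x s))\<bar> / 2) + B"
proof -
  define l where "l = (\<lambda>t. ln (norm (x t)))"
  have nz: "0 < norm (x t)" if "0 \<le> t" for t using pos[OF that] by force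
  have \<delta>pos: "0 < \<delta> t" if "0 \<le> t" for t using mono[of 0 t] \<delta>0 that by simp
  have l_var: "\<bar>l t - l s\<bar> \<le> 2 * len s t" if "0 \<le> s" "s \<le> t" for s t
    unfolding l_def by (rule log_modulus[OF that])
  have step: "len s t \<le> T" if "0 \<le> s" "s \<le> t" "t \<le> s + T * \<delta> s" for s t
  proof -
    have "len s t \<le> (1 / \<delta> s) * (t - s)"
    proof (rule len_le[OF that(1,2)])
      fix u assume "s \<le> u"
      then have "1 / \<delta> u \<le> 1 / \<delta> s" using mono[of s u] \<delta>pos[of s] that by (simp add: frac_le)
      then show "speed u \<le> 1 / \<delta> s" using sp[of u] that \<open>s \<le> u\<close> by simp
    qed
    also have "\<dots> \<le> (1 / \<delta> s) * (T * \<delta> s)" using that \<delta>pos[of s] by (intro mult_left_mono) auto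
    also have "\<dots> = T" using \<delta>pos[of s] that by simp
    finally show ?thesis .
  qed
  define M where "M = T * (2 * T + ln 2)"
  have M0: "0 \<le> M" using T by (simp add: M_def)
  have main: "ln 2 * len s t \<le> T * (l t - l s) + M" if "t0 \<le> s" "s \<le> t" "t < s + real m * (T * \<delta> 0)" for m s t
    using that
  proof (induction m arbitrary: s)
    case 0
    then show ?case by simp
  next
    case (Suc m)
    have s: "0 \<le> s" using Suc.prems t0 by simp
    show ?case
    proof (cases "t \<le> s + T * \<delta> s")
      case True
      have 1: "len s t \<le> T" by (rule step[OF s Suc.prems(2) True])
      then have "- 2 * T \<le> l t - l s" using l_var[OF s Suc.prems(2)] by simp
      then have "T * (- 2 * T) \<le> T * (l t - l s)" using T by (intro mult_left_mono) auto
      moreover have "ln 2 * len s t \<le> ln 2 * T" using 1 by (intro mult_left_mono) auto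
      moreover have "ln 2 * T = T * ln 2" by simp
      ultimately show ?thesis unfolding M_def by (simp only: algebra_simps)
    next
      case False
      define s' where "s' = s + T * \<delta> s"
      have "T * \<delta> 0 \<le> T * \<delta> s" using mono[of 0 s] s T by (intro mult_left_mono) auto
      moreover have "0 < T * \<delta> 0" using T \<delta>0 by simp
      ultimately have s': "s \<le> s'" "s' \<le> t" "t0 \<le> s'" "t < s' + real m * (T * \<delta> 0)"
        using False Suc.prems by (auto simp: s'_def algebra_simps)
      have "ln 2 * len s' t \<le> T * (l t - l s') + M" by (rule Suc.IH[OF s'(3,2,4)])
      moreover have "ln 2 * len s s' \<le> ln 2 * T" using step[OF s s'(1)] by (intro mult_left_mono) (auto simp: s'_def)
      moreover have "len s t = len s s' + len s' t" by (rule len_add[OF s s'(1,2)])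
      moreover have "ln 2 + l s \<le> l s'"
      proof -
        have "ln 2 + l s = ln (2 * norm (x s))" using nz[OF s] by (simp add: l_def ln_mult)
        also have "\<dots> \<le> l s'" unfolding l_def s'_def using dbl[OF Suc.prems(1)] nz[OF s] by (intro ln_mono) auto
        finally show ?thesis .
      qed
      then have "T * (ln 2 + l s) \<le> T * l s'" using T by (intro mult_left_mono) auto
      then have "ln 2 * T + T * l s \<le> T * l s'" by (simp add: algebra_simps)
      ultimately show ?thesis by (simp only: distrib_left right_diff_distrib)
    qed
  qed
  have main': "ln 2 * len s t \<le> T * (l t - l s) + M" if st: "t0 \<le> s" "s \<le> t" for s t
  proof -
    have "0 < T * \<delta> 0" using T \<delta>0 by simp
    then obtain m where "t - s < real m * (T * \<delta> 0)"
      using reals_Archimedean3 by (metis mult.commute)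
    then show ?thesis using main[OF st, of m] by simp
  qed
  define L where "L = len 0 t0"
  have L0: "0 \<le> L" unfolding L_def by (rule len_nonneg) simp
  have all: "ln 2 * len s t \<le> T * \<bar>l t - l s\<bar> + (M + ln 2 * L + 2 * T * L)" if st: "0 \<le> s" "s < t" for s t
  proof -
    have TL: "0 \<le> ln 2 * L" "0 \<le> 2 * T * L" "0 \<le> T * \<bar>l t - l s\<bar>" using L0 T by auto
    have ab: "T * (l t - l s) \<le> T * \<bar>l t - l s\<bar>" using T by (intro mult_left_mono) auto
    consider "t0 \<le> s" | "t \<le> t0" | "s < t0" "t0 < t" by linarith
    then show ?thesis
    proof cases
      case 1
      then have "ln 2 * len s t \<le> T * (l t - l s) + M" using main'[of s t] st by simp
      then show ?thesis using TL ab by linarith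
    next
      case 2
      have "L = len 0 s + (len s t + len t t0)"
        unfolding L_def using len_add[of 0 s t0] len_add[of s t t0] st 2 by simp
      then have "len s t \<le> L" using len_nonneg[of 0 s] len_nonneg[of t t0] st by simp
      then have "ln 2 * len s t \<le> ln 2 * L" by (intro mult_left_mono) auto
      then show ?thesis using TL M0 by linarith
    next
      case 3
      have "L = len 0 s + len s t0" unfolding L_def using len_add[of 0 s t0] st 3 by simp
      then have sL: "len s t0 \<le> L" using len_nonneg[of 0 s] st by simp
      then have "ln 2 * len s t0 \<le> ln 2 * L" by (intro mult_left_mono) auto
      moreover have "ln 2 * len s t = ln 2 * len s t0 + ln 2 * len t0 t"
        using len_add[of s t0 t] st 3 by (simp add: distrib_left)
      moreover have "ln 2 * len t0 t \<le> T * l t - T * l t0 + M"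
        using main'[of t0 t] 3 by (simp add: right_diff_distrib)
      moreover have "l s - 2 * L \<le> l t0" using l_var[of s t0] st 3 sL by simp
      then have "T * (l s - 2 * L) \<le> T * l t0" using T by (intro mult_left_mono) auto
      then have "T * l s - 2 * T * L \<le> T * l t0" by (simp add: algebra_simps)
      moreover have "T * l t - T * l s \<le> T * \<bar>l t - l s\<bar>" using ab by (simp add: right_diff_distrib)
      ultimately show ?thesis by linarith
    qed
  qed
  define A where "A = max 1 (2 * T / ln 2)"
  define B where "B = (M + ln 2 * L + 2 * T * L) / ln 2"
  show ?thesis
  proof (rule exI[of _ A], intro conjI, simp add: A_def, rule exI[of _ B], intro conjI allI impI)
    show "0 \<le> B" using M0 L0 T by (simp add: B_def)
    fix s t :: real assume st: "0 \<le> s" "s < t"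
    have "len s t \<le> (2 * T / ln 2) * (\<bar>l t - l s\<bar> / 2) + B"
      using all[OF st] by (simp add: B_def field_simps)
    also have "\<dots> \<le> A * (\<bar>l t - l s\<bar> / 2) + B"
      by (intro add_right_mono mult_right_mono) (auto simp: A_def)
    finally show "len s t \<le> A * (\<bar>ln (norm (x t)) - ln (norm (x s))\<bar> / 2) + B" by (simp add: l_def)
  qed
qed

end

section \<open>Orbits in a domain that is starlike at infinity\<close>

text \<open>The situation after both changes of coordinates: \<open>D\<close> is the image of the fundamental domain
under the Koenigs function, \<open>g\<close> maps it into the half-plane, and \<open>F\<close> is the self-map, which
becomes translation by \<open>1\<close> in \<open>D\<close>.\<close>

locale starlike_orbit =
  fixes D :: "complex set" and g F :: "complex \<Rightarrow> complex" and w0 :: complex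
  assumes open_D: "open D" and w0: "w0 \<in> D"
    and shift: "\<And>w t. w \<in> D \<Longrightarrow> 0 \<le> t \<Longrightarrow> w + of_real t \<in> D"
    and g_hol: "g holomorphic_on D" and g_pos: "\<And>w. w \<in> D \<Longrightarrow> 0 < Re (g w)"
    and F_hol: "F holomorphic_on rhp" and F_ge: "\<And>z. 0 < Re z \<Longrightarrow> Re z \<le> Re (F z)"
    and F_g: "\<And>w. w \<in> D \<Longrightarrow> F (g w) = g (w + 1)"
    and orbit_inf: "filterlim (\<lambda>n. g (w0 + of_nat n)) at_infinity sequentially"
begin

definition orbit :: "real \<Rightarrow> complex" where
  "orbit t = g (w0 + of_real t)"

lemma orbit_in: "0 \<le> t \<Longrightarrow> w0 + of_real t \<in> D"
  using shift[OF w0] .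

sublocale rhp_curve orbit "\<lambda>t. deriv g (w0 + of_real t)"
proof
  fix t :: real assume t: "0 \<le> t"
  show "0 < Re (orbit t)" unfolding orbit_def by (rule g_pos[OF orbit_in[OF t]])
  have "(g has_field_derivative deriv g (w0 + of_real t)) (at (w0 + of_real t))"
    by (rule holomorphic_derivI[OF g_hol open_D orbit_in[OF t]])
  moreover have "((\<lambda>t. w0 + of_real t) has_vector_derivative 1) (at t)"
    by (auto intro!: derivative_eq_intros)
  ultimately show "(orbit has_vector_derivative deriv g (w0 + of_real t)) (at t)"
    using field_vector_diff_chain_at[of "\<lambda>t. w0 + of_real t" 1 t g] by (simp add: orbit_def[abs_def] o_def)
next
  have "continuous_on D (deriv g)"
    by (intro holomorphic_on_imp_continuous_on holomorphic_deriv g_hol open_D)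
  then show "continuous_on {0..} (\<lambda>t. deriv g (w0 + of_real t))"
    by (rule continuous_on_compose2) (auto intro!: continuous_intros orbit_in)
qed

text \<open>In the coordinate \<open>w\<close> the orbit has Euclidean speed \<open>1\<close>, and a ball of radius \<open>R\<close> has density
\<open>1 / R\<close> at its centre.\<close>

lemma speed_le:
  assumes t: "0 \<le> t" and R: "0 < R" "ball (w0 + of_real t) R \<subseteq> D"
  shows "speed t \<le> 1 / R"
proof -
  have "norm (deriv g (w0 + of_real t)) \<le> 2 * Re (g (w0 + of_real t)) / R"
    by (rule schwarz_pick_ball(2)[OF holomorphic_on_subset[OF g_hol R(2)] R(1)]) (use R g_pos in auto)
  then show ?thesis
    using pos[OF t] R(1) unfolding speed_def orbit_def by (simp add: field_simps)
qed

lemma ball_shift: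
  assumes "ball w R \<subseteq> D" "0 \<le> t" shows "ball (w + of_real t) R \<subseteq> D"
proof
  fix v assume "v \<in> ball (w + of_real t) R"
  then have "v - of_real t \<in> ball w R" by (simp add: dist_norm algebra_simps)
  then have "v - of_real t + of_real t \<in> D" using assms by (intro shift) auto
  then show "v \<in> D" by simp
qed

lemma ball_orbit_shift:
  assumes "ball (w0 + of_real s) R \<subseteq> D" "s \<le> t" shows "ball (w0 + of_real t) R \<subseteq> D"
  using ball_shift[OF assms(1), of "t - s"] assms(2) by simp

lemma bounded_speed: "\<exists>M>0. \<forall>t\<ge>0. speed t \<le> M"
proof -
  obtain r where r: "0 < r" "ball w0 r \<subseteq> D" using open_D w0 open_contains_ball by blast
  then show ?thesis
    using speed_le[OF _ r(1) ball_orbit_shift[of 0 r]] by (intro exI[of _ "1/r"]) auto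
qed

lemma orbit_norm_pos: "0 \<le> t \<Longrightarrow> 0 < norm (orbit t)"
  using less_le_trans[OF pos complex_Re_le_cmod] .

lemma orbit_Suc: "0 \<le> t \<Longrightarrow> orbit (t + 1) = F (orbit t)"
  using F_g[OF orbit_in] by (simp add: orbit_def add.assoc)

lemma Re_orbit_add_nat: "0 \<le> t \<Longrightarrow> Re (orbit t) \<le> Re (orbit (t + of_nat n))"
proof (induction n)
  case (Suc n)
  have "orbit (t + of_nat (Suc n)) = F (orbit (t + of_nat n))"
    using orbit_Suc[of "t + of_nat n"] Suc.prems by (simp add: add_ac)
  then show ?case using Suc F_ge[OF pos[of "t + of_nat n"]] by simp
qed simp

lemma nat_floor_decomp:
  fixes t :: real assumes "s \<le> t"
  obtains n where "s + of_nat n \<le> t" "t \<le> s + of_nat n + 1" 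
  by (rule that[of "nat \<lfloor>t - s\<rfloor>"]) (use assms in linarith)+

text \<open>\<open>Re\<close> does not decrease in a time step \<open>1\<close>, and over shorter times it changes by a bounded
factor, as the speed is bounded.\<close>

lemma Re_orbit_almost_mono: "\<exists>c>0. \<forall>s t. 0 \<le> s \<longrightarrow> s \<le> t \<longrightarrow> c * Re (orbit s) \<le> Re (orbit t)"
proof -
  obtain M where M: "0 < M" "\<And>t. 0 \<le> t \<Longrightarrow> speed t \<le> M" using bounded_speed by auto
  have "exp (- 2 * M) * Re (orbit s) \<le> Re (orbit t)" if st: "0 \<le> s" "s \<le> t" for s t
  proof -
    obtain n where n: "s + of_nat n \<le> t" "t \<le> s + of_nat n + 1" using nat_floor_decomp[OF st(2)] .
    have sn: "0 \<le> s + of_nat n" using st by simp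
    have p: "0 < Re (orbit (s + of_nat n))" "0 < Re (orbit t)" using pos sn st by auto
    have "len (s + of_nat n) t \<le> M * (t - (s + of_nat n))"
      by (rule len_le[OF sn n(1)]) (use M sn in auto)
    also have "\<dots> \<le> M * 1" using M n by (intro mult_left_mono) auto
    finally have "ln (Re (orbit (s + of_nat n))) - 2 * M \<le> ln (Re (orbit t))"
      using log_Re[OF sn n(1)] by simp
    then have "exp (ln (Re (orbit (s + of_nat n))) - 2 * M) \<le> exp (ln (Re (orbit t)))" by simp
    then have "exp (- 2 * M) * Re (orbit (s + of_nat n)) \<le> Re (orbit t)"
      using p by (simp add: exp_diff exp_minus field_simps)
    moreover have "exp (- 2 * M) * Re (orbit s) \<le> exp (- 2 * M) * Re (orbit (s + of_nat n))"
      using Re_orbit_add_nat[OF st(1), of n] by (intro mult_left_mono) auto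
    ultimately show ?thesis by linarith
  qed
  then show ?thesis by (intro exI[of _ "exp (- 2 * M)"]) auto
qed

lemma len_unit_bounded: "\<exists>M. \<forall>s t. 0 \<le> s \<longrightarrow> s \<le> t \<longrightarrow> t \<le> s + 1 \<longrightarrow> len s t \<le> M"
proof -
  obtain M where M: "0 < M" "\<And>t. 0 \<le> t \<Longrightarrow> speed t \<le> M" using bounded_speed by auto
  have "len s t \<le> M" if st: "0 \<le> s" "s \<le> t" "t \<le> s + 1" for s t
  proof -
    have "len s t \<le> M * (t - s)" by (rule len_le[OF st(1,2)]) (use M st in auto)
    also have "\<dots> \<le> M * 1" using M st by (intro mult_left_mono) auto
    finally show ?thesis by simp
  qed
  then show ?thesis by blast
qed

text \<open>The left translates of \<open>D\<close> by natural numbers increase, so finitely many of them that cover \<open>K\<close>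
can be replaced by one.\<close>

lemma compact_absorbed:
  assumes K: "compact K" and exhaust: "\<And>w. w \<in> K \<Longrightarrow> \<exists>t\<ge>0. w + of_real t \<in> D"
  shows "\<exists>T\<ge>0. \<forall>t\<ge>T. \<forall>w\<in>K. w + of_real t \<in> D"
proof -
  define U where "U = (\<lambda>n::nat. (\<lambda>w. w - of_nat n) ` D)"
  have opU: "open (U n)" for n
    unfolding U_def using open_translation_subtract[OF open_D, of "of_nat n"] by simp
  have "K \<subseteq> (\<Union>n. U n)"
  proof
    fix w assume "w \<in> K"
    then obtain t where t: "0 \<le> t" "w + of_real t \<in> D" using exhaust by blast
    obtain n :: nat where n: "t \<le> real n" using real_arch_simple by blast
    have "w + of_real t + of_real (real n - t) \<in> D" by (rule shift[OF t(2)]) (use n in simp)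
    then have "w + of_nat n \<in> D" by simp
    then have "w \<in> U n" unfolding U_def by (intro image_eqI[of _ _ "w + of_nat n"]) auto
    then show "w \<in> (\<Union>n. U n)" by blast
  qed
  with compactE_image[OF K, of UNIV U] opU
  obtain C where C: "finite C" "K \<subseteq> (\<Union>n\<in>C. U n)" by auto
  define T where "T = real (Max (insert 0 C))"
  show ?thesis
  proof (intro exI[of _ T] conjI allI impI ballI)
    show "0 \<le> T" by (simp add: T_def)
    fix t w assume t: "T \<le> t" and "w \<in> K"
    then obtain n where n: "n \<in> C" "w \<in> U n" using C by blast
    then have "w + of_nat n \<in> D" by (auto simp: U_def)
    moreover have "n \<le> Max (insert 0 C)" using n C(1) by (intro Max_ge) auto
    then have "real n \<le> t" using t by (simp add: T_def)
    ultimately have "w + of_nat n + of_real (t - real n) \<in> D" by (intro shift) auto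
    then show "w + of_real t \<in> D" by simp
  qed
qed

lemma orbit_at_infinity: "filterlim orbit at_infinity at_top"
  unfolding filterlim_at_infinity_conv_norm_at_top filterlim_at_top
proof
  fix Z :: real
  obtain M where M: "\<And>s t. 0 \<le> s \<Longrightarrow> s \<le> t \<Longrightarrow> t \<le> s + 1 \<Longrightarrow> len s t \<le> M"
    using len_unit_bounded by blast
  have "eventually (\<lambda>n. (\<bar>Z\<bar> + 1) * exp (2 * M) \<le> norm (g (w0 + of_nat n))) sequentially"
    using orbit_inf unfolding filterlim_at_infinity_conv_norm_at_top filterlim_at_top by blast
  then obtain N where N: "\<And>n. N \<le> n \<Longrightarrow> (\<bar>Z\<bar> + 1) * exp (2 * M) \<le> norm (orbit (of_nat n))"
    unfolding eventually_sequentially by (auto simp: orbit_def)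
  show "eventually (\<lambda>t. Z \<le> norm (orbit t)) at_top"
    unfolding eventually_at_top_linorder
  proof (intro exI allI impI)
    fix t :: real assume t: "real N \<le> t"
    obtain n where n: "real N + of_nat n \<le> t" "t \<le> real N + of_nat n + 1" using nat_floor_decomp[OF t] .
    define m where "m = N + n"
    have m: "real m \<le> t" "t \<le> real m + 1" "N \<le> m" using n by (auto simp: m_def)
    have "0 \<le> t" using m(1) of_nat_0_le_iff[of m] by linarith
    then have nz: "0 < norm (orbit (real m))" "0 < norm (orbit t)"
      using less_le_trans[OF pos complex_Re_le_cmod] by auto
    have "ln (norm (orbit (real m))) - 2 * M \<le> ln (norm (orbit t))"
      using log_modulus[of "real m" t] M[of "real m" t] m by simp
    then have "exp (ln (norm (orbit (real m))) - 2 * M) \<le> exp (ln (norm (orbit t)))" by simp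
    then have "norm (orbit (real m)) \<le> norm (orbit t) * exp (2 * M)"
      using nz by (simp add: exp_diff field_simps)
    with N[OF m(3)] have "(\<bar>Z\<bar> + 1) * exp (2 * M) \<le> norm (orbit t) * exp (2 * M)" by (rule order_trans)
    then have "\<bar>Z\<bar> + 1 \<le> norm (orbit t)" by (rule mult_right_le_imp_le) simp
    then show "Z \<le> norm (orbit t)" by simp
  qed
qed

end

section \<open>Comparison with a model domain\<close>

text \<open>After scaling by \<open>|X n|\<close> the two points are close to \<open>e\<close> and \<open>b e\<close> for a unit vector \<open>e\<close> with real
part close to \<open>c\<close>.\<close>

lemma hsq_ratio_limit:
  fixes X Y :: "nat \<Rightarrow> complex" and b c :: real
  assumes X: "\<And>n. 0 < Re (X n)" and c: "0 < c" "(\<lambda>n. Re (X n) / norm (X n)) \<longlonglongrightarrow> c"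
    and b: "0 < b" "(\<lambda>n. Y n / X n) \<longlonglongrightarrow> of_real b"
  shows "(\<lambda>n. hsq (X n) (Y n)) \<longlonglongrightarrow> (b - 1)\<^sup>2 / (c\<^sup>2 * b)"
    and "(\<lambda>n. Re (Y n) / norm (Y n)) \<longlonglongrightarrow> c"
proof -
  have Xnz: "X n \<noteq> 0" for n using X[of n] by force
  define e where "e = (\<lambda>n. Y n / X n - of_real b)"
  have e0: "e \<longlonglongrightarrow> 0" unfolding e_def using tendsto_diff[OF b(2) tendsto_const[of "of_real b"]] by simp
  define u where "u = (\<lambda>n. X n / of_real (norm (X n)))"
  have nu: "norm (u n) = 1" for n using Xnz[of n] by (simp add: u_def norm_divide)
  have Reu: "Re (u n) = Re (X n) / norm (X n)" for n by (simp add: u_def)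
  have eu: "(\<lambda>n. e n * u n) \<longlonglongrightarrow> 0"
  proof (rule tendsto_norm_zero_cancel)
    show "(\<lambda>n. norm (e n * u n)) \<longlonglongrightarrow> 0" using tendsto_norm_zero[OF e0] by (simp add: norm_mult nu)
  qed
  have Yu: "Y n / of_real (norm (X n)) = of_real b * u n + e n * u n" for n
    using Xnz[of n] by (simp add: u_def e_def field_simps)
  have "Re (Y n) / norm (X n) = b * (Re (X n) / norm (X n)) + Re (e n * u n)" for n
    using arg_cong[OF Yu[of n], of Re] by (simp add: Reu)
  moreover have "(\<lambda>n. b * (Re (X n) / norm (X n)) + Re (e n * u n)) \<longlonglongrightarrow> b * c + 0"
    using tendsto_Re[OF eu] by (intro tendsto_intros c) simp
  ultimately have RY: "(\<lambda>n. Re (Y n) / norm (X n)) \<longlonglongrightarrow> b * c" by simp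
  have "(\<lambda>n. (norm (1 - Y n / X n))\<^sup>2 / ((Re (X n) / norm (X n)) * (Re (Y n) / norm (X n))))
      \<longlonglongrightarrow> (norm (1 - complex_of_real b))\<^sup>2 / (c * (b * c))"
    using b(1) c(1) by (intro tendsto_intros b c RY) auto
  moreover have "(norm (1 - Y n / X n))\<^sup>2 / ((Re (X n) / norm (X n)) * (Re (Y n) / norm (X n))) = hsq (X n) (Y n)" for n
  proof -
    have "norm (X n - Y n) = norm (X n) * norm (1 - Y n / X n)"
      using Xnz[of n] by (simp add: norm_mult[symmetric] right_diff_distrib)
    then show ?thesis
      using Xnz[of n] by (simp add: hsq_def power_mult_distrib power2_eq_square)
  qed
  moreover have "(norm (1 - complex_of_real b))\<^sup>2 = (b - 1)\<^sup>2"
    by (metis norm_minus_commute norm_of_real of_real_1 of_real_diff power2_abs)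
  ultimately show "(\<lambda>n. hsq (X n) (Y n)) \<longlonglongrightarrow> (b - 1)\<^sup>2 / (c\<^sup>2 * b)"
    by (simp add: power2_eq_square mult_ac)
  have "(\<lambda>n. norm (Y n / X n)) \<longlonglongrightarrow> norm (complex_of_real b)" by (intro tendsto_intros b)
  then have "(\<lambda>n. (Re (Y n) / norm (X n)) / norm (Y n / X n)) \<longlonglongrightarrow> (b * c) / norm (complex_of_real b)"
    using b(1) by (intro tendsto_divide RY) auto
  moreover have "(Re (Y n) / norm (X n)) / norm (Y n / X n) = Re (Y n) / norm (Y n)" for n
    using Xnz[of n] by (simp add: norm_divide)
  ultimately have "(\<lambda>n. Re (Y n) / norm (Y n)) \<longlonglongrightarrow> (b * c) / norm (complex_of_real b)"
    by (simp only:)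
  then show "(\<lambda>n. Re (Y n) / norm (Y n)) \<longlonglongrightarrow> c" using b(1) by simp
qed

context starlike_orbit
begin

text \<open>Along times at which the orbit stays in a sector \<open>F\<close> acts like multiplication by its angular
derivative \<open>\<beta>\<close>, so the hyperbolic displacements over times \<open>1\<close> and \<open>2\<close> have limits.\<close>

lemma displacement_along_sector:
  assumes t: "\<And>n. 0 \<le> t n" "filterlim t at_top sequentially"
    and c: "0 < c" "(\<lambda>n. Re (orbit (t n)) / norm (orbit (t n))) \<longlonglongrightarrow> c"
  obtains \<beta> :: real where "1 \<le> \<beta>"
    "(\<lambda>n. hsq (orbit (t n)) (orbit (t n + 1))) \<longlonglongrightarrow> (\<beta> - 1)\<^sup>2 / (c\<^sup>2 * \<beta>)"
    "(\<lambda>n. hsq (orbit (t n)) (orbit (t n + 2))) \<longlonglongrightarrow> (\<beta>\<^sup>2 - 1)\<^sup>2 / (c\<^sup>2 * \<beta>\<^sup>2)"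
proof -
  obtain \<beta> :: real where \<beta>: "1 \<le> \<beta>" "\<And>K e. 0 < K \<Longrightarrow> 0 < e \<Longrightarrow>
      \<exists>R. \<forall>z. 0 < Re z \<longrightarrow> norm z \<le> K * Re z \<longrightarrow> R \<le> norm z \<longrightarrow> norm (F z / z - of_real \<beta>) \<le> e"
    using julia_wolff_caratheodory[OF F_hol F_ge] by blast
  have ratio: "(\<lambda>n. orbit (s n + 1) / orbit (s n)) \<longlonglongrightarrow> of_real \<beta>"
    if s: "\<And>n. 0 \<le> s n" "filterlim s at_top sequentially"
      "(\<lambda>n. Re (orbit (s n)) / norm (orbit (s n))) \<longlonglongrightarrow> c" for s :: "nat \<Rightarrow> real"
  proof (rule LIMSEQ_I)
    fix e :: real assume e: "0 < e"
    have "0 < 2 / c" using c by simp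
    from \<beta>(2)[OF this, of "e/2"] e obtain R where R: "\<And>z. 0 < Re z \<Longrightarrow> norm z \<le> 2 / c * Re z \<Longrightarrow> R \<le> norm z
        \<Longrightarrow> norm (F z / z - of_real \<beta>) \<le> e / 2" by auto
    have "filterlim (\<lambda>n. norm (orbit (s n))) at_top sequentially"
      using filterlim_compose[OF orbit_at_infinity s(2)] by (simp add: filterlim_at_infinity_conv_norm_at_top)
    then have "eventually (\<lambda>n. R \<le> norm (orbit (s n))) sequentially" by (simp add: filterlim_at_top)
    moreover have "eventually (\<lambda>n. c / 2 < Re (orbit (s n)) / norm (orbit (s n))) sequentially"
      by (rule order_tendstoD(1)[OF s(3)]) (use c in simp)
    ultimately have "eventually (\<lambda>n. norm (orbit (s n + 1) / orbit (s n) - of_real \<beta>) < e) sequentially"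
    proof eventually_elim
      case (elim n)
      have p: "0 < Re (orbit (s n))" using pos s by simp
      then have "0 < norm (orbit (s n))" by (rule less_le_trans[OF _ complex_Re_le_cmod])
      with elim(2) c have "norm (orbit (s n)) \<le> 2 / c * Re (orbit (s n))" by (simp add: field_simps)
      from R[OF p this elim(1)] show ?case using orbit_Suc[OF s(1)] e by simp
    qed
    then show "\<exists>no. \<forall>n\<ge>no. norm (orbit (s n + 1) / orbit (s n) - of_real \<beta>) < e"
      by (simp add: eventually_sequentially)
  qed
  have r1: "(\<lambda>n. orbit (t n + 1) / orbit (t n)) \<longlonglongrightarrow> of_real \<beta>" by (rule ratio[OF t c(2)])
  have p: "0 < Re (orbit (t n))" "0 < Re (orbit (t n + 1))" for n using pos t(1)[of n] by auto
  note l1 = hsq_ratio_limit[where Y = "\<lambda>n. orbit (t n + 1)", OF p(1) c _ r1]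
  have b0: "0 < \<beta>" using \<beta>(1) by simp
  have r2: "(\<lambda>n. orbit (t n + 1 + 1) / orbit (t n + 1)) \<longlonglongrightarrow> of_real \<beta>"
    by (rule ratio[OF _ _ l1(2)[OF b0]])
       (use t in \<open>auto intro: add_nonneg_nonneg filterlim_tendsto_add_at_top[where c = 1] simp: add.commute\<close>)
  have "(\<lambda>n. (orbit (t n + 1 + 1) / orbit (t n + 1)) * (orbit (t n + 1) / orbit (t n))) \<longlonglongrightarrow> of_real \<beta> * of_real \<beta>"
    by (rule tendsto_mult[OF r2 r1])
  moreover have "(orbit (t n + 1 + 1) / orbit (t n + 1)) * (orbit (t n + 1) / orbit (t n)) = orbit (t n + 2) / orbit (t n)" for n
    using p[of n] by (auto simp: add.assoc)
  ultimately have "(\<lambda>n. orbit (t n + 2) / orbit (t n)) \<longlonglongrightarrow> of_real \<beta> * of_real \<beta>"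
    by (simp only:)
  then have r3: "(\<lambda>n. orbit (t n + 2) / orbit (t n)) \<longlonglongrightarrow> of_real (\<beta>\<^sup>2)"
    by (simp add: power2_eq_square)
  show ?thesis
    using that[OF \<beta>(1) l1(1)[OF b0]] hsq_ratio_limit(1)[OF p(1) c _ r3] b0 by simp
qed

end

text \<open>\<open>S\<close> is the union of all left translates of \<open>D\<close>, with conformal map \<open>E\<close> onto the half-plane and
inverse \<open>L\<close>. The map \<open>Q\<close> stands for \<open>E\<close> after the Koenigs function; that it is defined on the
whole half-plane gives a lower bound for distances between orbit points.\<close>

locale starlike_orbit_model = starlike_orbit +
  fixes S :: "complex set" and E L Q :: "complex \<Rightarrow> complex"
  assumes exhaust: "\<And>w. w \<in> S \<Longrightarrow> \<exists>t\<ge>0. w + of_real t \<in> D"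
    and D_sub: "D \<subseteq> S"
    and E_pos: "\<And>w. w \<in> S \<Longrightarrow> 0 < Re (E w)"
    and L_hol: "L holomorphic_on rhp" and L_in: "\<And>z. 0 < Re z \<Longrightarrow> L z \<in> S"
    and L_E: "\<And>w. w \<in> S \<Longrightarrow> L (E w) = w"
    and Q_hol: "Q holomorphic_on rhp" and Q_pos: "\<And>z. 0 < Re z \<Longrightarrow> 0 < Re (Q z)"
    and Q_g: "\<And>w. w \<in> D \<Longrightarrow> Q (g w) = E w"
    and E_shift: "\<And>w v t. w \<in> S \<Longrightarrow> v \<in> S \<Longrightarrow> 0 \<le> t \<Longrightarrow>
        hsq (E (w + of_real t)) (E (v + of_real t)) = hsq (E w) (E v)"
begin

text \<open>The displacement over time \<open>j\<close> tends to the displacement of the translation by \<open>j\<close> in \<open>S\<close>. It is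
never smaller, since \<open>Q\<close> contracts. Conversely, the image in \<open>S\<close> of the disc of radius \<open>r < 1\<close> is
relatively compact, so that after a long translation to the right it lies in \<open>D\<close>, and
Schwarz--Pick on this disc loses the factor \<open>r\<close> only.\<close>

lemma displacement_limit:
  assumes j: "0 \<le> j"
  shows "((\<lambda>t. hsq (orbit t) (orbit (t + j))) \<longlongrightarrow> hsq (E w0) (E (w0 + of_real j))) at_top"
proof -
  define e0 where "e0 = E w0"
  define e1 where "e1 = E (w0 + of_real j)"
  have inS: "w0 + of_real t \<in> S" if "0 \<le> t" for t using orbit_in[OF that] D_sub by blast
  have w0S: "w0 \<in> S" using w0 D_sub by blast
  have e_pos: "0 < Re e0" "0 < Re e1" using E_pos[OF w0S] E_pos[OF inS[OF j]] by (auto simp: e0_def e1_def)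
  have opos: "0 < Re (orbit t)" "0 < Re (orbit (t + j))" if "0 \<le> t" for t using pos that j by auto
  define \<rho>0 where "\<rho>0 = rho e1 e0"
  have \<rho>0: "0 \<le> \<rho>0" "\<rho>0 < 1" using rho_lt_1[OF e_pos(2,1)] by (auto simp: \<rho>0_def rho_nonneg)
  have lower: "\<rho>0 \<le> rho (orbit (t + j)) (orbit t)" if t: "0 \<le> t" for t
  proof -
    have "hsq (E (w0 + of_real j)) (E w0) = hsq (E (w0 + of_real j + of_real t)) (E (w0 + of_real t))"
      by (rule E_shift[symmetric]) (use t j w0S inS in auto)
    also have "\<dots> = hsq (Q (orbit (t + j))) (Q (orbit t))"
      using Q_g[OF orbit_in[OF t]] Q_g[OF orbit_in[of "t + j"]] t j by (simp add: orbit_def add_ac)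
    also have "\<dots> \<le> hsq (orbit (t + j)) (orbit t)"
      by (rule schwarz_pick_rhp[OF Q_hol Q_pos opos(2,1)[OF t]])
    finally show ?thesis
      using e_pos opos[OF t] by (simp add: \<rho>0_def e0_def e1_def hsq_le_iff_rho_le)
  qed
  define \<psi> where "\<psi> = (\<lambda>u. (e0 + cnj e0 * u) / (1 - u))"
  define u1 where "u1 = (e1 - e0) / (e1 + cnj e0)"
  have \<psi>: "\<psi> holomorphic_on ball 0 1" "\<And>u. norm u < 1 \<Longrightarrow> 0 < Re (\<psi> u)" "\<psi> 0 = e0" "\<psi> u1 = e1" "norm u1 = \<rho>0"
    using rhp_from_disc[OF e_pos(1)] e_pos by (auto simp: \<psi>_def u1_def \<rho>0_def rho_def norm_divide)
  have upper: "\<exists>T\<ge>0. \<forall>t\<ge>T. rho (orbit (t + j)) (orbit t) \<le> \<rho>0 / r" if r: "\<rho>0 < r" "r < 1" for r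
  proof -
    have r0: "0 < r" using r \<rho>0 by simp
    have sub: "cball 0 r \<subseteq> ball 0 (1::real)" "cball (0::complex) r \<subseteq> ball 0 1" using r by auto
    have L\<psi>: "(\<lambda>u. L (\<psi> u)) holomorphic_on ball 0 1"
      by (rule holomorphic_on_compose_gen[OF \<psi>(1) L_hol, unfolded o_def]) (use \<psi>(2) in auto)
    have cpt: "compact ((\<lambda>u. L (\<psi> u)) ` cball 0 r)"
      by (rule compact_continuous_image[OF holomorphic_on_imp_continuous_on[OF holomorphic_on_subset[OF L\<psi> sub(2)]]]) simp
    have "(\<lambda>u. L (\<psi> u)) ` cball 0 r \<subseteq> S" using sub(2) \<psi>(2) L_in by auto
    then have "\<exists>t\<ge>0. w + of_real t \<in> D" if "w \<in> (\<lambda>u. L (\<psi> u)) ` cball 0 r" for w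
      using exhaust that by blast
    from compact_absorbed[OF cpt this]
    obtain T where T: "0 \<le> T" "\<And>t w. T \<le> t \<Longrightarrow> w \<in> (\<lambda>u. L (\<psi> u)) ` cball 0 r \<Longrightarrow> w + of_real t \<in> D"
      by metis
    have T': "L (\<psi> u) + of_real t \<in> D" if "T \<le> t" "u \<in> cball 0 r" for t u
      by (rule T(2)[OF that(1)]) (use that(2) in blast)
    show ?thesis
    proof (intro exI[of _ T] conjI allI impI T(1))
      fix t assume t: "T \<le> t"
      define G where "G = (\<lambda>u. g (L (\<psi> u) + of_real t))"
      have "(\<lambda>u. L (\<psi> u) + of_real t) holomorphic_on ball 0 r"
        using holomorphic_on_subset[OF L\<psi> subset_ball[of r 1 0]] r by (intro holomorphic_intros) simp
      then have "G holomorphic_on ball 0 r"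
        unfolding G_def by (rule holomorphic_on_compose_gen[OF _ g_hol, unfolded o_def]) (use T'[OF t] in auto)
      then have "rho (G u1) (G 0) \<le> dist 0 u1 / r"
        by (rule schwarz_pick_ball(1)[OF _ r0]) (use T'[OF t] g_pos r \<psi>(5) in \<open>auto simp: G_def\<close>)
      moreover have "G 0 = orbit t" "G u1 = orbit (t + j)"
        unfolding G_def orbit_def \<psi>(3,4) e0_def e1_def L_E[OF w0S] L_E[OF inS[OF j]] by (simp_all add: add_ac)
      ultimately show "rho (orbit (t + j)) (orbit t) \<le> \<rho>0 / r" by (simp add: \<psi>(5))
    qed
  qed
  have lim: "((\<lambda>t. rho (orbit (t + j)) (orbit t)) \<longlongrightarrow> \<rho>0) at_top"
  proof (rule order_tendstoI)
    fix a assume "a < \<rho>0"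
    then show "eventually (\<lambda>t. a < rho (orbit (t + j)) (orbit t)) at_top"
      unfolding eventually_at_top_linorder by (intro exI[of _ 0] allI impI) (rule less_le_trans[OF _ lower])
  next
    fix a assume a: "\<rho>0 < a"
    define a' where "a' = min a 1"
    have a': "\<rho>0 < a'" "a' \<le> 1" "a' \<le> a" using a \<rho>0 by (auto simp: a'_def)
    define r where "r = (1 + \<rho>0 / a') / 2"
    have a'0: "0 < a'" using a' \<rho>0 by simp
    have q: "\<rho>0 / a' < 1" "\<rho>0 \<le> \<rho>0 / a'" using a' a'0 \<rho>0 by (auto simp: field_simps mult_left_le)
    define q where "q = \<rho>0 / a'"
    have "q < 1" "\<rho>0 \<le> q" using q by (auto simp: q_def)
    then have "\<rho>0 < r" "r < 1" "q < r" by (auto simp: r_def q_def[symmetric])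
    then have r: "\<rho>0 < r" "r < 1" "\<rho>0 / a' < r" by (auto simp: q_def)
    then have "\<rho>0 / r < a'" using a'0 \<rho>0 by (simp add: field_simps)
    moreover obtain T where "\<forall>t\<ge>T. rho (orbit (t + j)) (orbit t) \<le> \<rho>0 / r" using upper[OF r(1,2)] by blast
    ultimately show "eventually (\<lambda>t. rho (orbit (t + j)) (orbit t) < a) at_top"
      unfolding eventually_at_top_linorder using a'(3)
      by (intro exI[of _ T] allI impI) (meson le_less_trans less_le_trans)
  qed
  have "((\<lambda>t. 4 * (rho (orbit (t + j)) (orbit t))\<^sup>2 / (1 - (rho (orbit (t + j)) (orbit t))\<^sup>2))
      \<longlongrightarrow> 4 * \<rho>0\<^sup>2 / (1 - \<rho>0\<^sup>2)) at_top"
    using \<rho>0 by (intro tendsto_intros lim) (auto simp: abs_square_eq_1)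
  moreover have "4 * \<rho>0\<^sup>2 / (1 - \<rho>0\<^sup>2) = hsq e0 e1"
    using hsq_eq_rho[OF e_pos(2,1)] by (simp add: \<rho>0_def hsq_def norm_minus_commute mult.commute)
  moreover have "eventually (\<lambda>t. 4 * (rho (orbit (t + j)) (orbit t))\<^sup>2 / (1 - (rho (orbit (t + j)) (orbit t))\<^sup>2)
      = hsq (orbit t) (orbit (t + j))) at_top"
    using eventually_ge_at_top[of 0]
  proof eventually_elim
    case (elim t)
    have "hsq (orbit t) (orbit (t + j)) = hsq (orbit (t + j)) (orbit t)"
      by (simp add: hsq_def norm_minus_commute mult.commute)
    then show ?case using hsq_eq_rho[OF opos(2,1)[OF elim]] by simp
  qed
  ultimately show ?thesis
    unfolding e0_def e1_def by (simp add: tendsto_cong)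
qed

text \<open>Both descriptions of the limiting displacement are compared here. Two times are needed,
since both the multiplier \<open>\<beta>\<close> and the direction \<open>c\<close> are unknown.\<close>

lemma sector_multiplier:
  assumes t: "\<And>n. 0 \<le> t n" "filterlim t at_top sequentially"
    and c: "0 < c" "(\<lambda>n. Re (orbit (t n)) / norm (orbit (t n))) \<longlonglongrightarrow> c"
  obtains \<beta> :: real where "1 \<le> \<beta>" "hsq (E w0) (E (w0 + 1)) = (\<beta> - 1)\<^sup>2 / (c\<^sup>2 * \<beta>)"
    "hsq (E w0) (E (w0 + 2)) = (\<beta>\<^sup>2 - 1)\<^sup>2 / (c\<^sup>2 * \<beta>\<^sup>2)"
proof -
  obtain \<beta> :: real where \<beta>: "1 \<le> \<beta>"
    "(\<lambda>n. hsq (orbit (t n)) (orbit (t n + 1))) \<longlonglongrightarrow> (\<beta> - 1)\<^sup>2 / (c\<^sup>2 * \<beta>)"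
    "(\<lambda>n. hsq (orbit (t n)) (orbit (t n + 2))) \<longlonglongrightarrow> (\<beta>\<^sup>2 - 1)\<^sup>2 / (c\<^sup>2 * \<beta>\<^sup>2)"
    using displacement_along_sector[OF t c] .
  have 1: "(\<lambda>n. hsq (orbit (t n)) (orbit (t n + 1))) \<longlonglongrightarrow> hsq (E w0) (E (w0 + of_real 1))"
    by (rule filterlim_compose[OF displacement_limit t(2)]) simp
  have 2: "(\<lambda>n. hsq (orbit (t n)) (orbit (t n + 2))) \<longlonglongrightarrow> hsq (E w0) (E (w0 + of_real 2))"
    by (rule filterlim_compose[OF displacement_limit t(2)]) simp
  show ?thesis
    using that[OF \<beta>(1)] LIMSEQ_unique[OF 1 \<beta>(2)] LIMSEQ_unique[OF 2 \<beta>(3)] by simp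
qed

lemma slope_limitI:
  assumes *: "\<And>t c. (\<And>n::nat. 0 \<le> t n) \<Longrightarrow> filterlim t at_top sequentially \<Longrightarrow>
      (\<lambda>n. Re (orbit (t n)) / norm (orbit (t n))) \<longlonglongrightarrow> c \<Longrightarrow> c = c0"
  shows "((\<lambda>t. Re (orbit t) / norm (orbit t)) \<longlongrightarrow> c0) at_top"
proof (rule ccontr)
  let ?q = "\<lambda>t. Re (orbit t) / norm (orbit t)"
  assume "\<not> ?thesis"
  then obtain e where e: "0 < e" "\<not> eventually (\<lambda>t. dist (?q t) c0 < e) at_top"
    unfolding tendsto_iff by blast
  have "\<exists>t\<ge>real n. \<not> dist (?q t) c0 < e" for n
    using e(2) unfolding eventually_at_top_linorder by blast
  then obtain t where t: "\<And>n. real n \<le> t n" "\<And>n. \<not> dist (?q (t n)) c0 < e" by metis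
  have t0: "0 \<le> t n" for n using t(1)[of n] by (meson of_nat_0_le_iff order_trans)
  have tt: "filterlim t at_top sequentially"
    by (rule filterlim_at_top_mono[OF filterlim_real_sequentially]) (use t in auto)
  have "\<bar>?q (t n)\<bar> \<le> 1" for n
    using abs_Re_le_cmod[of "orbit (t n)"] by (simp add: divide_le_eq_1)
  then have "bounded (range (\<lambda>n. ?q (t n)))" by (auto simp: bounded_iff)
  from bounded_imp_convergent_subsequence[OF this]
  obtain c r where r: "strict_mono r" "((\<lambda>n. ?q (t n)) \<circ> r) \<longlonglongrightarrow> c" by blast
  have "c = c0"
    by (rule *[of "t \<circ> r"])
       (use t0 r filterlim_compose[OF tt filterlim_subseq[OF r(1)]] in \<open>auto simp: o_def\<close>)
  moreover have "(\<lambda>n. dist (?q (t (r n))) c0) \<longlonglongrightarrow> dist c c0"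
    using r(2) by (intro tendsto_intros) (simp add: o_def)
  then have "e \<le> dist c c0" by (rule LIMSEQ_le_const) (use t(2) in \<open>auto simp: not_less\<close>)
  ultimately show False using e(1) by simp
qed

end

section \<open>Slopes of sequences and of curves\<close>

text \<open>The cosine determines \<open>|a|\<close>. If the limit of \<open>|a|\<close> is not zero, then \<open>a\<close> cannot change its sign
any more, by continuity.\<close>

lemma angle_limit_of_cos_limit:
  fixes a :: "real \<Rightarrow> real"
  assumes cont: "continuous_on {0..} a" and bd: "\<And>t. 0 \<le> t \<Longrightarrow> \<bar>a t\<bar> \<le> pi / 2"
    and lim: "((\<lambda>t. cos (a t)) \<longlongrightarrow> c) at_top"
  obtains \<theta> where "(a \<longlongrightarrow> \<theta>) at_top"
proof -
  have c: "-1 \<le> c" "c \<le> 1"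
    using tendsto_lowerbound[OF lim, of "-1"] tendsto_upperbound[OF lim, of 1] by simp_all
  have "continuous_on {-1..1} arccos" by (rule continuous_on_arccos')
  then have "((\<lambda>t. arccos (cos (a t))) \<longlongrightarrow> arccos c) at_top"
    by (rule continuous_on_tendsto_compose[OF _ lim]) (use c in auto)
  moreover have "eventually (\<lambda>t. arccos (cos (a t)) = \<bar>a t\<bar>) at_top"
    using eventually_ge_at_top[of 0]
  proof eventually_elim
    case (elim t)
    have "arccos (cos \<bar>a t\<bar>) = \<bar>a t\<bar>" using bd[OF elim] pi_ge_zero by (intro arccos_cos) linarith+
    then show ?case by simp
  qed
  ultimately have abs: "((\<lambda>t. \<bar>a t\<bar>) \<longlongrightarrow> arccos c) at_top" by (rule Lim_transform_eventually)
  show ?thesis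
  proof (cases "arccos c = 0")
    case True
    then have "(a \<longlongrightarrow> 0) at_top" using abs by (simp add: tendsto_rabs_zero_iff)
    then show ?thesis by (rule that)
  next
    case False
    then have "0 < arccos c" using arccos_lbound[of c] c by auto
    then have "eventually (\<lambda>t. 0 < \<bar>a t\<bar>) at_top" using abs by (intro order_tendstoD(1)) auto
    then obtain t0 where t0: "\<And>t. t0 \<le> t \<Longrightarrow> a t \<noteq> 0" unfolding eventually_at_top_linorder by auto
    define t1 where "t1 = max t0 0"
    have nz: "a t \<noteq> 0" if "t1 \<le> t" for t using t0 that by (simp add: t1_def)
    have same: "sgn (a t) = sgn (a t1)" if t: "t1 \<le> t" for t
    proof (rule ccontr)
      assume ne: "sgn (a t) \<noteq> sgn (a t1)"
      have ct: "continuous_on {t1..t} a" by (rule continuous_on_subset[OF cont]) (auto simp: t1_def)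
      have "\<exists>u. t1 \<le> u \<and> u \<le> t \<and> a u = 0"
      proof (cases "0 < a t1")
        case True
        then have "a t < 0" using ne nz[OF t] by (auto simp: sgn_if split: if_splits)
        then show ?thesis using IVT2'[OF _ _ t ct, of 0] True by auto
      next
        case False
        then have "a t1 < 0" using nz[of t1] by simp
        moreover then have "0 < a t" using ne nz[OF t] by (auto simp: sgn_if split: if_splits)
        ultimately show ?thesis using IVT'[of a t1 0 t, OF _ _ t ct] by auto
      qed
      then show False using nz by blast
    qed
    have "((\<lambda>t. sgn (a t1) * \<bar>a t\<bar>) \<longlongrightarrow> sgn (a t1) * arccos c) at_top" by (intro tendsto_intros abs)
    moreover have "eventually (\<lambda>t. sgn (a t1) * \<bar>a t\<bar> = a t) at_top"
      using eventually_ge_at_top[of t1] by eventually_elim (metis same sgn_mult_abs)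
    ultimately have "(a \<longlongrightarrow> sgn (a t1) * arccos c) at_top" by (rule Lim_transform_eventually)
    then show ?thesis by (rule that)
  qed
qed

lemma slopes_eq_of_limit:
  assumes lim: "((\<lambda>t. Arg (1 - cnj \<tau> * \<eta> t)) \<longlongrightarrow> \<theta>) at_top"
    and z: "\<And>n. n0 \<le> n \<Longrightarrow> z n = \<eta> (real (n - n0))"
  shows "slope_seq \<tau> z = slope_curve \<tau> \<eta>"
proof -
  have shift: "filterlim (\<lambda>n. real (n - n0)) at_top sequentially"
    by (rule filterlim_compose[OF filterlim_real_sequentially filterlim_minus_const_nat_at_top])
  have "(\<lambda>n. Arg (1 - cnj \<tau> * \<eta> (real (n - n0)))) \<longlonglongrightarrow> \<theta>"
    by (rule filterlim_compose[OF lim shift])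
  moreover have "eventually (\<lambda>n. Arg (1 - cnj \<tau> * \<eta> (real (n - n0))) = Arg (1 - cnj \<tau> * z n)) sequentially"
    using eventually_ge_at_top[of n0] by eventually_elim (simp add: z)
  ultimately have zl: "(\<lambda>n. Arg (1 - cnj \<tau> * z n)) \<longlonglongrightarrow> \<theta>" by (rule Lim_transform_eventually)
  have "slope_seq \<tau> z = {\<theta>}"
  proof (intro set_eqI iffI)
    fix x assume "x \<in> slope_seq \<tau> z"
    then obtain r where r: "strict_mono (r :: nat \<Rightarrow> nat)" "(\<lambda>n. Arg (1 - cnj \<tau> * z (r n))) \<longlonglongrightarrow> x"
      by (auto simp: slope_seq_def)
    have "(\<lambda>n. Arg (1 - cnj \<tau> * z (r n))) \<longlonglongrightarrow> \<theta>"
      by (rule filterlim_compose[OF zl filterlim_subseq[OF r(1)]])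
    then show "x \<in> {\<theta>}" using LIMSEQ_unique[OF r(2)] by simp
  next
    fix x assume "x \<in> {\<theta>}"
    then show "x \<in> slope_seq \<tau> z"
      using zl by (auto simp: slope_seq_def intro!: exI[of _ id] strict_monoI)
  qed
  moreover have "slope_curve \<tau> \<eta> = {\<theta>}"
  proof (intro set_eqI iffI)
    fix x assume "x \<in> slope_curve \<tau> \<eta>"
    then obtain s where s: "filterlim s at_top sequentially" "(\<lambda>n. Arg (1 - cnj \<tau> * \<eta> (s n))) \<longlonglongrightarrow> x"
      by (auto simp: slope_curve_def)
    show "x \<in> {\<theta>}" using LIMSEQ_unique[OF s(2) filterlim_compose[OF lim s(1)]] by simp
  next
    fix x assume "x \<in> {\<theta>}"
    then show "x \<in> slope_curve \<tau> \<eta>"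
      using filterlim_compose[OF lim filterlim_real_sequentially] filterlim_real_sequentially
      by (auto simp: slope_curve_def intro!: exI[of _ real])
  qed
  ultimately show ?thesis by simp
qed

text \<open>Every time is compared with its integer part. Integer parts of a sequence of times need not
be strictly increasing, so a subsequence is chosen on which they are.\<close>

lemma slopes_eq_of_slow_variation:
  assumes slow: "((\<lambda>t. Arg (1 - cnj \<tau> * \<eta> t) - Arg (1 - cnj \<tau> * \<eta> (real (nat \<lfloor>t\<rfloor>)))) \<longlongrightarrow> 0) at_top"
    and z: "\<And>n. n0 \<le> n \<Longrightarrow> z n = \<eta> (real (n - n0))"
  shows "slope_seq \<tau> z = slope_curve \<tau> \<eta>"
proof (intro set_eqI iffI)
  let ?a = "\<lambda>t. Arg (1 - cnj \<tau> * \<eta> t)"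
  fix \<theta>
  { assume "\<theta> \<in> slope_seq \<tau> z"
    then obtain r where r: "strict_mono (r :: nat \<Rightarrow> nat)" "(\<lambda>n. Arg (1 - cnj \<tau> * z (r n))) \<longlonglongrightarrow> \<theta>"
      by (auto simp: slope_seq_def)
    define s where "s = (\<lambda>n. real (r (n + n0) - n0))"
    have ge: "n \<le> r n" for n using r(1) by (rule strict_mono_imp_increasing)
    have "filterlim s at_top sequentially"
    proof (rule filterlim_at_top_mono[OF filterlim_real_sequentially])
      have "real n \<le> s n" for n using ge[of "n + n0"] by (simp add: s_def)
      then show "eventually (\<lambda>n. real n \<le> s n) sequentially" by simp
    qed
    moreover have "z (r (n + n0)) = \<eta> (s n)" for n
    proof -
      have "n0 \<le> r (n + n0)" using ge[of "n + n0"] by simp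
      then show ?thesis using z by (simp add: s_def)
    qed
    then have "(\<lambda>n. ?a (s n)) \<longlonglongrightarrow> \<theta>" using LIMSEQ_ignore_initial_segment[OF r(2), of n0] by simp
    ultimately show "\<theta> \<in> slope_curve \<tau> \<eta>" unfolding slope_curve_def by (auto simp: s_def intro!: exI[of _ s]) }
  { assume "\<theta> \<in> slope_curve \<tau> \<eta>"
    then obtain s where s: "\<And>n. 0 \<le> s n" "filterlim s at_top sequentially" "(\<lambda>n. ?a (s n)) \<longlonglongrightarrow> \<theta>"
      by (auto simp: slope_curve_def)
    define m where "m = (\<lambda>n. nat \<lfloor>s n\<rfloor>)"
    have m: "filterlim m at_top sequentially"
      unfolding m_def by (rule filterlim_compose[OF filterlim_nat_sequentially filterlim_compose[OF filterlim_floor_sequentially s(2)]])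
    have "(\<lambda>n. ?a (s n) - (?a (s n) - ?a (real (m n)))) \<longlonglongrightarrow> \<theta> - 0"
      unfolding m_def by (intro tendsto_diff s(3) filterlim_compose[OF slow s(2)])
    then have ml: "(\<lambda>n. ?a (real (m n))) \<longlonglongrightarrow> \<theta>" by simp
    have "\<exists>k. \<forall>n. (True) \<and> (k n < k (Suc n) \<and> m (k n) < m (k (Suc n)))"
    proof (rule dependent_nat_choice)
      fix x :: nat and n :: nat
      have "eventually (\<lambda>y. Suc (m x) \<le> m y \<and> Suc x \<le> y) sequentially"
        using m by (intro eventually_conj eventually_ge_at_top) (simp add: filterlim_at_top)
      then obtain y where "Suc (m x) \<le> m y \<and> Suc x \<le> y" using eventually_happens' sequentially_bot by blast
      then show "\<exists>y. True \<and> x < y \<and> m x < m y" by (intro exI[of _ y]) simp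
    qed auto
    then obtain k where k: "\<And>n. k n < k (Suc n)" "\<And>n. m (k n) < m (k (Suc n))" by blast
    have ks: "strict_mono k" "strict_mono (\<lambda>n. m (k n) + n0)"
      using k by (auto simp: strict_mono_Suc_iff)
    have "(\<lambda>n. ?a (real (m (k n)))) \<longlonglongrightarrow> \<theta>" by (rule filterlim_compose[OF ml filterlim_subseq[OF ks(1)]])
    then have "(\<lambda>n. Arg (1 - cnj \<tau> * z (m (k n) + n0))) \<longlonglongrightarrow> \<theta>" by (simp add: z)
    then show "\<theta> \<in> slope_seq \<tau> z" unfolding slope_seq_def using ks(2) by blast }
qed

text \<open>With \<open>x = cay \<tau> z\<close> one has \<open>1 - cnj \<tau> z = 2 / (x + 1)\<close>.\<close>

lemma Arg_cay:
  assumes "norm \<tau> = 1" "norm z < 1"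
  shows "Arg (1 - cnj \<tau> * z) = - Im (Ln (cay \<tau> z + 1))"
    and "\<bar>Arg (1 - cnj \<tau> * z)\<bar> \<le> pi / 2"
    and "cos (Arg (1 - cnj \<tau> * z)) = Re (cay \<tau> z + 1) / norm (cay \<tau> z + 1)"
proof -
  define x where "x = cay \<tau> z + 1"
  have x: "0 < Re x" using cay_pos[OF assms] by (simp add: x_def)
  have xnz: "x \<noteq> 0" using x by force
  have nn: "x \<notin> \<real>\<^sub>\<le>\<^sub>0" using x by (simp add: complex_nonpos_Reals_iff)
  have "1 - cnj \<tau> * z = of_real 2 * inverse x"
    using cay_den_nonzero[OF assms] by (simp add: x_def cay_def divide_simps)
  then have "Arg (1 - cnj \<tau> * z) = Arg (inverse x)" by (simp only: Arg_times_of_real[of 2] zero_less_numeral)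
  also have "\<dots> = Im (Ln (inverse x))" using xnz by (intro Arg_eq_Im_Ln) simp
  also have "\<dots> = - Im (Ln x)" using Ln_inverse[OF nn] by simp
  finally show 1: "Arg (1 - cnj \<tau> * z) = - Im (Ln (cay \<tau> z + 1))" by (simp add: x_def)
  show "\<bar>Arg (1 - cnj \<tau> * z)\<bar> \<le> pi / 2" using Re_Ln_pos_lt_imp[OF x] unfolding 1 x_def[symmetric] by simp
  have "exp (Ln x) = x" using xnz by simp
  then have "Re x = exp (Re (Ln x)) * cos (Im (Ln x))" by (metis Re_exp)
  then have "Re x = norm x * cos (Im (Ln x))" using xnz by simp
  then show "cos (Arg (1 - cnj \<tau> * z)) = Re (cay \<tau> z + 1) / norm (cay \<tau> z + 1)"
    using xnz unfolding 1 x_def[symmetric] by simp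
qed

section \<open>Strips and half-planes\<close>

lemma open_connected_real_cases:
  fixes T :: "real set"
  assumes "open T" "connected T" "T \<noteq> {}"
  obtains "T = UNIV" | a where "T = {a<..}" | b where "T = {..<b}" | a b where "a < b" "T = {a<..<b}"
proof -
  have lt: "\<exists>y\<in>T. y < x" if x: "x \<in> T" for x
  proof -
    obtain e where e: "0 < e" "ball x e \<subseteq> T" using assms(1) x open_contains_ball by blast
    then have "x - e / 2 \<in> T" by (intro subsetD[OF e(2)]) (auto simp: dist_real_def)
    then show ?thesis using e(1) by (intro bexI[of _ "x - e/2"]) auto
  qed
  have gt: "\<exists>y\<in>T. x < y" if x: "x \<in> T" for x
  proof -
    obtain e where e: "0 < e" "ball x e \<subseteq> T" using assms(1) x open_contains_ball by blast
    then have "x + e / 2 \<in> T" by (intro subsetD[OF e(2)]) (auto simp: dist_real_def)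
    then show ?thesis using e(1) by (intro bexI[of _ "x + e/2"]) auto
  qed
  have low: "(\<exists>y\<in>T. y < x) \<longleftrightarrow> (bdd_below T \<longrightarrow> Inf T < x)" for x
    using assms(3) by (auto simp: cInf_less_iff bdd_below_def not_le)
  have high: "(\<exists>y\<in>T. x < y) \<longleftrightarrow> (bdd_above T \<longrightarrow> x < Sup T)" for x
    using assms(3) by (auto simp: less_cSup_iff bdd_above_def not_le)
  have mem: "x \<in> T \<longleftrightarrow> (\<exists>y\<in>T. y < x) \<and> (\<exists>y\<in>T. x < y)" for x
  proof
    assume "(\<exists>y\<in>T. y < x) \<and> (\<exists>y\<in>T. x < y)"
    then obtain y z where "y \<in> T" "z \<in> T" "y < x" "x < z" by blast
    then show "x \<in> T" using connected_contains_Icc[OF assms(2), of y z] by auto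
  qed (use lt gt in blast)
  have iff: "x \<in> T \<longleftrightarrow> (bdd_below T \<longrightarrow> Inf T < x) \<and> (bdd_above T \<longrightarrow> x < Sup T)" for x
    by (subst mem) (simp only: low high)
  consider "bdd_below T" "bdd_above T" | "bdd_below T" "\<not> bdd_above T" | "\<not> bdd_below T" "bdd_above T"
    | "\<not> bdd_below T" "\<not> bdd_above T"
    by (cases "bdd_below T"; cases "bdd_above T") metis+
  then show ?thesis
  proof cases
    case 1
    then have mem': "x \<in> T \<longleftrightarrow> Inf T < x \<and> x < Sup T" for x using iff[of x] by simp
    obtain x where "x \<in> T" using assms(3) by blast
    then have "Inf T < Sup T" using mem'[of x] by linarith
    moreover have "T = {Inf T<..<Sup T}" by (intro set_eqI) (simp only: mem' greaterThanLessThan_iff)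
    ultimately show ?thesis by (rule that(4))
  next
    case 2
    then have "x \<in> T \<longleftrightarrow> Inf T < x" for x using iff[of x] by simp
    then have "T = {Inf T<..}" by (intro set_eqI) (simp only: greaterThan_iff)
    then show ?thesis by (rule that(2))
  next
    case 3
    then have "x \<in> T \<longleftrightarrow> x < Sup T" for x using iff[of x] by simp
    then have "T = {..<Sup T}" by (intro set_eqI) (simp only: lessThan_iff)
    then show ?thesis by (rule that(3))
  next
    case 4
    then have "x \<in> T" for x using iff[of x] by simp
    then have "T = UNIV" by (intro set_eqI) (simp only: UNIV_I)
    then show ?thesis by (rule that(1))
  qed
qed

text \<open>Such a set is determined by the open interval of imaginary parts that occur in it. This
gives the trichotomy of hyperbolic maps and parabolic maps of positive and of zero
hyperbolic step.\<close>

lemma translation_invariant_cases: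
  assumes S: "open S" "connected S" "S \<noteq> {}" and inv: "\<And>w t. w \<in> S \<Longrightarrow> w + of_real t \<in> S"
  obtains "S = UNIV" | a where "S = {w. a < Im w}" | b where "S = {w. Im w < b}"
    | a b where "a < b" "S = {w. a < Im w \<and> Im w < b}"
proof -
  have mem: "w \<in> S \<longleftrightarrow> Im w \<in> Im ` S" for w
  proof
    assume "Im w \<in> Im ` S"
    then obtain v where v: "v \<in> S" "Im w = Im v" by blast
    have "w = v + of_real (Re w - Re v)" using v(2) by (simp add: complex_eq_iff)
    then show "w \<in> S" using inv[OF v(1)] by metis
  qed blast
  have "open (Im ` S)"
    unfolding open_contains_ball
  proof
    fix x assume "x \<in> Im ` S"
    then obtain w where w: "w \<in> S" "x = Im w" by blast
    obtain e where e: "0 < e" "ball w e \<subseteq> S" using S(1) w(1) open_contains_ball by blast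
    have "ball x e \<subseteq> Im ` S"
    proof
      fix y assume "y \<in> ball x e"
      then have "norm (\<i> * complex_of_real (y - x)) < e"
        unfolding norm_mult norm_of_real by (simp add: dist_real_def abs_minus_commute)
      then have "w + \<i> * of_real (y - x) \<in> ball w e" by (simp only: mem_ball dist_norm) (simp add: norm_minus_commute)
      then have "w + \<i> * of_real (y - x) \<in> S" using e by blast
      then show "y \<in> Im ` S" by (rule rev_image_eqI) (simp add: w(2))
    qed
    then show "\<exists>e>0. ball x e \<subseteq> Im ` S" using e(1) by blast
  qed
  moreover have "connected (Im ` S)"
    by (rule connected_continuous_image[OF _ S(2)]) (intro continuous_intros)
  moreover have "Im ` S \<noteq> {}" using S(3) by simp
  moreover have S_eq: "S = {w. Im w \<in> Im ` S}"
    by (intro set_eqI) (simp only: mem mem_Collect_eq)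
  ultimately show ?thesis
  proof (cases rule: open_connected_real_cases[of "Im ` S"])
    case 1
    then show ?thesis using S_eq by (intro that(1)) simp
  next
    case (2 a)
    show ?thesis by (rule that(2)[of a]) (use S_eq 2 in simp)
  next
    case (3 b)
    show ?thesis by (rule that(3)[of b]) (use S_eq 3 in simp)
  next
    case (4 a b)
    show ?thesis by (rule that(4)[of a b]) (use S_eq 4 in simp_all)
  qed
qed

lemma strip_angle:
  assumes "a < (b::real)"
  shows "\<bar>pi / (b - a) * (y - (a + b) / 2)\<bar> < pi / 2 \<longleftrightarrow> a < y \<and> y < b"
proof -
  define d where "d = pi / (b - a)"
  have d: "0 < d" "pi / 2 = d * ((b - a) / 2)" using assms by (auto simp: d_def)
  have "\<bar>d * (y - (a + b) / 2)\<bar> < pi / 2 \<longleftrightarrow> d * \<bar>y - (a + b) / 2\<bar> < d * ((b - a) / 2)"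
    unfolding d(2) using d(1) by (simp add: abs_mult)
  also have "\<dots> \<longleftrightarrow> \<bar>y - (a + b) / 2\<bar> < (b - a) / 2" using d(1) by simp
  also have "\<dots> \<longleftrightarrow> a < y \<and> y < b" by (simp add: abs_less_iff field_simps) linarith
  finally show ?thesis by (simp add: d_def)
qed

lemma exp_strip_pos:
  assumes "a < b" "a < Im w" "Im w < b"
  shows "0 < Re (exp (of_real (pi / (b - a)) * (w - \<i> * of_real ((a + b) / 2))))"
proof -
  have cos_pos: "0 < cos x" if "\<bar>x\<bar> < pi / 2" for x :: real
    using that by (intro cos_gt_zero_pi) linarith+
  have "\<bar>pi / (b - a) * (Im w - (a + b) / 2)\<bar> < pi / 2" using strip_angle[OF assms(1)] assms by blast
  then have "0 < cos (pi / (b - a) * (Im w - (a + b) / 2))"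
    by (rule cos_pos)
  then show ?thesis by (simp add: Re_exp)
qed

context starlike_orbit
begin

lemma slope_of_add_one:
  assumes "((\<lambda>t. Re (orbit t) / norm (orbit t)) \<longlongrightarrow> c) at_top"
  shows "((\<lambda>t. Re (orbit t + 1) / norm (orbit t + 1)) \<longlongrightarrow> c) at_top"
proof -
  have inf: "filterlim (\<lambda>t. norm (orbit t)) at_top at_top"
    using orbit_at_infinity by (simp add: filterlim_at_infinity_conv_norm_at_top)
  have i0: "((\<lambda>t. inverse (norm (orbit t))) \<longlongrightarrow> 0) at_top"
    by (rule tendsto_inverse_0_at_top[OF inf])
  have j0: "((\<lambda>t. inverse (orbit t)) \<longlongrightarrow> 0) at_top"
    by (rule filterlim_compose[OF tendsto_inverse_0 orbit_at_infinity])
  have "((\<lambda>t. (Re (orbit t) / norm (orbit t) + inverse (norm (orbit t))) / norm (1 + inverse (orbit t)))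
      \<longlongrightarrow> (c + 0) / norm (1 + 0 :: complex)) at_top"
    by (intro tendsto_intros assms i0 j0) simp
  moreover have "eventually (\<lambda>t. (Re (orbit t) / norm (orbit t) + inverse (norm (orbit t))) / norm (1 + inverse (orbit t))
      = Re (orbit t + 1) / norm (orbit t + 1)) at_top"
    using eventually_ge_at_top[of 0]
  proof eventually_elim
    case (elim t)
    have nz: "orbit t \<noteq> 0" using pos[OF elim] by force
    then have "norm (orbit t + 1) = norm (orbit t) * norm (1 + inverse (orbit t))"
      by (simp add: norm_mult[symmetric] distrib_left)
    moreover have "Re (orbit t) / norm (orbit t) + inverse (norm (orbit t)) = Re (orbit t + 1) / norm (orbit t)"
      using nz by (simp add: divide_inverse distrib_right)
    ultimately show ?case by simp
  qed
  ultimately show ?thesis by (simp add: tendsto_cong)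
qed

text \<open>In a half-plane the translations by \<open>1\<close> and \<open>2\<close> have displacements in the ratio \<open>1 : 4\<close> (as
measured by \<open>hsq\<close>). For multiplication by \<open>\<beta>\<close> the ratio is
\<open>1 : (\<beta> + 1)\<^sup>2 / \<beta>\<close>, so \<open>\<beta>\<close> would have to be \<open>1\<close>, and then the
displacement would be zero. So the orbit stays in no sector along any sequence of times. The
sign \<open>s\<close> distinguishes upper and lower half-planes.\<close>

lemma halfplane_slope:
  assumes s: "s = 1 \<or> s = - (1::real)" and D: "D \<subseteq> {w. 0 < s * (Im w - a)}"
    and ex: "\<And>w. 0 < s * (Im w - a) \<Longrightarrow> \<exists>t\<ge>0. w + of_real t \<in> D"
    and k: "k holomorphic_on rhp" "\<And>z. 0 < Re z \<Longrightarrow> 0 < s * (Im (k z) - a)" "\<And>w. w \<in> D \<Longrightarrow> k (g w) = w"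
  shows "((\<lambda>t. Re (orbit t) / norm (orbit t)) \<longlongrightarrow> 0) at_top"
proof -
  have ss: "s * s = 1" using s by auto
  define E where "E = (\<lambda>w. - \<i> * of_real s * (w - \<i> * of_real a))"
  define L where "L = (\<lambda>z. \<i> * of_real s * z + \<i> * of_real a)"
  have ReE: "Re (E w) = s * (Im w - a)" for w by (simp add: E_def algebra_simps)
  have Ed: "E v - E w = - \<i> * of_real s * (v - w)" for v w by (simp add: E_def algebra_simps)
  have css: "complex_of_real s * complex_of_real s = 1" using ss by (metis of_real_1 of_real_mult)
  have ns: "norm (- \<i> * of_real s * u) = norm u" for u using s by (auto simp: norm_mult)
  interpret M: starlike_orbit_model D g F w0 "{w. 0 < s * (Im w - a)}" E L "\<lambda>z. E (k z)"
  proof unfold_locales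
    show "L holomorphic_on rhp" unfolding L_def by (intro holomorphic_intros)
    show "(\<lambda>z. E (k z)) holomorphic_on rhp" unfolding E_def by (intro holomorphic_intros k(1))
    fix w v :: complex and t :: real
    show "hsq (E (w + of_real t)) (E (v + of_real t)) = hsq (E w) (E v)"
      unfolding hsq_def Ed ReE by simp
    assume "w \<in> {w. 0 < s * (Im w - a)}"
    have "L (E w) = (complex_of_real s * complex_of_real s) * (w - \<i> * of_real a) + \<i> * of_real a"
      by (simp add: L_def E_def algebra_simps)
    then show "L (E w) = w" by (simp add: css)
  next
    fix z :: complex assume "0 < Re z"
    moreover have "s * (Im (L z) - a) = (s * s) * Re z" by (simp add: L_def algebra_simps)
    ultimately show "L z \<in> {w. 0 < s * (Im w - a)}" by (simp add: ss)
  qed (use D ex k ReE in auto)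
  have w0S: "0 < s * (Im w0 - a)" using w0 D by auto
  show ?thesis
  proof (rule M.slope_limitI)
    fix t :: "nat \<Rightarrow> real" and c
    assume t: "\<And>n. 0 \<le> t n" "filterlim t at_top sequentially"
      and c: "(\<lambda>n. Re (orbit (t n)) / norm (orbit (t n))) \<longlonglongrightarrow> c"
    have "0 \<le> c" by (rule LIMSEQ_le_const[OF c]) (use pos[OF t(1)] in \<open>auto intro!: divide_nonneg_nonneg simp: less_imp_le\<close>)
    moreover have False if cpos: "0 < c"
    proof -
      obtain \<beta> where \<beta>: "1 \<le> \<beta>" "hsq (E w0) (E (w0 + 1)) = (\<beta> - 1)\<^sup>2 / (c\<^sup>2 * \<beta>)"
        "hsq (E w0) (E (w0 + 2)) = (\<beta>\<^sup>2 - 1)\<^sup>2 / (c\<^sup>2 * \<beta>\<^sup>2)"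
        using M.sector_multiplier[OF t cpos c] by blast
      define y where "y = s * (Im w0 - a)"
      have y: "0 < y" using w0S by (simp add: y_def)
      have h1: "hsq (E w0) (E (w0 + 1)) = 1 / y\<^sup>2" "hsq (E w0) (E (w0 + 2)) = 4 / y\<^sup>2"
        unfolding hsq_def Ed ns ReE by (simp_all add: y_def power2_eq_square)
      have b1: "1 / y\<^sup>2 = (\<beta> - 1)\<^sup>2 / (c\<^sup>2 * \<beta>)" using \<beta>(2) h1(1) by simp
      have b2: "4 / y\<^sup>2 = (\<beta>\<^sup>2 - 1)\<^sup>2 / (c\<^sup>2 * \<beta>\<^sup>2)" using \<beta>(3) h1(2) by simp
      have nz: "y\<^sup>2 \<noteq> 0" "c\<^sup>2 * \<beta> \<noteq> 0" "c\<^sup>2 * \<beta>\<^sup>2 \<noteq> 0" using \<beta>(1) y cpos by auto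
      have e1: "(\<beta> - 1)\<^sup>2 * y\<^sup>2 = c\<^sup>2 * \<beta>" using b1 unfolding frac_eq_eq[OF nz(1,2)] by simp
      have "(\<beta>\<^sup>2 - 1)\<^sup>2 * y\<^sup>2 = 4 * (c\<^sup>2 * \<beta>\<^sup>2)" using b2 unfolding frac_eq_eq[OF nz(1,3)] by simp
      moreover have "(\<beta>\<^sup>2 - 1)\<^sup>2 * y\<^sup>2 = (\<beta> + 1)\<^sup>2 * ((\<beta> - 1)\<^sup>2 * y\<^sup>2)"
        by (simp add: power2_eq_square algebra_simps)
      ultimately have "4 * (c\<^sup>2 * \<beta>\<^sup>2) = (\<beta> + 1)\<^sup>2 * (c\<^sup>2 * \<beta>)"
        by (simp only: e1)
      moreover have "4 * (c\<^sup>2 * \<beta>\<^sup>2) = (c\<^sup>2 * \<beta>) * (4 * \<beta>)" by (simp add: power2_eq_square)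
      ultimately have "(c\<^sup>2 * \<beta>) * (\<beta> + 1)\<^sup>2 = (c\<^sup>2 * \<beta>) * (4 * \<beta>)"
        by (simp only: mult.commute)
      then have "(\<beta> + 1)\<^sup>2 = 4 * \<beta>" using \<beta>(1) cpos by simp
      then have "(\<beta> - 1)\<^sup>2 = 0" by (simp add: power2_eq_square algebra_simps)
      then have "c\<^sup>2 * \<beta> = 0" using e1 by simp
      then show False using cpos \<beta>(1) by simp
    qed
    ultimately show "c = 0" by force
  qed
qed

text \<open>The strip corresponds to the half-plane by an exponential function, which turns the
translation by \<open>1\<close> into the multiplication by \<open>\<kappa>\<close>. Equality of displacements over times \<open>1\<close>
and \<open>2\<close> forces \<open>\<beta> = \<kappa>\<close>, hence equality of the cosines of the directions.\<close>

lemma strip_slope: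
  assumes ab: "a < b" and D: "D \<subseteq> {w. a < Im w \<and> Im w < b}"
    and ex: "\<And>w. a < Im w \<Longrightarrow> Im w < b \<Longrightarrow> \<exists>t\<ge>0. w + of_real t \<in> D"
    and k: "k holomorphic_on rhp" "\<And>z. 0 < Re z \<Longrightarrow> a < Im (k z) \<and> Im (k z) < b" "\<And>w. w \<in> D \<Longrightarrow> k (g w) = w"
    and sector: "\<And>t. 0 \<le> t \<Longrightarrow> norm (orbit t) \<le> K * Re (orbit t)"
  shows "((\<lambda>t. Re (orbit t) / norm (orbit t)) \<longlongrightarrow> cos (pi / (b - a) * (Im w0 - (a + b) / 2))) at_top"
proof -
  define d where "d = pi / (b - a)"
  define m where "m = (a + b) / 2"
  define E where "E = (\<lambda>w. exp (of_real d * (w - \<i> * of_real m)))"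
  define L where "L = (\<lambda>z. Ln z / of_real d + \<i> * of_real m)"
  define S where "S = {w. a < Im w \<and> Im w < b}"
  have d: "0 < d" using ab by (simp add: d_def)
  have ang: "\<bar>d * (y - m)\<bar> < pi / 2 \<longleftrightarrow> a < y \<and> y < b" for y
    unfolding d_def m_def by (rule strip_angle[OF ab])
  have ReE: "Re (E w) = exp (d * Re w) * cos (d * (Im w - m))" for w by (simp add: E_def Re_exp)
  have nE: "norm (E w) = exp (d * Re w)" for w by (simp add: E_def norm_exp_eq_Re)
  have cpos: "0 < cos (d * (Im w - m))" if "w \<in> S" for w
    using ang[of "Im w"] that by (intro cos_gt_zero_pi) (auto simp: S_def abs_less_iff)
  have Epos: "0 < Re (E w)" if "w \<in> S" for w unfolding ReE using cpos[OF that] by simp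
  have Eshift: "E (w + of_real t) = of_real (exp (d * t)) * E w" for w t
    by (simp add: E_def exp_of_real[symmetric] exp_add[symmetric] algebra_simps)
  have hsqE: "hsq (E w) (E (w + of_real t)) = (exp (d * t) - 1)\<^sup>2 / ((cos (d * (Im w - m)))\<^sup>2 * exp (d * t))" for w t
  proof -
    have "norm (E w - E (w + of_real t)) = norm (of_real (1 - exp (d * t)) * E w)"
      unfolding Eshift by (simp add: algebra_simps)
    also have "\<dots> = \<bar>1 - exp (d * t)\<bar> * exp (d * Re w)" by (simp only: norm_mult norm_of_real nE)
    finally have "(norm (E w - E (w + of_real t)))\<^sup>2 = (exp (d * t) - 1)\<^sup>2 * (exp (d * Re w))\<^sup>2"
      by (simp add: power_mult_distrib power2_commute)
    moreover have "Re (E (w + of_real t)) = exp (d * t) * Re (E w)" unfolding Eshift by simp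
    ultimately have "hsq (E w) (E (w + of_real t)) =
        (exp (d * t) - 1)\<^sup>2 * (exp (d * Re w))\<^sup>2 / (Re (E w) * (exp (d * t) * Re (E w)))"
      unfolding hsq_def by simp
    also have "\<dots> = (exp (d * t) - 1)\<^sup>2 * (exp (d * Re w))\<^sup>2 /
        (((cos (d * (Im w - m)))\<^sup>2 * exp (d * t)) * (exp (d * Re w))\<^sup>2)"
      unfolding ReE by (simp only: power2_eq_square mult_ac)
    finally show ?thesis by simp
  qed
  interpret M: starlike_orbit_model D g F w0 S E L "\<lambda>z. E (k z)"
  proof unfold_locales
    show "L holomorphic_on rhp" unfolding L_def using d
      by (intro holomorphic_intros) (auto simp: complex_nonpos_Reals_iff)
    show "(\<lambda>z. E (k z)) holomorphic_on rhp" unfolding E_def by (intro holomorphic_intros k(1))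
    fix w assume w: "w \<in> S"
    have "Ln (E w) = of_real d * (w - \<i> * of_real m)"
      unfolding E_def using ang[of "Im w"] w pi_gt_zero by (intro Ln_exp) (auto simp: S_def abs_less_iff)
    then show "L (E w) = w" using d by (simp add: L_def)
    fix v and t :: real
    have "E (w + of_real t) - E (v + of_real t) = of_real (exp (d * t)) * (E w - E v)"
      unfolding Eshift by (simp add: algebra_simps)
    then have "norm (E (w + of_real t) - E (v + of_real t)) = exp (d * t) * norm (E w - E v)"
      by (simp only: norm_mult norm_of_real abs_exp_cancel)
    moreover have "Re (E (u + of_real t)) = exp (d * t) * Re (E u)" for u unfolding Eshift by simp
    ultimately show "hsq (E (w + of_real t)) (E (v + of_real t)) = hsq (E w) (E v)"
      by (simp add: hsq_def power_mult_distrib power2_eq_square)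
  next
    fix z :: complex assume z: "0 < Re z"
    have "Im (L z) = Im (Ln z) / d + m" using d by (simp add: L_def)
    then have "d * (Im (L z) - m) = Im (Ln z)" using d by simp
    then show "L z \<in> S" using ang[of "Im (L z)"] Re_Ln_pos_lt_imp[OF z] by (simp add: S_def)
  qed (use D ex k Epos in \<open>auto simp: S_def\<close>)
  have w0S: "w0 \<in> S" using w0 D by (auto simp: S_def)
  define q where "q = cos (d * (Im w0 - m))"
  have q: "0 < q" unfolding q_def by (rule cpos[OF w0S])
  define \<kappa> where "\<kappa> = exp d"
  have \<kappa>: "1 < \<kappa>" using d by (simp add: \<kappa>_def)
  have K: "0 < K"
  proof -
    have "0 < norm (orbit 0)" by (rule less_le_trans[OF pos complex_Re_le_cmod]) simp
    then have "0 < K * Re (orbit 0)" by (rule less_le_trans[OF _ sector]) simp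
    then show ?thesis using pos[of 0] by (simp add: zero_less_mult_iff)
  qed
  have "((\<lambda>t. Re (orbit t) / norm (orbit t)) \<longlongrightarrow> q) at_top"
  proof (rule M.slope_limitI)
    fix t :: "nat \<Rightarrow> real" and c
    assume t: "\<And>n. 0 \<le> t n" "filterlim t at_top sequentially"
      and c: "(\<lambda>n. Re (orbit (t n)) / norm (orbit (t n))) \<longlonglongrightarrow> c"
    have "1 / K \<le> Re (orbit (t n)) / norm (orbit (t n))" for n
    proof -
      have "0 < norm (orbit (t n))" by (rule orbit_norm_pos[OF t(1)])
      then show ?thesis using sector[OF t(1), of n] K by (simp add: field_simps)
    qed
    then have "1 / K \<le> c" by (intro LIMSEQ_le_const[OF c]) auto
    then have c0: "0 < c" using K by (smt (verit) divide_pos_pos)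
    obtain \<beta> where \<beta>: "1 \<le> \<beta>" "hsq (E w0) (E (w0 + 1)) = (\<beta> - 1)\<^sup>2 / (c\<^sup>2 * \<beta>)"
      "hsq (E w0) (E (w0 + 2)) = (\<beta>\<^sup>2 - 1)\<^sup>2 / (c\<^sup>2 * \<beta>\<^sup>2)"
      using M.sector_multiplier[OF t c0 c] by blast
    have h1: "hsq (E w0) (E (w0 + 1)) = (\<kappa> - 1)\<^sup>2 / (q\<^sup>2 * \<kappa>)"
      using hsqE[of w0 1] by (simp add: q_def \<kappa>_def)
    have h2: "hsq (E w0) (E (w0 + 2)) = (\<kappa>\<^sup>2 - 1)\<^sup>2 / (q\<^sup>2 * \<kappa>\<^sup>2)"
      using hsqE[of w0 2] by (simp add: q_def \<kappa>_def exp_double[symmetric] mult.commute)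
    \<comment> \<open>the ratio of the two displacements determines the multiplier, as \<open>x + 1 / x\<close> is injective for \<open>x \<ge> 1\<close>\<close>
    define P where "P = (\<kappa> - 1)\<^sup>2 / (q\<^sup>2 * \<kappa>)"
    have P: "0 < P" using \<kappa> q by (simp add: P_def)
    have sq: "(x\<^sup>2 - 1)\<^sup>2 / (y\<^sup>2 * x\<^sup>2) = (x - 1)\<^sup>2 / (y\<^sup>2 * x) * ((x + 1)\<^sup>2 / x)" for x y :: real
      by (simp add: power2_eq_square algebra_simps)
    have "P * ((\<kappa> + 1)\<^sup>2 / \<kappa>) = P * ((\<beta> + 1)\<^sup>2 / \<beta>)"
      using \<beta>(2,3) h1 h2 unfolding sq P_def by simp
    then have "(\<kappa> + 1)\<^sup>2 / \<kappa> = (\<beta> + 1)\<^sup>2 / \<beta>"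
      using P by (subst (asm) mult_cancel_left) auto
    then have "(\<kappa> + 1)\<^sup>2 * \<beta> = (\<beta> + 1)\<^sup>2 * \<kappa>"
      by (subst (asm) frac_eq_eq) (use \<kappa> \<beta>(1) in auto)
    then have "(\<kappa> - \<beta>) * (\<kappa> * \<beta> - 1) = 0" by (simp add: power2_eq_square algebra_simps)
    moreover have "1 < \<kappa> * \<beta>" using \<kappa> \<beta>(1) by (smt (verit) mult_le_cancel_left1)
    ultimately have e: "\<beta> = \<kappa>" by simp
    have "(\<kappa> - 1)\<^sup>2 / (q\<^sup>2 * \<kappa>) = (\<kappa> - 1)\<^sup>2 / (c\<^sup>2 * \<kappa>)" using \<beta>(2) unfolding e h1 .
    moreover have nz: "q\<^sup>2 * \<kappa> \<noteq> 0" "c\<^sup>2 * \<kappa> \<noteq> 0" using \<kappa> q c0 by auto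
    ultimately have "(\<kappa> - 1)\<^sup>2 * (c\<^sup>2 * \<kappa>) = (\<kappa> - 1)\<^sup>2 * (q\<^sup>2 * \<kappa>)"
      unfolding frac_eq_eq[OF nz] by blast
    then have "c\<^sup>2 = q\<^sup>2" using \<kappa> by simp
    then show "c = q" using c0 q by simp
  qed
  then show ?thesis by (simp add: q_def d_def m_def)
qed

end

section \<open>The plane\<close>

text \<open>The domain \<open>D\<close>, seen in the half-plane through a map \<open>k\<close> into the coordinate of \<open>D\<close>, contains the
far part of each sector, and there its hyperbolic density is at most twice the one of the
half-plane. The latter is expressed by the consequence that matters, the Schwarz--Pick
inequality for holomorphic functions \<open>J\<close> on \<open>D\<close>.\<close>

definition sector_comparison_map :: "complex set \<Rightarrow> (complex \<Rightarrow> complex) \<Rightarrow> bool" where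
  "sector_comparison_map D k \<longleftrightarrow> (\<forall>K>0. \<exists>R. \<forall>x. 0 < Re x \<longrightarrow> norm x \<le> K * Re x \<longrightarrow> R \<le> norm x \<longrightarrow>
     k x \<in> D \<and> (\<forall>J. J holomorphic_on D \<longrightarrow> (\<forall>w\<in>D. 0 < Re (J w)) \<longrightarrow>
       norm (deriv (\<lambda>x. J (k x)) x) \<le> 2 * Re (J (k x)) / Re x))"

context starlike_orbit
begin

text \<open>If the translates of \<open>D\<close> exhaust the plane, the balls in \<open>D\<close> around the orbit become arbitrarily
large, so the speed tends to zero.\<close>

lemma plane_slow_variation:
  assumes ex: "\<And>w. \<exists>t\<ge>0. w + of_real t \<in> D"
  shows "((\<lambda>t. Im (Ln (orbit t + 1)) - Im (Ln (orbit (real (nat \<lfloor>t\<rfloor>)) + 1))) \<longlongrightarrow> 0) at_top"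
proof -
  have big_ball: "\<exists>T\<ge>0. \<forall>t\<ge>T. ball (w0 + of_real t) R \<subseteq> D" for R
  proof -
    obtain T where T: "0 \<le> T" "\<forall>t\<ge>T. \<forall>w\<in>cball w0 R. w + of_real t \<in> D"
      using compact_absorbed[OF compact_cball ex, of w0 R] by blast
    have "ball (w0 + of_real t) R \<subseteq> D" if t: "T \<le> t" for t
    proof
      fix w assume "w \<in> ball (w0 + of_real t) R"
      then have "w - of_real t \<in> cball w0 R" by (simp add: dist_norm algebra_simps)
      then have "w - of_real t + of_real t \<in> D" using T(2) t by blast
      then show "w \<in> D" by simp
    qed
    then show ?thesis using T(1) by blast
  qed
  show ?thesis
    unfolding tendsto_iff
  proof (intro allI impI)
    fix e :: real assume e: "0 < e"
    define R where "R = 4 / e"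
    have R: "0 < R" using e by (simp add: R_def)
    obtain T where T: "0 \<le> T" "\<And>t. T \<le> t \<Longrightarrow> ball (w0 + of_real t) R \<subseteq> D" using big_ball[of R] by blast
    show "eventually (\<lambda>t. dist (Im (Ln (orbit t + 1)) - Im (Ln (orbit (real (nat \<lfloor>t\<rfloor>)) + 1))) 0 < e) at_top"
      unfolding eventually_at_top_linorder
    proof (intro exI[of _ "T + 1"] allI impI)
      fix t assume t: "T + 1 \<le> t"
      define s where "s = real (nat \<lfloor>t\<rfloor>)"
      have s: "s \<le> t" "t \<le> s + 1" "T \<le> s" "0 \<le> s" using t T(1) by (auto simp: s_def) linarith+
      have p: "0 < Re (orbit u)" if "s \<le> u" for u using pos that s by simp
      have "norm (Ln (orbit t + 1) - Ln (orbit s + 1)) \<le> 2 * len s t"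
      proof (rule variation_le_len[OF s(4,1)])
        fix u assume u: "s \<le> u" "u \<le> t"
        have nn: "orbit u + 1 \<notin> \<real>\<^sub>\<le>\<^sub>0" using p[OF u(1)] by (simp add: complex_nonpos_Reals_iff)
        have "((\<lambda>u. orbit u + 1) has_vector_derivative deriv g (w0 + of_real u)) (at u)"
          using vd[of u] u s by (auto intro!: derivative_eq_intros)
        from field_vector_diff_chain_at[OF this has_field_derivative_Ln[OF nn]]
        show "((\<lambda>u. Ln (orbit u + 1)) has_vector_derivative deriv g (w0 + of_real u) * inverse (orbit u + 1)) (at u)"
          by (simp add: o_def)
      next
        fix u assume u: "s < u" "u < t"
        have "Re (orbit u) \<le> norm (orbit u + 1)" using complex_Re_le_cmod[of "orbit u + 1"] by simp
        then have "norm (deriv g (w0 + of_real u)) / norm (orbit u + 1)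
            \<le> norm (deriv g (w0 + of_real u)) / Re (orbit u)"
          using p[of u] u by (intro divide_left_mono mult_pos_pos) auto
        also have "\<dots> = 2 * speed u" unfolding speed_def by simp
        finally show "norm (deriv g (w0 + of_real u) * inverse (orbit u + 1)) \<le> 2 * speed u"
          by (simp only: norm_mult norm_inverse divide_inverse)
      qed
      also have "len s t \<le> (1 / R) * (t - s)"
        by (rule len_le[OF s(4,1)]) (use speed_le[OF _ R T(2)] s in auto)
      also have "\<dots> \<le> (1 / R) * 1" using s R by (intro mult_left_mono) auto
      finally have "norm (Ln (orbit t + 1) - Ln (orbit s + 1)) \<le> e / 2" by (simp add: R_def)
      then have "\<bar>Im (Ln (orbit t + 1)) - Im (Ln (orbit s + 1))\<bar> \<le> e / 2"
        using abs_Im_le_cmod[of "Ln (orbit t + 1) - Ln (orbit s + 1)"] by simp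
      then show "dist (Im (Ln (orbit t + 1)) - Im (Ln (orbit (real (nat \<lfloor>t\<rfloor>)) + 1))) 0 < e"
        using e by (simp add: s_def[symmetric])
    qed
  qed
qed

text \<open>Let \<open>\<delta> t\<close> be the Euclidean distance of \<open>w0 + t\<close> to the complement of \<open>D\<close>. In a time
\<open>T \<delta> t\<close> the modulus has to double: by the almost monotonicity of \<open>Re\<close>, otherwise both end
points would lie in the part of a fixed sector between the moduli \<open>c N\<close> and \<open>2 N\<close>, where
\<open>N = |orbit t|\<close>. The half-plane distance in that region is bounded, hence so is the distance
in \<open>D\<close>. But if \<open>p\<close> is a point of the complement closest to \<open>w0 + t\<close>, then \<open>D\<close> avoids the slit
\<open>p - [0, \<infinity>)\<close>, and \<open>sqrt (w - p)\<close> maps \<open>D\<close> into the half-plane; it shows that the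
distance in \<open>D\<close> of \<open>w0 + t\<close> and \<open>w0 + t + T \<delta> t\<close> is at least \<open>ln (T - 1) / 4\<close>. This plays the
role of the Koebe quarter theorem.\<close>

lemma plane_doubling:
  assumes DU: "D \<noteq> UNIV" and k: "k holomorphic_on rhp" "\<And>w. w \<in> D \<Longrightarrow> k (g w) = w"
    and K: "\<And>t. 0 \<le> t \<Longrightarrow> norm (orbit t) \<le> K * Re (orbit t)"
    and cmp: "sector_comparison_map D k"
  shows "\<exists>A\<ge>1. \<exists>B\<ge>0. \<forall>s t. 0 \<le> s \<longrightarrow> s < t \<longrightarrow>
    len s t \<le> A * (\<bar>ln (norm (orbit t)) - ln (norm (orbit s))\<bar> / 2) + B"
proof -
  have nzo: "0 < norm (orbit t)" if "0 \<le> t" for t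
    by (rule orbit_norm_pos[OF that])
  have K0: "0 < K"
  proof -
    have "0 < K * Re (orbit 0)" by (rule less_le_trans[OF nzo K]) simp_all
    then show ?thesis using pos[of 0] by (simp add: zero_less_mult_iff)
  qed
  define \<delta> where "\<delta> = (\<lambda>t. infdist (w0 + of_real t) (- D))"
  have cl: "closed (- D)" "- D \<noteq> {}" using open_D DU by auto
  have near: "\<exists>p. p \<notin> D \<and> \<delta> t = dist (w0 + of_real t) p" for t
    using infdist_attains_inf[OF cl, of "w0 + of_real t"] by (auto simp: \<delta>_def)
  have \<delta>_ball: "ball (w0 + of_real t) (\<delta> t) \<subseteq> D" for t
  proof
    fix w assume "w \<in> ball (w0 + of_real t) (\<delta> t)"
    then have "dist (w0 + of_real t) w < \<delta> t" by simp
    then show "w \<in> D" using infdist_le[of w "- D" "w0 + of_real t"] by (auto simp: \<delta>_def)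
  qed
  have \<delta>_pos: "0 < \<delta> t" if "0 \<le> t" for t
  proof -
    obtain p where p: "p \<notin> D" "\<delta> t = dist (w0 + of_real t) p" using near by blast
    then show ?thesis using orbit_in[OF that] by auto
  qed
  have \<delta>_mono: "\<delta> s \<le> \<delta> t" if "0 \<le> s" "s \<le> t" for s t
  proof -
    obtain p where p: "p \<notin> D" "\<delta> t = dist (w0 + of_real t) p" using near by blast
    have "p \<notin> ball (w0 + of_real t) (\<delta> s)" using ball_orbit_shift[OF \<delta>_ball that(2)] p(1) by blast
    then show ?thesis using p(2) by simp
  qed
  have \<delta>_speed: "speed t \<le> 1 / \<delta> t" if "0 \<le> t" for t
    by (rule speed_le[OF that \<delta>_pos[OF that] \<delta>_ball])
  obtain c1 where c1: "0 < c1" "\<And>s t. 0 \<le> s \<Longrightarrow> s \<le> t \<Longrightarrow> c1 * Re (orbit s) \<le> Re (orbit t)"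
    using Re_orbit_almost_mono by blast
  define c where "c = min c1 1 / K"
  have c: "0 < c" using c1 K0 by (simp add: c_def)
  have "0 < 2 / c" using c by simp
  with cmp obtain R where R0: "\<forall>z. 0 < Re z \<longrightarrow> norm z \<le> 2 / c * Re z \<longrightarrow> R \<le> norm z \<longrightarrow>
      k z \<in> D \<and> (\<forall>J. J holomorphic_on D \<longrightarrow> (\<forall>w\<in>D. 0 < Re (J w)) \<longrightarrow>
        norm (deriv (\<lambda>z. J (k z)) z) \<le> 2 * Re (J (k z)) / Re z)"
    unfolding sector_comparison_map_def by blast
  have R: "k z \<in> D"
    "J holomorphic_on D \<Longrightarrow> (\<And>w. w \<in> D \<Longrightarrow> 0 < Re (J w)) \<Longrightarrow>
       norm (deriv (\<lambda>z. J (k z)) z) \<le> 2 * Re (J (k z)) / Re z"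
    if "0 < Re z" "norm z \<le> 2 / c * Re z" "R \<le> norm z" for z J
    using R0[rule_format, OF that] by simp_all
  \<comment> \<open>large enough that \<open>ln (T - 1)\<close> exceeds the bound \<open>16 / c\<close> for the variation of \<open>M\<close> below\<close>
  define T where "T = 2 + exp (16 / c)"
  have T: "0 < T" "exp (16 / c) < T - 1" by (auto simp: T_def add_pos_pos)
  have T1: "1 < T" unfolding T_def using exp_gt_zero[of "16 / c"] by linarith
  have "eventually (\<lambda>t. R / c \<le> norm (orbit t)) at_top"
    using orbit_at_infinity by (simp add: filterlim_at_infinity_conv_norm_at_top filterlim_at_top)
  then obtain t1 where t1: "\<And>t. t1 \<le> t \<Longrightarrow> R / c \<le> norm (orbit t)" unfolding eventually_at_top_linorder by blast
  define t0 where "t0 = max t1 0"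
  have dbl: "2 * norm (orbit t) \<le> norm (orbit (t + T * \<delta> t))" if t: "t0 \<le> t" for t
  proof (rule ccontr)
    assume small: "\<not> ?thesis"
    define t' where "t' = t + T * \<delta> t"
    define N where "N = norm (orbit t)"
    have t00: "0 \<le> t" using t by (simp add: t0_def)
    have tt': "t \<le> t'" using T \<delta>_pos[OF t00] by (simp add: t'_def)
    have N0: "0 < N" using nzo[OF t00] by (simp add: N_def)
    have RN: "R \<le> c * N" using t1[of t] t c by (simp add: t0_def N_def field_simps)
    define Y where "Y = {z. c * N \<le> Re z} \<inter> cball 0 (2 * N)"
    have cY: "convex Y" unfolding Y_def by (intro convex_Int convex_halfspace_Re_ge convex_cball)
    have ReN: "N / K \<le> Re (orbit t)" using K[OF t00] K0 by (simp add: N_def field_simps)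
    have "c * N \<le> Re (orbit u)" if "t \<le> u" for u
    proof -
      have "c * N = min c1 1 * (N / K)" by (simp add: c_def)
      also have "\<dots> \<le> c1 * Re (orbit t)" using ReN c1 N0 K0 by (intro mult_mono) auto
      also have "\<dots> \<le> Re (orbit u)" by (rule c1(2)[OF t00 that])
      finally show ?thesis .
    qed
    then have inY: "orbit t \<in> Y" "orbit t' \<in> Y"
      using small tt' N0 by (auto simp: Y_def N_def t'_def)
    have Yprop: "0 < Re z" "norm z \<le> 2 / c * Re z" "R \<le> norm z" if "z \<in> Y" for z
    proof -
      have z: "c * N \<le> Re z" "norm z \<le> 2 * N" using that by (auto simp: Y_def)
      have "0 < c * N" using c N0 by simp
      then show "0 < Re z" using z(1) by linarith
      have "c * norm z \<le> c * (2 * N)" using z(2) c by (intro mult_left_mono) auto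
      then have "c * norm z \<le> 2 * Re z" using z(1) by linarith
      then show "norm z \<le> 2 / c * Re z" using c by (simp add: field_simps)
      show "R \<le> norm z" using z(1) RN complex_Re_le_cmod[of z] by linarith
    qed
    obtain p where p: "p \<notin> D" "\<delta> t = dist (w0 + of_real t) p" using near by blast
    have slit: "w - p \<notin> \<real>\<^sub>\<le>\<^sub>0" if w: "w \<in> D" for w
    proof
      assume "w - p \<in> \<real>\<^sub>\<le>\<^sub>0"
      then obtain x where x: "x \<le> 0" "w - p = of_real x" by (auto elim: nonpos_Reals_cases)
      have "w + of_real (- x) \<in> D" by (rule shift[OF w]) (use x in simp)
      moreover have "w + of_real (- x) = p" using x(2) by (simp add: algebra_simps)
      ultimately show False using p(1) by simp
    qed
    \<comment> \<open>the square root, written such that its logarithmic derivative is visible\<close>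
    define J where "J = (\<lambda>w. exp (Ln (w - p) / 2))"
    have J_hol: "J holomorphic_on D" unfolding J_def by (intro holomorphic_intros) (use slit in auto)
    have J_pos: "0 < Re (J w)" if "w \<in> D" for w
    proof -
      have "w - p \<noteq> 0" using slit[OF that] by auto
      then have "- pi < Im (Ln (w - p))" "Im (Ln (w - p)) < pi"
        using slit[OF that] mpi_less_Im_Ln Im_Ln_less_pi by auto
      then have "0 < cos (Im (Ln (w - p) / 2))" by (intro cos_gt_zero_pi) auto
      then show ?thesis by (simp add: J_def Re_exp)
    qed
    define M where "M = (\<lambda>z. Ln (k z - p))"
    have Md: "(M has_field_derivative deriv k z / (k z - p)) (at z)"
      and Mb: "norm (deriv k z / (k z - p)) \<le> 4 / (c * N)" if z: "z \<in> Y" for z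
    proof -
      have kD: "k z \<in> D" by (rule R(1)[OF Yprop[OF z]])
      have dk: "(k has_field_derivative deriv k z) (at z)"
        using k(1) Yprop(1)[OF z] by (intro holomorphic_derivI[OF k(1) open_rhp]) simp
      show dM: "(M has_field_derivative deriv k z / (k z - p)) (at z)"
        unfolding M_def using slit[OF kD] by (auto intro!: derivative_eq_intros dk simp: field_simps)
      have "((\<lambda>z. exp (M z / 2)) has_field_derivative exp (M z / 2) * (deriv k z / (k z - p) / 2)) (at z)"
        by (intro DERIV_fun_exp DERIV_cdivide dM)
      then have "deriv (\<lambda>z. J (k z)) z = J (k z) * (deriv k z / (k z - p) / 2)"
        unfolding J_def M_def by (rule DERIV_imp_deriv)
      moreover have "norm (deriv (\<lambda>z. J (k z)) z) \<le> 2 * Re (J (k z)) / Re z"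
        by (rule R(2)[OF Yprop[OF z] J_hol J_pos])
      moreover have "2 * Re (J (k z)) / Re z \<le> 2 * norm (J (k z)) / (c * N)"
        using z c N0 complex_Re_le_cmod J_pos[OF kD] by (intro frac_le mult_left_mono) (auto simp: Y_def)
      ultimately have "norm (J (k z) * (deriv k z / (k z - p) / 2)) \<le> 2 * norm (J (k z)) / (c * N)"
        by simp
      moreover have "norm (J (k z) * (q / 2)) = norm (J (k z)) * (norm q / 2)" for q
        by (simp add: norm_mult norm_divide)
      ultimately have "norm (J (k z)) * (norm (deriv k z / (k z - p)) / 2) \<le> norm (J (k z)) * (2 / (c * N))"
        by (metis mult.commute times_divide_eq_right)
      moreover have "0 < norm (J (k z))" by (rule less_le_trans[OF J_pos[OF kD] complex_Re_le_cmod])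
      ultimately have "norm (deriv k z / (k z - p)) / 2 \<le> 2 / (c * N)"
        by (rule mult_left_le_imp_le)
      then show "norm (deriv k z / (k z - p)) \<le> 4 / (c * N)" by simp
    qed
    have "norm (M (orbit t') - M (orbit t)) \<le> 4 / (c * N) * norm (orbit t' - orbit t)"
      by (rule field_differentiable_bound[OF cY has_field_derivative_at_within[OF Md] Mb inY(2,1)])
    also have "\<dots> \<le> 4 / (c * N) * (4 * N)"
    proof (rule mult_left_mono)
      show "norm (orbit t' - orbit t) \<le> 4 * N"
        using norm_triangle_ineq4[of "orbit t'" "orbit t"] inY by (simp add: Y_def)
    qed (use c N0 in simp)
    also have "\<dots> = 16 / c" using N0 by simp
    finally have Mle: "\<bar>Re (M (orbit t') - M (orbit t))\<bar> \<le> 16 / c"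
      using abs_Re_le_cmod order_trans by blast
    have korb: "k (orbit u) = w0 + of_real u" if "0 \<le> u" for u
      unfolding orbit_def by (rule k(2)[OF orbit_in[OF that]])
    have d: "0 < \<delta> t" by (rule \<delta>_pos[OF t00])
    have ne: "w0 + of_real u - p \<noteq> 0" if "0 \<le> u" for u using slit[OF orbit_in[OF that]] by auto
    have ReM: "Re (M (orbit u)) = ln (norm (w0 + of_real u - p))" if "0 \<le> u" for u
      unfolding M_def korb[OF that] using ne[OF that] by simp
    have n1: "norm (w0 + of_real t - p) = \<delta> t" using p(2) by (simp add: dist_norm)
    have "(T - 1) * \<delta> t \<le> norm (w0 + of_real t' - p)"
    proof -
      have "norm (complex_of_real (T * \<delta> t)) \<le> norm (w0 + of_real t' - p) + norm (w0 + of_real t - p)"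
        using norm_triangle_ineq4[of "w0 + of_real t' - p" "w0 + of_real t - p"] by (simp add: t'_def)
      moreover have "norm (complex_of_real (T * \<delta> t)) = T * \<delta> t"
        unfolding norm_of_real using T d by simp
      ultimately show ?thesis unfolding n1 by (simp add: algebra_simps)
    qed
    then have "ln ((T - 1) * \<delta> t) \<le> Re (M (orbit t'))"
      unfolding ReM[OF order_trans[OF t00 tt']] using T1 d by (intro ln_mono mult_pos_pos) auto
    moreover have "ln ((T - 1) * \<delta> t) = ln (T - 1) + ln (\<delta> t)"
      using T1 d by (intro ln_mult_pos) auto
    moreover have "Re (M (orbit t)) = ln (\<delta> t)" unfolding ReM[OF t00] n1 ..
    ultimately have "ln (T - 1) \<le> 16 / c" using Mle by simp
    moreover have "ln (exp (16 / c)) < ln (T - 1)"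
      using T(2) by (intro ln_less_cancel_iff[THEN iffD2]) (use T1 in auto)
    ultimately show False by simp
  qed
  show ?thesis
    by (rule doubling_imp_linear_length[of T t0 \<delta>]) (use T \<delta>_pos[of 0] \<delta>_mono \<delta>_speed dbl in \<open>auto simp: t0_def\<close>)
qed

end

context starlike_orbit
begin

text \<open>Over unit time intervals \<open>|orbit t| / Re (orbit t)\<close> changes by a bounded factor.\<close>

lemma sector_from_integers:
  assumes K: "\<And>n::nat. norm (orbit (real n)) \<le> K * Re (orbit (real n))"
  shows "\<exists>K'. \<forall>t\<ge>0. norm (orbit t) \<le> K' * Re (orbit t)"
proof -
  obtain M where M: "\<And>s t. 0 \<le> s \<Longrightarrow> s \<le> t \<Longrightarrow> t \<le> s + 1 \<Longrightarrow> len s t \<le> M"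
    using len_unit_bounded by blast
  have "norm (orbit t) \<le> (K * exp (4 * M)) * Re (orbit t)" if t: "0 \<le> t" for t
  proof -
    obtain n where "0 + real n \<le> t" "t \<le> 0 + real n + 1" using nat_floor_decomp[OF t] .
    then have n: "real n \<le> t" "t \<le> real n + 1" by auto
    have p: "0 < Re (orbit (real n))" "0 < Re (orbit t)" using pos t by auto
    have nz: "0 < norm (orbit (real n))" "0 < norm (orbit t)"
      using less_le_trans[OF p(1) complex_Re_le_cmod] less_le_trans[OF p(2) complex_Re_le_cmod] by auto
    have L: "len (real n) t \<le> M" using M n by simp
    have "ln (norm (orbit t)) \<le> ln (norm (orbit (real n))) + 2 * M"
      using log_modulus[OF _ n(1)] L by simp
    then have "exp (ln (norm (orbit t))) \<le> exp (ln (norm (orbit (real n))) + 2 * M)" by simp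
    then have 1: "norm (orbit t) \<le> norm (orbit (real n)) * exp (2 * M)" using nz by (simp add: exp_add)
    have "ln (Re (orbit (real n))) \<le> ln (Re (orbit t)) + 2 * M"
      using log_Re[OF _ n(1)] L by simp
    then have "exp (ln (Re (orbit (real n)))) \<le> exp (ln (Re (orbit t)) + 2 * M)" by simp
    then have 2: "Re (orbit (real n)) \<le> Re (orbit t) * exp (2 * M)" using p by (simp add: exp_add)
    have "0 < K * Re (orbit (real n))" by (rule less_le_trans[OF nz(1) K])
    then have K0: "0 < K" using p by (simp add: zero_less_mult_iff)
    have "norm (orbit t) \<le> K * Re (orbit (real n)) * exp (2 * M)"
      by (rule order_trans[OF 1]) (intro mult_right_mono K, simp)
    also have "\<dots> \<le> K * (Re (orbit t) * exp (2 * M)) * exp (2 * M)"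
      using 2 K0 by (intro mult_right_mono mult_left_mono) auto
    also have "\<dots> = K * (exp (2 * M) * exp (2 * M)) * Re (orbit t)" by (simp only: mult_ac)
    also have "exp (2 * M) * exp (2 * M) = exp (4 * M)" by (simp add: exp_add[symmetric])
    finally show ?thesis .
  qed
  then show ?thesis by blast
qed

end

section \<open>Non-tangential convergence\<close>

lemma cay_plus_one:
  assumes "norm \<tau> = 1" "norm z < 1"
  shows "1 - cnj \<tau> * z = 2 / (cay \<tau> z + 1)" and "norm (\<tau> - z) = 2 / norm (cay \<tau> z + 1)"
proof -
  show 1: "1 - cnj \<tau> * z = 2 / (cay \<tau> z + 1)"
    using cay_den_nonzero[OF assms] by (simp add: cay_def divide_simps)
  have "norm (\<tau> - z) = norm (cnj \<tau> * (\<tau> - z))" using assms(1) by (simp add: norm_mult)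
  also have "cnj \<tau> * (\<tau> - z) = 1 - cnj \<tau> * z" using tau_cnj[OF assms(1)] by (simp add: right_diff_distrib)
  finally show "norm (\<tau> - z) = 2 / norm (cay \<tau> z + 1)" by (simp add: 1 norm_divide)
qed

text \<open>This identity compares the two ways to measure the distance from the radius towards \<open>\<tau>\<close>:
the quotient \<open>|\<tau> - z| / (1 - |z|)\<close> in the disc and \<open>|x| / Re x\<close> in the half-plane.\<close>

lemma cay_ratio:
  assumes "norm \<tau> = 1" "norm z < 1"
  shows "norm (cay \<tau> z) * (1 - (norm z)\<^sup>2) = norm (1 + cnj \<tau> * z) * norm (\<tau> - z) * Re (cay \<tau> z)"
proof -
  have n: "norm (\<tau> - z) = norm (1 - cnj \<tau> * z)"
    using cay_plus_one[OF assms] by (simp add: norm_divide)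
  have nz: "norm (1 - cnj \<tau> * z) \<noteq> 0" using cay_den_nonzero[OF assms] by simp
  have "norm (cay \<tau> z) = norm (1 + cnj \<tau> * z) / norm (1 - cnj \<tau> * z)" by (simp add: cay_def norm_divide)
  then show ?thesis
    unfolding n Re_cay[OF assms(1)] using nz by (simp add: power2_eq_square)
qed

lemma tendsto_iff_cay_at_infinity:
  assumes \<tau>: "norm \<tau> = 1" and z: "\<And>t. norm (z t) < 1"
  shows "(z \<longlongrightarrow> \<tau>) G \<longleftrightarrow> filterlim (\<lambda>t. cay \<tau> (z t)) at_infinity G"
proof
  assume inf: "filterlim (\<lambda>t. cay \<tau> (z t)) at_infinity G"
  have "filterlim (\<lambda>t. cay \<tau> (z t) + 1) at_infinity G"
    using tendsto_add_filterlim_at_infinity'[OF inf tendsto_const[of 1]] .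
  then have "((\<lambda>t. inverse (cay \<tau> (z t) + 1)) \<longlongrightarrow> 0) G"
    by (rule filterlim_compose[OF tendsto_inverse_0])
  then have "((\<lambda>t. 2 * norm (inverse (cay \<tau> (z t) + 1))) \<longlongrightarrow> 2 * norm (0::complex)) G"
    by (intro tendsto_intros)
  then have "((\<lambda>t. norm (\<tau> - z t)) \<longlongrightarrow> 0) G"
    using cay_plus_one(2)[OF \<tau> z] by (simp add: norm_inverse divide_inverse)
  then have "((\<lambda>t. \<tau> - z t) \<longlongrightarrow> 0) G" by (rule tendsto_norm_zero_cancel)
  then have "((\<lambda>t. \<tau> - (\<tau> - z t)) \<longlongrightarrow> \<tau> - 0) G" by (intro tendsto_intros)
  then show "(z \<longlongrightarrow> \<tau>) G" by simp
next
  assume lim: "(z \<longlongrightarrow> \<tau>) G"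
  have "((\<lambda>t. (1 - cnj \<tau> * z t) / 2) \<longlongrightarrow> (1 - cnj \<tau> * \<tau>) / 2) G" by (intro tendsto_intros lim) simp
  then have l0: "((\<lambda>t. (1 - cnj \<tau> * z t) / 2) \<longlongrightarrow> 0) G" using tau_cnj[OF \<tau>] by simp
  have "filterlim (\<lambda>t. (1 - cnj \<tau> * z t) / 2) (at 0) G"
    unfolding filterlim_at using l0 cay_den_nonzero[OF \<tau> z] by simp
  then have "filterlim (\<lambda>t. inverse ((1 - cnj \<tau> * z t) / 2)) at_infinity G"
    by (rule filterlim_compose[OF filterlim_inverse_at_infinity])
  from tendsto_add_filterlim_at_infinity'[OF this tendsto_const[of "-1"]]
  have "filterlim (\<lambda>t. inverse ((1 - cnj \<tau> * z t) / 2) + -1) at_infinity G" .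
  moreover have "inverse ((1 - cnj \<tau> * z t) / 2) + -1 = cay \<tau> (z t)" for t
    using cay_den_nonzero[OF \<tau> z[of t]] by (simp add: cay_def divide_simps)
  ultimately show "filterlim (\<lambda>t. cay \<tau> (z t)) at_infinity G" by simp
qed

lemma nontangential_imp_sector:
  assumes \<tau>: "norm \<tau> = 1" and nt: "converges_nontangentially z \<tau>"
  shows "\<exists>K. \<forall>n. norm (cay \<tau> (z n)) \<le> K * Re (cay \<tau> (z n))"
proof -
  obtain R where R: "1 < R" "\<And>n. norm (\<tau> - z n) < R * (1 - norm (z n))" and z: "\<And>n. norm (z n) < 1"
    using nt by (auto simp: converges_nontangentially_def)
  have "norm (cay \<tau> (z n)) \<le> (2 * R) * Re (cay \<tau> (z n))" for n
  proof -
    define q where "q = 1 - (norm (z n))\<^sup>2"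
    have q: "0 < q" using z[of n] by (simp add: q_def abs_square_less_1)
    have "(norm (z n))\<^sup>2 \<le> norm (z n)" using z[of n] by (simp add: power2_eq_square mult_left_le)
    then have le: "R * (1 - norm (z n)) \<le> R * q" using R(1) by (intro mult_left_mono) (auto simp: q_def)
    have "norm (1 + cnj \<tau> * z n) \<le> 2"
      using norm_triangle_ineq[of 1 "cnj \<tau> * z n"] z[of n] \<tau> by (simp add: norm_mult)
    then have "norm (1 + cnj \<tau> * z n) * norm (\<tau> - z n) \<le> 2 * (R * q)"
      using R(2)[of n] le by (intro mult_mono) auto
    then have "norm (cay \<tau> (z n)) * q \<le> 2 * (R * q) * Re (cay \<tau> (z n))"
      unfolding q_def cay_ratio[OF \<tau> z] using cay_pos[OF \<tau> z[of n]] by (intro mult_right_mono) auto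
    then have "norm (cay \<tau> (z n)) * q \<le> (2 * R * Re (cay \<tau> (z n))) * q" by (simp add: mult_ac)
    then show ?thesis using q by simp
  qed
  then show ?thesis by blast
qed

lemma sector_imp_nontangential:
  assumes \<tau>: "norm \<tau> = 1" and z: "\<And>n. norm (z n) < 1" and lim: "z \<longlonglongrightarrow> \<tau>"
    and K: "eventually (\<lambda>n. norm (cay \<tau> (z n)) \<le> K * Re (cay \<tau> (z n))) sequentially"
  shows "converges_nontangentially z \<tau>"
proof -
  have "filterlim (\<lambda>n. cay \<tau> (z n)) at_infinity sequentially"
    using tendsto_iff_cay_at_infinity[where z = z, OF \<tau> z] lim by blast
  then have "eventually (\<lambda>n. 1 \<le> norm (cay \<tau> (z n))) sequentially"
    by (simp add: filterlim_at_infinity_conv_norm_at_top filterlim_at_top)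
  with K have "eventually (\<lambda>n. norm (\<tau> - z n) \<le> 2 * \<bar>K\<bar> * (1 - norm (z n))) sequentially"
  proof eventually_elim
    case (elim n)
    define x where "x = cay \<tau> (z n)"
    have x: "0 < Re x" using cay_pos[OF \<tau> z] by (simp add: x_def)
    have nz: "x + 1 \<noteq> 0" using x by (metis add_pos_pos less_irrefl one_complex.sel(1) plus_complex.sel(1) zero_complex.sel(1) zero_less_one)
    have "1 + cnj \<tau> * z n = 2 * x / (x + 1)"
      using cay_plus_one(1)[OF \<tau> z[of n]] nz unfolding x_def by (simp add: field_simps)
    moreover have "norm (x + 1) \<le> 2 * norm x" using norm_triangle_ineq[of x 1] elim(2) by (simp add: x_def)
    ultimately have one: "1 \<le> norm (1 + cnj \<tau> * z n)" using nz by (simp add: norm_divide norm_mult)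
    have "norm (\<tau> - z n) * Re x \<le> norm (1 + cnj \<tau> * z n) * norm (\<tau> - z n) * Re x"
      using one x by (intro mult_right_mono) (auto simp: mult_le_cancel_right1)
    also have "\<dots> = norm x * (1 - (norm (z n))\<^sup>2)" unfolding x_def by (rule cay_ratio[OF \<tau> z, symmetric])
    also have "\<dots> \<le> (\<bar>K\<bar> * Re x) * (1 - (norm (z n))\<^sup>2)"
    proof (rule mult_right_mono)
      have "K * Re x \<le> \<bar>K\<bar> * Re x" using x by (intro mult_right_mono) auto
      then show "norm x \<le> \<bar>K\<bar> * Re x" using elim(1) by (simp add: x_def)
      show "0 \<le> 1 - (norm (z n))\<^sup>2" using z[of n] by (simp add: abs_square_le_1)
    qed
    finally have "norm (\<tau> - z n) * Re x \<le> (\<bar>K\<bar> * (1 - (norm (z n))\<^sup>2)) * Re x" by (simp add: mult_ac)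
    then have "norm (\<tau> - z n) \<le> \<bar>K\<bar> * (1 - (norm (z n))\<^sup>2)" using x by simp
    also have "1 - (norm (z n))\<^sup>2 = (1 + norm (z n)) * (1 - norm (z n))" by (simp add: power2_eq_square algebra_simps)
    also have "\<bar>K\<bar> * ((1 + norm (z n)) * (1 - norm (z n))) \<le> \<bar>K\<bar> * (2 * (1 - norm (z n)))"
      using z[of n] by (intro mult_left_mono mult_right_mono) auto
    finally show ?case by (simp add: mult_ac)
  qed
  then obtain N where N: "\<And>n. N \<le> n \<Longrightarrow> norm (\<tau> - z n) \<le> 2 * \<bar>K\<bar> * (1 - norm (z n))"
    by (auto simp: eventually_sequentially)
  define q where "q = (\<lambda>n. norm (\<tau> - z n) / (1 - norm (z n)))"
  have q0: "0 \<le> q n" for n using z[of n] by (simp add: q_def)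
  define R where "R = sum q {..<N} + 2 * \<bar>K\<bar> + 2"
  have sq: "0 \<le> sum q {..<N}" by (intro sum_nonneg q0)
  have "norm (\<tau> - z n) < R * (1 - norm (z n))" for n
  proof -
    have "q n < R"
    proof (cases "n < N")
      case True
      have "q n \<le> sum q {..<N}" using q0 True by (intro member_le_sum) auto
      then show ?thesis by (simp add: R_def)
    next
      case False
      then have "q n \<le> 2 * \<bar>K\<bar>" using N[of n] z[of n] by (simp add: q_def pos_divide_le_eq)
      then show ?thesis using sq by (simp add: R_def)
    qed
    then show ?thesis using z[of n] by (simp add: q_def pos_divide_less_eq)
  qed
  moreover have "1 < R" using sq by (simp add: R_def)
  ultimately show ?thesis using z lim by (auto simp: converges_nontangentially_def)
qed

text \<open>By contradiction: points that violate the inequality further and further out in a sector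
form a non-tangential sequence, and the hypothesis about such sequences applies to it.\<close>

lemma sector_comparison:
  assumes \<tau>: "norm \<tau> = 1" and V: "domain V" "simply_connected V" "V \<subseteq> disc"
    and h: "h holomorphic_on disc"  and hV: "open (h ` V)"
    and hyp: "\<And>z. converges_nontangentially z \<tau> \<Longrightarrow>
              (\<forall>\<^sub>F n in sequentially. z n \<in> V) \<and>
              (\<lambda>n. disc_density (z n) / hyperbolic_density V (z n)) \<longlonglongrightarrow> 1"
  shows "sector_comparison_map (h ` V) (\<lambda>x. h (icay \<tau> x))"
proof (rule ccontr)
  define good where "good = (\<lambda>x. h (icay \<tau> x) \<in> h ` V \<and> (\<forall>J. J holomorphic_on (h ` V) \<longrightarrow> (\<forall>w\<in>h ` V. 0 < Re (J w)) \<longrightarrow>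
          norm (deriv (\<lambda>x. J (h (icay \<tau> x))) x) \<le> 2 * Re (J (h (icay \<tau> x))) / Re x))"
  assume "\<not> ?thesis"
  then obtain K where "0 < K"
    and "\<not> (\<exists>R. \<forall>x. 0 < Re x \<longrightarrow> norm x \<le> K * Re x \<longrightarrow> R \<le> norm x \<longrightarrow> good x)"
    unfolding sector_comparison_map_def good_def by blast
  then have "\<exists>x. 0 < Re x \<and> norm x \<le> K * Re x \<and> real n \<le> norm x \<and> \<not> good x" for n
    by blast
  then obtain x where x: "\<And>n. 0 < Re (x n)" "\<And>n. norm (x n) \<le> K * Re (x n)" "\<And>n. real n \<le> norm (x n)"
    "\<And>n. \<not> good (x n)" by metis
  define z where "z = (\<lambda>n. icay \<tau> (x n))"
  have z: "norm (z n) < 1" "cay \<tau> (z n) = x n" for n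
    using norm_icay[OF \<tau> x(1)] cay_icay[OF \<tau> x(1)] by (auto simp: z_def)
  have "filterlim (\<lambda>n. norm (x n)) at_top sequentially"
    by (rule filterlim_at_top_mono[OF filterlim_real_sequentially]) (use x(3) in auto)
  then have "z \<longlonglongrightarrow> \<tau>"
    using tendsto_iff_cay_at_infinity[where z = z, OF \<tau> z(1)] z(2) by (simp add: filterlim_at_infinity_conv_norm_at_top)
  then have "converges_nontangentially z \<tau>"
    by (rule sector_imp_nontangential[OF \<tau> z(1), where K = K]) (simp add: z x(2))
  from hyp[OF this] have inV: "\<forall>\<^sub>F n in sequentially. z n \<in> V"
    and ratio: "(\<lambda>n. disc_density (z n) / hyperbolic_density V (z n)) \<longlonglongrightarrow> 1" by auto
  have "\<forall>\<^sub>F n in sequentially. 1 / 2 < disc_density (z n) / hyperbolic_density V (z n)"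
    by (rule order_tendstoD(1)[OF ratio]) simp
  with inV have "\<forall>\<^sub>F n in sequentially. z n \<in> V \<and> 1 / 2 < disc_density (z n) / hyperbolic_density V (z n)"
    by (rule eventually_conj)
  then obtain n where n: "z n \<in> V" "1 / 2 < disc_density (z n) / hyperbolic_density V (z n)"
    using eventually_happens' sequentially_bot by blast
  define \<zeta> where "\<zeta> = x n"
  have \<zeta>: "0 < Re \<zeta>" "icay \<tau> \<zeta> = z n" using x(1) by (auto simp: \<zeta>_def z_def)
  have dens: "0 < disc_density (z n)" by (rule disc_density_pos[OF z(1)])
  have "0 < hyperbolic_density V (z n)"
  proof (rule ccontr)
    assume "\<not> ?thesis"
    then have "disc_density (z n) / hyperbolic_density V (z n) \<le> 0"
      using dens by (simp add: divide_nonneg_nonpos)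
    then show False using n(2) by simp
  qed
  then have hd: "hyperbolic_density V (z n) \<le> 2 * disc_density (z n)"
    using n(2) by (simp add: field_simps)
  have di: "(icay \<tau> has_field_derivative deriv (icay \<tau>) \<zeta>) (at \<zeta>)"
    by (rule holomorphic_derivI[OF icay_holomorphic open_rhp]) (use \<zeta> in simp)
  have "((\<lambda>x. cay \<tau> (icay \<tau> x)) has_field_derivative deriv (cay \<tau>) (z n) * deriv (icay \<tau>) \<zeta>) (at \<zeta>)"
    by (rule DERIV_chain2[OF _ di]) (use cay_holomorphic[OF \<tau>] z(1) \<zeta> in \<open>auto intro: holomorphic_derivI\<close>)
  moreover have "((\<lambda>x. cay \<tau> (icay \<tau> x)) has_field_derivative 1) (at \<zeta>)"
    by (rule has_field_derivative_transform_within_open[OF DERIV_ident open_rhp])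
       (use \<zeta> cay_icay[OF \<tau>] in auto)
  ultimately have "deriv (cay \<tau>) (z n) * deriv (icay \<tau>) \<zeta> = 1" by (rule DERIV_unique)
  then have "norm (deriv (cay \<tau>) (z n)) * norm (deriv (icay \<tau>) \<zeta>) = 1"
    by (metis norm_mult norm_one)
  moreover have "disc_density (z n) = norm (deriv (cay \<tau>) (z n)) / (2 * Re \<zeta>)"
    using disc_density_cay[OF \<tau> z(1)] z(2) by (simp add: \<zeta>_def)
  ultimately have di_norm: "disc_density (z n) * norm (deriv (icay \<tau>) \<zeta>) = 1 / (2 * Re \<zeta>)" by simp
  have oV: "open V" using V(1) by (simp add: domain_def)
  have "good \<zeta>"
    unfolding good_def \<zeta>(2)
  proof (intro conjI allI impI)
    show "h (z n) \<in> h ` V" using n(1) by blast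
    fix J assume J: "J holomorphic_on h ` V" "\<forall>w\<in>h ` V. 0 < Re (J w)"
    have JhV: "(\<lambda>z. J (h z)) holomorphic_on V"
      by (rule holomorphic_on_compose_gen[OF holomorphic_on_subset[OF h V(3)] J(1), unfolded o_def]) auto
    have "norm (deriv (\<lambda>z. J (h z)) (z n)) \<le> 2 * Re (J (h (z n))) * hyperbolic_density V (z n)"
      by (rule hyperbolic_density_rhp[OF V n(1) JhV]) (use J(2) in auto)
    also have "\<dots> \<le> 2 * Re (J (h (z n))) * (2 * disc_density (z n))"
      using hd J(2) n(1) by (intro mult_left_mono) (auto simp: less_imp_le)
    finally have b: "norm (deriv (\<lambda>z. J (h z)) (z n)) \<le> 4 * Re (J (h (z n))) * disc_density (z n)" by simp
    have "((\<lambda>x. J (h (icay \<tau> x))) has_field_derivative deriv (\<lambda>z. J (h z)) (z n) * deriv (icay \<tau>) \<zeta>) (at \<zeta>)"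
      by (rule DERIV_chain2[where f = "\<lambda>z. J (h z)", OF _ di]) (use holomorphic_derivI[OF JhV oV n(1)] \<zeta> in simp)
    then have "norm (deriv (\<lambda>x. J (h (icay \<tau> x))) \<zeta>) = norm (deriv (\<lambda>z. J (h z)) (z n)) * norm (deriv (icay \<tau>) \<zeta>)"
      by (simp add: DERIV_imp_deriv norm_mult)
    also have "\<dots> \<le> 4 * Re (J (h (z n))) * disc_density (z n) * norm (deriv (icay \<tau>) \<zeta>)"
      using b by (intro mult_right_mono) auto
    also have "\<dots> = 2 * Re (J (h (z n))) / Re \<zeta>"
      by (simp only: mult.assoc di_norm) simp
    finally show "norm (deriv (\<lambda>x. J (h (icay \<tau> x))) \<zeta>) \<le> 2 * Re (J (h (z n))) / Re \<zeta>" .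
  qed
  then show False using x(4) by (simp add: \<zeta>_def)
qed

section \<open>The orbit of the semigroup\<close>

locale koenigs_orbit =
  fixes f h :: "complex \<Rightarrow> complex" and V :: "complex set" and \<tau> z0 :: complex
  assumes \<tau>: "norm \<tau> = 1"
    and f: "f holomorphic_on disc" "f ` disc \<subseteq> disc"
    and h: "h holomorphic_on disc" and hf: "\<And>z. z \<in> disc \<Longrightarrow> h (f z) = h z + 1"
    and V: "open V" "V \<subseteq> disc" "f ` V \<subseteq> V" and inj: "inj_on h V"
    and shiftV: "\<And>w t. w \<in> h ` V \<Longrightarrow> 0 \<le> t \<Longrightarrow> w + of_real t \<in> h ` V"
    and z0: "z0 \<in> V" and iter: "(\<lambda>n. (f ^^ n) z0) \<longlonglongrightarrow> \<tau>"
begin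

definition hinv :: "complex \<Rightarrow> complex" where "hinv = inv_into V h"

lemma hinv_h: "v \<in> V \<Longrightarrow> hinv (h v) = v"
  by (simp add: hinv_def inv_into_f_f[OF inj])

lemma hinv_in: "w \<in> h ` V \<Longrightarrow> hinv w \<in> V"
  by (simp add: hinv_def inv_into_into)

lemma h_hinv: "w \<in> h ` V \<Longrightarrow> h (hinv w) = w"
  by (simp add: hinv_def f_inv_into_f)

lemma hV: "h holomorphic_on V" by (rule holomorphic_on_subset[OF h V(2)])

lemma open_hV: "open (h ` V)" by (rule open_mapping_thm3[OF hV V(1) inj])

lemma hinv_holomorphic: "hinv holomorphic_on h ` V"
proof (rule holomorphic_has_inverse[OF hV V(1) inj])
  fix k assume k: "k holomorphic_on h ` V" "\<And>z. z \<in> V \<Longrightarrow> k (h z) = z"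
  show "hinv holomorphic_on h ` V"
  proof (rule holomorphic_transform[OF k(1)])
    fix w assume "w \<in> h ` V"
    then obtain v where v: "v \<in> V" "w = h v" by blast
    show "k w = hinv w" unfolding v(2) k(2)[OF v(1)] hinv_h[OF v(1)] ..
  qed
qed

lemma iter_in_V: "(f ^^ n) z0 \<in> V"
  by (induction n) (use z0 V(3) in auto)

lemma h_iter: "h ((f ^^ n) z0) = h z0 + of_nat n"
proof (induction n)
  case (Suc n)
  then show ?case using hf[of "(f ^^ n) z0"] iter_in_V[of n] V(2) by auto
qed simp

definition g :: "complex \<Rightarrow> complex" where "g = (\<lambda>w. cay \<tau> (hinv w))"
definition F :: "complex \<Rightarrow> complex" where "F = (\<lambda>x. cay \<tau> (f (icay \<tau> x)))"

lemma hinv_norm: "w \<in> h ` V \<Longrightarrow> norm (hinv w) < 1"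
  using hinv_in V(2) by force

lemma iter_norm: "norm ((f ^^ n) z0) < 1"
  using iter_in_V[of n] V(2) by auto

lemma g_iter: "g (h z0 + of_nat n) = cay \<tau> ((f ^^ n) z0)"
  using hinv_h[OF iter_in_V[of n]] by (simp add: g_def h_iter)

lemma F_cay: "norm z < 1 \<Longrightarrow> F (cay \<tau> z) = cay \<tau> (f z)"
  by (simp add: F_def icay_cay[OF \<tau>])

lemma F_iter: "(F ^^ n) (cay \<tau> z0) = cay \<tau> ((f ^^ n) z0)"
  by (induction n) (simp_all add: F_cay iter_norm)

sublocale starlike_orbit "h ` V" g F "h z0"
proof
  show F_hol: "F holomorphic_on rhp"
  proof -
    have "(\<lambda>x. f (icay \<tau> x)) holomorphic_on rhp"
      by (rule holomorphic_on_compose_gen[OF icay_holomorphic f(1), unfolded o_def]) (use norm_icay[OF \<tau>] in auto)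
    then show ?thesis
      unfolding F_def
      by (rule holomorphic_on_compose_gen[OF _ cay_holomorphic[OF \<tau>], unfolded o_def])
         (use norm_icay[OF \<tau>] f(2) in \<open>auto simp: image_subset_iff\<close>)
  qed
  have fd: "norm (f z) < 1" if "norm z < 1" for z
  proof -
    have "f z \<in> f ` disc" using that by (intro imageI) simp
    then show ?thesis using f(2) by (auto dest: subsetD)
  qed
  have F_pos: "0 < Re (F z)" if "0 < Re z" for z
    unfolding F_def by (rule cay_pos[OF \<tau> fd[OF norm_icay[OF \<tau> that]]])
  have inf: "filterlim (\<lambda>n. cay \<tau> ((f ^^ n) z0)) at_infinity sequentially"
    using tendsto_iff_cay_at_infinity[where z = "\<lambda>n. (f ^^ n) z0", OF \<tau> iter_norm] iter by blast
  \<comment> \<open>the Denjoy--Wolff point is at infinity, so Julia's lemma applies to the orbit of \<open>z0\<close>\<close>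
  show "Re z \<le> Re (F z)" if "0 < Re z" for z
  proof (rule julia_rhp[OF F_hol F_pos _ _ that])
    show "0 < Re (cay \<tau> z0)" using cay_pos[OF \<tau>] iter_norm[of 0] by simp
    show "filterlim (\<lambda>n. (F ^^ n) (cay \<tau> z0)) at_infinity sequentially" using inf by (simp add: F_iter)
  qed
  show "filterlim (\<lambda>n. g (h z0 + of_nat n)) at_infinity sequentially" using inf by (simp add: g_iter)
  show "g holomorphic_on h ` V"
    unfolding g_def
    by (rule holomorphic_on_compose_gen[OF hinv_holomorphic cay_holomorphic[OF \<tau>], unfolded o_def])
       (use hinv_norm in auto)
  fix w assume w: "w \<in> h ` V"
  show "0 < Re (g w)" unfolding g_def by (rule cay_pos[OF \<tau> hinv_norm[OF w]])
  obtain v where v: "v \<in> V" "w = h v" using w by blast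
  have "f v \<in> V" "h (f v) = w + 1" using v V hf[of v] by auto
  then have "hinv (w + 1) = f v" using hinv_h by metis
  then show "F (g w) = g (w + 1)"
    using F_cay[of v] v V(2) hinv_h by (auto simp: g_def)
qed (use open_hV z0 shiftV in auto)

definition \<eta> :: "real \<Rightarrow> complex" where "\<eta> t = hinv (h z0 + of_real t)"

lemma \<eta>_semigroup: "\<eta> = (\<lambda>t. semigroup_fication h V t z0)"
  by (simp add: \<eta>_def[abs_def] semigroup_fication_def hinv_def)

lemma orbit_\<eta>: "orbit t = cay \<tau> (\<eta> t)"
  unfolding orbit_def \<eta>_def by (simp add: g_def)

lemma \<eta>_in_V: "0 \<le> t \<Longrightarrow> \<eta> t \<in> V"
  unfolding \<eta>_def by (rule hinv_in[OF orbit_in])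

lemma \<eta>_norm: "0 \<le> t \<Longrightarrow> norm (\<eta> t) < 1"
  using \<eta>_in_V V(2) by force

lemma h_\<eta>: "0 \<le> t \<Longrightarrow> h (\<eta> t) = h z0 + of_real t"
  unfolding \<eta>_def by (rule h_hinv[OF orbit_in])

lemma \<eta>_nat: "\<eta> (real n) = (f ^^ n) z0"
  using hinv_h[OF iter_in_V[of n]] by (simp add: \<eta>_def h_iter)

lemma f_\<eta>: "0 \<le> t \<Longrightarrow> f (\<eta> t) = \<eta> (t + 1)"
proof -
  assume t: "0 \<le> t"
  have "f (\<eta> t) \<in> V" "h (f (\<eta> t)) = h z0 + of_real (t + 1)"
    using \<eta>_in_V[OF t] V hf[of "\<eta> t"] h_\<eta>[OF t] by auto
  then show ?thesis unfolding \<eta>_def using hinv_h by metis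
qed

definition \<eta>' :: "real \<Rightarrow> complex" where "\<eta>' t = deriv hinv (h z0 + of_real t)"

lemma \<eta>_deriv: assumes t: "0 \<le> t" shows "(\<eta> has_vector_derivative \<eta>' t) (at t)"
proof -
  have "(hinv has_field_derivative \<eta>' t) (at (h z0 + of_real t))"
    unfolding \<eta>'_def by (rule holomorphic_derivI[OF hinv_holomorphic open_hV orbit_in[OF t]])
  moreover have "((\<lambda>t. h z0 + of_real t) has_vector_derivative 1) (at t)"
    by (auto intro!: derivative_eq_intros)
  ultimately show ?thesis
    using field_vector_diff_chain_at[of "\<lambda>t. h z0 + of_real t" 1 t hinv] by (simp add: \<eta>_def[abs_def] o_def)
qed

lemma \<eta>'_cont: "continuous_on {0..} \<eta>'"
proof -
  have "continuous_on (h ` V) (deriv hinv)"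
    by (intro holomorphic_on_imp_continuous_on holomorphic_deriv hinv_holomorphic open_hV)
  then show ?thesis
    unfolding \<eta>'_def by (rule continuous_on_compose2) (auto intro!: continuous_intros orbit_in)
qed

lemma \<eta>_cont: "continuous_on {0..} \<eta>"
  using has_vector_derivative_continuous[OF \<eta>_deriv] by (intro continuous_at_imp_continuous_on) auto

lemma speed_eq: assumes t: "0 \<le> t" shows "speed t = disc_density (\<eta> t) * norm (\<eta>' t)"
proof -
  have w: "h z0 + of_real t \<in> h ` V" by (rule orbit_in[OF t])
  have 1: "(hinv has_field_derivative \<eta>' t) (at (h z0 + of_real t))"
    unfolding \<eta>'_def by (rule holomorphic_derivI[OF hinv_holomorphic open_hV w])
  have "(cay \<tau> has_field_derivative deriv (cay \<tau>) (\<eta> t)) (at (hinv (h z0 + of_real t)))"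
    unfolding \<eta>_def using cay_holomorphic[OF \<tau>] hinv_norm[OF w] by (intro holomorphic_derivI) auto
  from DERIV_chain2[OF this 1] have "deriv g (h z0 + of_real t) = deriv (cay \<tau>) (\<eta> t) * \<eta>' t"
    unfolding g_def by (rule DERIV_imp_deriv)
  then show ?thesis
    unfolding speed_def orbit_\<eta> disc_density_cay[OF \<tau> \<eta>_norm[OF t]] by (simp add: norm_mult)
qed

lemma length_eq: assumes "0 \<le> s" shows "hyperbolic_length \<eta> s t = len s t"
  unfolding hyperbolic_length_def len_def
  by (rule integral_cong) (use assms in \<open>simp add: speed_eq vector_derivative_at[OF \<eta>_deriv]\<close>)

lemma \<eta>_disc_curve: "disc_curve \<eta>"
  using \<eta>_cont \<eta>_norm by (auto simp: disc_curve_def)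

lemma \<eta>_piecewise: "piecewise_C1_on \<eta> 0 T"
  unfolding piecewise_C1_on_def
proof (intro conjI exI[of _ "{}"] allI impI)
  show "continuous_on {0..T} \<eta>" by (rule continuous_on_subset[OF \<eta>_cont]) auto
  fix c d :: real assume "0 \<le> c \<and> c < d \<and> d \<le> T \<and> {c<..<d} \<inter> {} = {}"
  then have c: "0 \<le> c" by simp
  have "continuous_on {c..d} \<eta>'" by (rule continuous_on_subset[OF \<eta>'_cont]) (use c in auto)
  moreover have "(\<eta> has_vector_derivative \<eta>' t) (at t within {c..d})" if "t \<in> {c..d}" for t
    by (rule has_vector_derivative_at_within[OF \<eta>_deriv]) (use that c in simp)
  ultimately show "\<exists>\<gamma>'. continuous_on {c..d} \<gamma>' \<and> (\<forall>t\<in>{c..d}. (\<eta> has_vector_derivative \<gamma>' t) (at t within {c..d}))"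
    by blast
qed simp

lemma \<eta>_lipschitz: "\<exists>L. L-lipschitz_on {0..} \<eta>"
proof -
  obtain M where M: "0 < M" "\<And>t. 0 \<le> t \<Longrightarrow> speed t \<le> M" using bounded_speed by auto
  have le: "norm (\<eta> t - \<eta> s) \<le> M * (t - s)" if st: "0 \<le> s" "s \<le> t" for s t
  proof -
    have "norm (\<eta> t - \<eta> s) \<le> 1 * len s t"
    proof (rule variation_le_len[OF st])
      fix u assume "s < u" "u < t"
      then have u: "0 \<le> u" using st by simp
      have "1 \<le> disc_density (\<eta> u)"
        using \<eta>_norm[OF u] by (simp add: disc_density_def abs_square_less_1)
      then have "1 * norm (\<eta>' u) \<le> disc_density (\<eta> u) * norm (\<eta>' u)" by (intro mult_right_mono) auto
      then show "norm (\<eta>' u) \<le> 1 * speed u" by (simp add: speed_eq[OF u])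
    qed (use \<eta>_deriv st in auto)
    also have "len s t \<le> M * (t - s)" by (rule len_le[OF st]) (use M st in auto)
    finally show ?thesis by simp
  qed
  have "M-lipschitz_on {0..} \<eta>"
  proof (rule lipschitz_onI)
    fix s t :: real assume "s \<in> {0..}" "t \<in> {0..}"
    then show "dist (\<eta> s) (\<eta> t) \<le> M * dist s t"
      using le[of s t] le[of t s] by (cases "s \<le> t") (auto simp: dist_norm norm_minus_commute dist_real_def)
  qed (use M in simp)
  then show ?thesis by blast
qed

lemma \<eta>_lands: "lands_at \<eta> \<tau>"
proof -
  define \<xi> where "\<xi> = (\<lambda>t. \<eta> (max t 0))"
  have "filterlim (\<lambda>t. cay \<tau> (\<xi> t)) at_infinity at_top"
  proof (rule filterlim_mono_eventually[OF orbit_at_infinity order_refl order_refl])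
    show "\<forall>\<^sub>F t in at_top. orbit t = cay \<tau> (\<xi> t)"
      using eventually_ge_at_top[of 0] by eventually_elim (simp add: \<xi>_def orbit_\<eta>)
  qed
  then have "(\<xi> \<longlongrightarrow> \<tau>) at_top"
    using tendsto_iff_cay_at_infinity[OF \<tau>, of \<xi> at_top] \<eta>_norm by (simp add: \<xi>_def)
  moreover have "\<forall>\<^sub>F t in at_top. \<xi> t = \<eta> t"
    using eventually_ge_at_top[of 0] by eventually_elim (simp add: \<xi>_def)
  ultimately have "(\<eta> \<longlongrightarrow> \<tau>) at_top" by (rule Lim_transform_eventually)
  then show ?thesis using \<tau> by (simp add: lands_at_def)
qed

lemma quasi_geodesic_iff:
  "hyperbolic_quasi_geodesic \<eta> \<longleftrightarrow>
     (\<exists>A\<ge>1. \<exists>B\<ge>0. \<forall>s t. 0 \<le> s \<and> s < t \<longrightarrow> len s t \<le> A * hyperbolic_dist (\<eta> s) (\<eta> t) + B)"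
  unfolding hyperbolic_quasi_geodesic_def using \<eta>_disc_curve \<eta>_piecewise length_eq by simp

lemma quasi_geodesicI:
  assumes Q: "Q holomorphic_on disc" "\<And>z. z \<in> disc \<Longrightarrow> 0 < Re (Q z)" and A: "1 \<le> A" and B: "0 \<le> B"
    and le: "\<And>s t. 0 \<le> s \<Longrightarrow> s < t \<Longrightarrow> len s t \<le> A * (\<bar>ln (norm (Q (\<eta> t))) - ln (norm (Q (\<eta> s)))\<bar> / 2) + B"
  shows "hyperbolic_quasi_geodesic \<eta>"
  unfolding quasi_geodesic_iff
proof (rule exI[of _ A], intro conjI A, rule exI[of _ B], intro conjI B allI impI)
  fix s t :: real assume "0 \<le> s \<and> s < t"
  then have st: "0 \<le> s" "s < t" "0 \<le> t" by auto
  have "\<bar>ln (norm (Q (\<eta> t))) - ln (norm (Q (\<eta> s)))\<bar> / 2 \<le> hyperbolic_dist (\<eta> s) (\<eta> t)"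
    using hyperbolic_dist_lower[of "\<eta> s" "\<eta> t", OF _ _ Q] \<eta>_norm st by simp
  then have "A * (\<bar>ln (norm (Q (\<eta> t))) - ln (norm (Q (\<eta> s)))\<bar> / 2) \<le> A * hyperbolic_dist (\<eta> s) (\<eta> t)"
    using A by (intro mult_left_mono) auto
  then show "len s t \<le> A * hyperbolic_dist (\<eta> s) (\<eta> t) + B" using le[OF st(1,2)] by simp
qed

text \<open>The upper bound for the hyperbolic distance turns the quasi-geodesic inequality into the one
about \<open>hsq\<close>, and Julia's lemma supplies the lower bound for \<open>Re\<close>.\<close>

lemma quasi_geodesic_imp_orbit_sector:
  assumes "hyperbolic_quasi_geodesic \<eta>"
  shows "\<exists>K. \<forall>t\<ge>0. norm (orbit t) \<le> K * Re (orbit t)"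
proof -
  obtain A B where AB: "1 \<le> A" "0 \<le> B"
    "\<And>s t. 0 \<le> s \<and> s < t \<Longrightarrow> len s t \<le> A * hyperbolic_dist (\<eta> s) (\<eta> t) + B"
    using assms unfolding quasi_geodesic_iff by blast
  obtain c where c: "0 < c" "\<And>s t. 0 \<le> s \<Longrightarrow> s \<le> t \<Longrightarrow> c * Re (orbit s) \<le> Re (orbit t)"
    using Re_orbit_almost_mono by blast
  show ?thesis
  proof (rule quasi_geodesic_imp_sector[OF _ _ orbit_at_infinity AB(1,2)])
    show "0 < c * Re (orbit 0)" using c pos[of 0] by simp
    show "c * Re (orbit 0) \<le> Re (orbit t)" if "0 \<le> t" for t using c(2)[of 0 t] that by simp
    fix s t :: real assume st: "0 \<le> s" "s < t"
    have "hyperbolic_dist (\<eta> s) (\<eta> t) \<le> ln (4 + hsq (orbit s) (orbit t)) / 2"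
      unfolding orbit_\<eta> by (rule hyperbolic_dist_upper[OF _ _ \<tau>]) (use \<eta>_norm st in auto)
    then have "A * hyperbolic_dist (\<eta> s) (\<eta> t) \<le> A * (ln (4 + hsq (orbit s) (orbit t)) / 2)"
      using AB(1) by (intro mult_left_mono) auto
    then show "len s t \<le> A * (ln (4 + hsq (orbit s) (orbit t)) / 2) + B" using AB(3)[of s t] st by simp
  qed
qed

lemma slopes_eq_of_cos_limit:
  assumes lim: "((\<lambda>t. Re (orbit t) / norm (orbit t)) \<longlongrightarrow> c) at_top"
    and z: "\<And>n. n0 \<le> n \<Longrightarrow> z n = \<eta> (real (n - n0))"
  shows "slope_seq \<tau> z = slope_curve \<tau> \<eta>"
proof -
  have "((\<lambda>t. cos (Arg (1 - cnj \<tau> * \<eta> t))) \<longlongrightarrow> c) at_top"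
  proof (rule Lim_transform_eventually[OF slope_of_add_one[OF lim]])
    show "\<forall>\<^sub>F t in at_top. Re (orbit t + 1) / norm (orbit t + 1) = cos (Arg (1 - cnj \<tau> * \<eta> t))"
      using eventually_ge_at_top[of 0] by eventually_elim (simp add: Arg_cay(3)[OF \<tau> \<eta>_norm] orbit_\<eta>)
  qed
  moreover have "continuous_on {0..} (\<lambda>t. Arg (1 - cnj \<tau> * \<eta> t))"
  proof -
    have "continuous_on {0..} (\<lambda>t. - Im (Ln (orbit t + 1)))"
      using pos by (intro continuous_intros cont) (auto simp: complex_nonpos_Reals_iff not_le add_pos_pos)
    then show ?thesis
      by (rule continuous_on_eq) (simp add: Arg_cay(1)[OF \<tau> \<eta>_norm] orbit_\<eta>)
  qed
  moreover have "\<bar>Arg (1 - cnj \<tau> * \<eta> t)\<bar> \<le> pi / 2" if "0 \<le> t" for t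
    by (rule Arg_cay(2)[OF \<tau> \<eta>_norm[OF that]])
  ultimately obtain \<theta> where "((\<lambda>t. Arg (1 - cnj \<tau> * \<eta> t)) \<longlongrightarrow> \<theta>) at_top"
    using angle_limit_of_cos_limit by blast
  then show ?thesis using z by (rule slopes_eq_of_limit)
qed

end

section \<open>The three types of maps\<close>

context koenigs_orbit
begin

lemma nontangential_imp_orbit_sector:
  assumes nt: "converges_nontangentially z \<tau>" and z: "\<And>n. n0 \<le> n \<Longrightarrow> z n = \<eta> (real (n - n0))"
  shows "\<exists>K. \<forall>t\<ge>0. norm (orbit t) \<le> K * Re (orbit t)"
proof -
  obtain K where K: "\<And>n. norm (cay \<tau> (z n)) \<le> K * Re (cay \<tau> (z n))"
    using nontangential_imp_sector[OF \<tau> nt] by blast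
  have "norm (orbit (real n)) \<le> K * Re (orbit (real n))" for n
    using K[of "n + n0"] z[of "n + n0"] by (simp add: orbit_\<eta>)
  then show ?thesis by (rule sector_from_integers)
qed

lemma orbit_sector_imp_nontangential:
  assumes K: "\<And>t. 0 \<le> t \<Longrightarrow> norm (orbit t) \<le> K * Re (orbit t)"
    and z: "\<And>n. n0 \<le> n \<Longrightarrow> z n = \<eta> (real (n - n0))"
    and z_disc: "\<And>n. norm (z n) < 1" and lim: "z \<longlonglongrightarrow> \<tau>"
  shows "converges_nontangentially z \<tau>"
proof (rule sector_imp_nontangential[OF \<tau> z_disc lim])
  show "\<forall>\<^sub>F n in sequentially. norm (cay \<tau> (z n)) \<le> K * Re (cay \<tau> (z n))"
    using eventually_ge_at_top[of n0]
    by eventually_elim (use K in \<open>simp add: z orbit_\<eta>\<close>)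
qed

text \<open>By Liouville's theorem, as the inverse of \<open>h\<close> on \<open>h ` V\<close> is bounded and injective.\<close>

lemma hV_not_UNIV: "h ` V \<noteq> UNIV"
proof
  assume U: "h ` V = UNIV"
  have bd: "bounded (range hinv)"
    by (rule boundedI[of _ 1]) (use hinv_norm U in \<open>auto intro: less_imp_le\<close>)
  have hol: "hinv holomorphic_on UNIV" using hinv_holomorphic U by simp
  obtain c where c: "\<And>w. hinv w = c"
    using Liouville_theorem[OF hol bd] by (auto simp: constant_on_def)
  have "h c = w" for w using h_hinv[of w] U c by simp
  from this[of 0] this[of 1] show False by simp
qed

lemma k_hol: "(\<lambda>x. h (icay \<tau> x)) holomorphic_on rhp"
  by (rule holomorphic_on_compose_gen[OF icay_holomorphic h, unfolded o_def]) (use norm_icay[OF \<tau>] in auto)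

lemma k_g: "w \<in> h ` V \<Longrightarrow> h (icay \<tau> (g w)) = w"
  using icay_cay[OF \<tau> hinv_norm] h_hinv by (simp add: g_def)

text \<open>Parabolic maps of zero hyperbolic step. The bound for the length by the change of
\<open>ln |orbit t|\<close>, which \<open>plane_doubling\<close> gives, is a bound by the hyperbolic distance, as the
Cayley transform is an isometry.\<close>

lemma plane_case:
  assumes ex: "\<And>w. \<exists>t\<ge>0. w + of_real t \<in> h ` V"
    and cmp: "sector_comparison_map (h ` V) (\<lambda>x. h (icay \<tau> x))"
    and z: "\<And>n. n0 \<le> n \<Longrightarrow> z n = \<eta> (real (n - n0))"
  shows "slope_seq \<tau> z = slope_curve \<tau> \<eta>"
    and "converges_nontangentially z \<tau> \<Longrightarrow> hyperbolic_quasi_geodesic \<eta>"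
proof -
  show "slope_seq \<tau> z = slope_curve \<tau> \<eta>"
  proof (rule slopes_eq_of_slow_variation[where z = z and \<eta> = \<eta>, OF _ z])
    have "((\<lambda>t. - (Im (Ln (orbit t + 1)) - Im (Ln (orbit (real (nat \<lfloor>t\<rfloor>)) + 1)))) \<longlongrightarrow> - 0) at_top"
      by (intro tendsto_minus plane_slow_variation ex)
    then have lim: "((\<lambda>t. - (Im (Ln (orbit t + 1)) - Im (Ln (orbit (real (nat \<lfloor>t\<rfloor>)) + 1)))) \<longlongrightarrow> 0) at_top" by simp
    show "((\<lambda>t. Arg (1 - cnj \<tau> * \<eta> t) - Arg (1 - cnj \<tau> * \<eta> (real (nat \<lfloor>t\<rfloor>)))) \<longlongrightarrow> 0) at_top"
    proof (rule Lim_transform_eventually[OF lim])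
      show "\<forall>\<^sub>F t in at_top. - (Im (Ln (orbit t + 1)) - Im (Ln (orbit (real (nat \<lfloor>t\<rfloor>)) + 1))) =
          Arg (1 - cnj \<tau> * \<eta> t) - Arg (1 - cnj \<tau> * \<eta> (real (nat \<lfloor>t\<rfloor>)))"
        using eventually_ge_at_top[of 0] by eventually_elim (simp add: Arg_cay(1)[OF \<tau> \<eta>_norm] orbit_\<eta>)
    qed
  qed simp
  assume nt: "converges_nontangentially z \<tau>"
  obtain K where K: "\<And>t. 0 \<le> t \<Longrightarrow> norm (orbit t) \<le> K * Re (orbit t)"
    using nontangential_imp_orbit_sector[OF nt z] by blast
  obtain A B where AB: "1 \<le> A" "0 \<le> B" "\<And>s t. 0 \<le> s \<Longrightarrow> s < t \<Longrightarrow>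
      len s t \<le> A * (\<bar>ln (norm (orbit t)) - ln (norm (orbit s))\<bar> / 2) + B"
    using plane_doubling[OF hV_not_UNIV k_hol k_g K cmp] by metis
  show "hyperbolic_quasi_geodesic \<eta>"
    by (rule quasi_geodesicI[OF cay_holomorphic[OF \<tau>] _ AB(1,2)])
       (use cay_pos[OF \<tau>] AB(3) in \<open>auto simp: orbit_\<eta>\<close>)
qed

text \<open>Hyperbolic maps. The orbit is always a quasi-geodesic: \<open>h\<close> followed by the exponential map of
the strip contracts, and it takes the orbit to a curve on which \<open>ln |x|\<close> grows linearly in
time, while the length grows at most linearly. Only then the orbit is known to stay in a
sector, and the slope can be computed.\<close>

lemma strip_case:
  assumes ab: "a < b" and ex: "\<And>w. a < Im w \<Longrightarrow> Im w < b \<Longrightarrow> \<exists>t\<ge>0. w + of_real t \<in> h ` V"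
    and h_in: "\<And>z. z \<in> disc \<Longrightarrow> a < Im (h z) \<and> Im (h z) < b"
    and z: "\<And>n. n0 \<le> n \<Longrightarrow> z n = \<eta> (real (n - n0))"
  shows "slope_seq \<tau> z = slope_curve \<tau> \<eta>" and "hyperbolic_quasi_geodesic \<eta>"
proof -
  define d where "d = pi / (b - a)"
  define m where "m = (a + b) / 2"
  have d: "0 < d" using ab by (simp add: d_def)
  have D: "h ` V \<subseteq> {w. a < Im w \<and> Im w < b}" using h_in V(2) by auto
  have k_in: "a < Im (h (icay \<tau> x)) \<and> Im (h (icay \<tau> x)) < b" if "0 < Re x" for x
    using h_in norm_icay[OF \<tau> that] by simp
  define Q where "Q = (\<lambda>z. exp (of_real d * (h z - \<i> * of_real m)))"
  obtain M where M: "0 < M" "\<And>t. 0 \<le> t \<Longrightarrow> speed t \<le> M" using bounded_speed by auto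
  define A where "A = max 1 (2 * M / d)"
  show qg: "hyperbolic_quasi_geodesic \<eta>"
  proof (rule quasi_geodesicI[of Q A 0])
    show "Q holomorphic_on disc" unfolding Q_def by (intro holomorphic_intros h)
    show "0 < Re (Q z)" if "z \<in> disc" for z
      unfolding Q_def d_def m_def by (rule exp_strip_pos[OF ab]) (use h_in[OF that] in auto)
    show "1 \<le> A" by (simp add: A_def)
    fix s t :: real assume st: "0 \<le> s" "s < t"
    have lnQ: "ln (norm (Q (\<eta> u))) = d * (Re (h z0) + u)" if "0 \<le> u" for u
      unfolding Q_def h_\<eta>[OF that] by simp
    have "len s t \<le> M * (t - s)" by (rule len_le) (use st M in auto)
    also have "\<dots> = (2 * M / d) * (d * (t - s) / 2)" using d by simp
    also have "\<dots> \<le> A * (d * (t - s) / 2)"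
      using d st by (intro mult_right_mono) (auto simp: A_def)
    also have "d * (t - s) = \<bar>ln (norm (Q (\<eta> t))) - ln (norm (Q (\<eta> s)))\<bar>"
      using d st lnQ[of s] lnQ[of t] by (simp add: right_diff_distrib[symmetric] abs_mult)
    finally show "len s t \<le> A * (\<bar>ln (norm (Q (\<eta> t))) - ln (norm (Q (\<eta> s)))\<bar> / 2) + 0" by simp
  qed simp
  obtain K where "\<And>t. 0 \<le> t \<Longrightarrow> norm (orbit t) \<le> K * Re (orbit t)"
    using quasi_geodesic_imp_orbit_sector[OF qg] by blast
  from strip_slope[OF ab D ex k_hol k_in k_g this]
  show "slope_seq \<tau> z = slope_curve \<tau> \<eta>" using z by (rule slopes_eq_of_cos_limit)
qed

text \<open>Parabolic maps of positive hyperbolic step. The orbit converges tangentially, whatever the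
starting point.\<close>

lemma halfplane_case:
  assumes s: "s = 1 \<or> s = - (1::real)"
    and ex: "\<And>w. 0 < s * (Im w - a) \<Longrightarrow> \<exists>t\<ge>0. w + of_real t \<in> h ` V"
    and h_in: "\<And>z. z \<in> disc \<Longrightarrow> 0 < s * (Im (h z) - a)"
    and z: "\<And>n. n0 \<le> n \<Longrightarrow> z n = \<eta> (real (n - n0))"
  shows "slope_seq \<tau> z = slope_curve \<tau> \<eta>" and "\<not> converges_nontangentially z \<tau>"
proof -
  have D: "h ` V \<subseteq> {w. 0 < s * (Im w - a)}" using h_in V(2) by auto
  have k_in: "0 < s * (Im (h (icay \<tau> x)) - a)" if "0 < Re x" for x
    using h_in norm_icay[OF \<tau> that] by simp
  have lim: "((\<lambda>t. Re (orbit t) / norm (orbit t)) \<longlongrightarrow> 0) at_top"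
    by (rule halfplane_slope[OF s D ex k_hol k_in k_g])
  then show "slope_seq \<tau> z = slope_curve \<tau> \<eta>" using z by (rule slopes_eq_of_cos_limit)
  show "\<not> converges_nontangentially z \<tau>"
  proof
    assume nt: "converges_nontangentially z \<tau>"
    obtain K where K: "\<And>t. 0 \<le> t \<Longrightarrow> norm (orbit t) \<le> K * Re (orbit t)"
      using nontangential_imp_orbit_sector[OF nt z] by blast
    have nz: "0 < norm (orbit t)" if "0 \<le> t" for t by (rule orbit_norm_pos[OF that])
    have "0 < K * Re (orbit 0)" by (rule less_le_trans[OF nz K]) simp_all
    then have K0: "0 < K" using pos[of 0] by (simp add: zero_less_mult_iff)
    have "\<forall>\<^sub>F t in at_top. 1 / K \<le> Re (orbit t) / norm (orbit t)"
      using eventually_ge_at_top[of 0]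
    proof eventually_elim
      case (elim t)
      then show ?case using K[OF elim] nz[OF elim] K0 by (simp add: field_simps)
    qed
    then have "1 / K \<le> 0" by (rule tendsto_lowerbound[OF lim]) simp
    then show False using K0 by simp
  qed
qed

end

section \<open>The theorem\<close>

theorem theoremC:
  fixes f h :: "complex \<Rightarrow> complex" and \<tau> :: complex and \<Omega> V :: "complex set"
  assumes "non_elliptic f"
    and "is_Denjoy_Wolff_point f \<tau>"
    and "Koenigs_pair f h \<Omega>"
    and "fundamental_domain f V"
    and "univalent_on h V"
    and "starlike_at_infinity (h ` V)"
    and "(\<Union>t\<in>{0::real..}. (\<lambda>w. w - of_real t) ` (h ` V)) = left_saturation \<Omega>"
    and "hyperbolic_map f \<or> parabolic_zero_step f \<Longrightarrow>
           (\<forall>z. converges_nontangentially z \<tau> \<longrightarrow>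
              (\<forall>\<^sub>F n in sequentially. z n \<in> V) \<and>
              (\<lambda>n. disc_density (z n) / hyperbolic_density V (z n)) \<longlonglongrightarrow> 1)"
  shows "\<forall>z\<in>disc. \<exists>n\<^sub>0\<ge>1. \<exists>\<eta>.
           \<eta> = (\<lambda>t. semigroup_fication h V t ((f ^^ n\<^sub>0) z)) \<and>
           (f ^^ n\<^sub>0) z \<in> V \<and> (\<forall>t::real\<ge>0. h ((f ^^ n\<^sub>0) z) + of_real t \<in> h ` V) \<and>
           disc_curve \<eta> \<and> (\<exists>L. L-lipschitz_on {0..} \<eta>) \<and> lands_at \<eta> \<tau> \<and>
           (\<forall>n\<ge>n\<^sub>0. (f ^^ n) z = \<eta> (real (n - n\<^sub>0))) \<and>
           f ` (\<eta> ` {0..}) \<subseteq> \<eta> ` {0..} \<and>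
           slope_seq \<tau> (\<lambda>n. (f ^^ n) z) = slope_curve \<tau> \<eta> \<and>
           (hyperbolic_quasi_geodesic \<eta> \<longleftrightarrow> converges_nontangentially (\<lambda>n. (f ^^ n) z) \<tau>)"
proof (rule ballI, goal_cases)
  case (1 z)
  then have z: "z \<in> disc" .
  have ff: "f holomorphic_on disc" "f ` disc \<subseteq> disc" using assms(1) by (auto simp: non_elliptic_def)
  have tau: "norm \<tau> = 1" and DW: "\<And>z. z \<in> disc \<Longrightarrow> (\<lambda>n. (f ^^ n) z) \<longlonglongrightarrow> \<tau>"
    using assms(2) by (auto simp: is_Denjoy_Wolff_point_def)
  have hh: "h holomorphic_on disc" "h ` disc = \<Omega>" and hhf: "\<And>z. z \<in> disc \<Longrightarrow> h (f z) = h z + 1"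
    and \<Omega>: "asymptotically_starlike_at_infinity \<Omega>"
    using assms(3) by (auto simp: Koenigs_pair_def)
  have VV: "domain V" "simply_connected V" "V \<subseteq> disc" "f ` V \<subseteq> V"
    and V_abs: "(\<Union>n\<in>{1::nat..}. {z \<in> disc. (f ^^ n) z \<in> V}) = disc"
    using assms(4) by (auto simp: fundamental_domain_def)
  have oV: "open V" using VV(1) by (simp add: domain_def)
  have injV: "inj_on h V" using assms(5) by (simp add: univalent_on_def)
  have shiftW: "w + of_real t \<in> h ` V" if "w \<in> h ` V" "0 \<le> t" for w t
    using assms(6) that unfolding starlike_at_infinity_def by blast
  have it_disc: "(f ^^ n) z \<in> disc" for n
  proof (induction n)
    case (Suc n)
    then have "f ((f ^^ n) z) \<in> f ` disc" by (rule imageI)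
    then show ?case using ff(2) by auto
  qed (use z in simp)
  have "z \<in> (\<Union>n\<in>{1::nat..}. {z \<in> disc. (f ^^ n) z \<in> V})" unfolding V_abs by (rule z)
  then obtain n0 where n0: "1 \<le> n0" "(f ^^ n0) z \<in> V" by auto
  define z0 where "z0 = (f ^^ n0) z"
  have it: "(f ^^ n) z0 = (f ^^ (n + n0)) z" for n by (simp add: z0_def funpow_add)
  interpret koenigs_orbit f h V \<tau> z0
  proof
    show "(\<lambda>n. (f ^^ n) z0) \<longlonglongrightarrow> \<tau>"
      unfolding it by (rule LIMSEQ_ignore_initial_segment[OF DW[OF z]])
  qed (use tau ff hh hhf oV VV injV shiftW n0 in \<open>auto simp: z0_def\<close>)
  have orb: "(f ^^ n) z = \<eta> (real (n - n0))" if "n0 \<le> n" for n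
    unfolding \<eta>_nat it using that by simp
  have z_norm: "norm ((f ^^ n) z) < 1" for n using it_disc[of n] by simp
  define S where "S = left_saturation \<Omega>"
  have S_eq: "w \<in> S \<longleftrightarrow> (\<exists>t\<ge>0. w + of_real t \<in> h ` V)" for w
  proof -
    have "w \<in> S \<longleftrightarrow> (\<exists>t\<ge>0. \<exists>v\<in>h ` V. w = v - of_real t)"
      unfolding S_def assms(7)[symmetric] by blast
    also have "\<dots> \<longleftrightarrow> (\<exists>t\<ge>0. w + of_real t \<in> h ` V)"
      by (simp only: eq_diff_eq) blast
    finally show ?thesis .
  qed
  have S_inv: "w + of_real t \<in> S" if w: "w \<in> S" for w t
  proof -
    obtain s where s: "0 \<le> s" "w + of_real s \<in> h ` V" using w S_eq by blast
    define r where "r = max 0 (s - t)"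
    have "w + of_real s + of_real (t + r - s) \<in> h ` V" by (rule shiftW[OF s(2)]) (simp add: r_def)
    then have "w + of_real t + of_real r \<in> h ` V" by (simp add: algebra_simps)
    then show ?thesis unfolding S_eq by (intro exI[of _ r]) (simp add: r_def)
  qed
  have S_dom: "open S" "connected S" "S \<noteq> {}"
    using \<Omega> by (auto simp: asymptotically_starlike_at_infinity_def starlike_at_infinity_def domain_def S_def)
  have h_S: "h v \<in> S" if "v \<in> disc" for v
  proof -
    have "h v + 1 \<in> \<Omega>" using \<Omega> hh(2) that by (auto simp: asymptotically_starlike_at_infinity_def)
    then show ?thesis unfolding S_def left_saturation_def by (intro UN_I[of 1] image_eqI[of _ _ "h v + 1"]) auto
  qed
  \<comment> \<open>this direction holds for all types of maps\<close>
  have qg_nt: "converges_nontangentially (\<lambda>n. (f ^^ n) z) \<tau>" if qg: "hyperbolic_quasi_geodesic \<eta>"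
    using quasi_geodesic_imp_orbit_sector[OF qg] orbit_sector_imp_nontangential[OF _ orb z_norm DW[OF z]] by blast
  have main: "slope_seq \<tau> (\<lambda>n. (f ^^ n) z) = slope_curve \<tau> \<eta> \<and>
      (converges_nontangentially (\<lambda>n. (f ^^ n) z) \<tau> \<longrightarrow> hyperbolic_quasi_geodesic \<eta>)"
  proof (rule translation_invariant_cases[OF S_dom S_inv])
    assume "S = UNIV"
    then have "parabolic_zero_step f"
      using assms(1,3) unfolding parabolic_zero_step_def S_def by blast
    then have hyp: "(\<forall>\<^sub>F n in sequentially. z n \<in> V) \<and>
              (\<lambda>n. disc_density (z n) / hyperbolic_density V (z n)) \<longlonglongrightarrow> 1"
      if "converges_nontangentially z \<tau>" for z using assms(8) that by blast
    have ex: "\<exists>t\<ge>0. w + of_real t \<in> h ` V" for w using S_eq[of w] \<open>S = UNIV\<close> by simp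
    show ?thesis
      using plane_case[OF ex sector_comparison[OF tau VV(1-3) hh(1) open_hV hyp] orb] by blast
  next
    fix a assume S: "S = {w. a < Im w}"
    have "\<exists>t\<ge>0. w + of_real t \<in> h ` V" if "0 < 1 * (Im w - a)" for w using S_eq[of w] that S by simp
    moreover have "0 < 1 * (Im (h v) - a)" if "v \<in> disc" for v using h_S[OF that] S by simp
    ultimately show ?thesis using halfplane_case[of 1 a, OF _ _ _ orb] by blast
  next
    fix b assume S: "S = {w. Im w < b}"
    have "\<exists>t\<ge>0. w + of_real t \<in> h ` V" if "0 < - 1 * (Im w - b)" for w using S_eq[of w] that S by simp
    moreover have "0 < - 1 * (Im (h v) - b)" if "v \<in> disc" for v using h_S[OF that] S by simp
    ultimately show ?thesis using halfplane_case[of "- 1" b, OF _ _ _ orb] by blast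
  next
    fix a b :: real assume S: "a < b" "S = {w. a < Im w \<and> Im w < b}"
    have "\<exists>t\<ge>0. w + of_real t \<in> h ` V" if "a < Im w" "Im w < b" for w using S_eq[of w] that S by simp
    moreover have "a < Im (h v) \<and> Im (h v) < b" if "v \<in> disc" for v using h_S[OF that] S by simp
    ultimately show ?thesis using strip_case[OF S(1) _ _ orb] by blast
  qed
  have forward: "f ` (\<eta> ` {0..}) \<subseteq> \<eta> ` {0..}"
  proof
    fix v assume "v \<in> f ` (\<eta> ` {0..})"
    then obtain t where "0 \<le> t" "v = f (\<eta> t)" by auto
    then have "v = \<eta> (t + 1)" "t + 1 \<in> {0..}" using f_\<eta> by auto
    then show "v \<in> \<eta> ` {0..}" by (rule image_eqI)
  qed
  show ?case
  proof (rule exI[of _ n0], intro conjI n0(1), rule exI[of _ \<eta>], intro conjI)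
    show "\<eta> = (\<lambda>t. semigroup_fication h V t ((f ^^ n0) z))"
      using \<eta>_semigroup unfolding z0_def .
    show "\<forall>t\<ge>0. h ((f ^^ n0) z) + of_real t \<in> h ` V"
      using orbit_in unfolding z0_def by blast
    show "\<forall>n\<ge>n0. (f ^^ n) z = \<eta> (real (n - n0))" using orb by blast
    show "slope_seq \<tau> (\<lambda>n. (f ^^ n) z) = slope_curve \<tau> \<eta>" using main by blast
    show "hyperbolic_quasi_geodesic \<eta> \<longleftrightarrow> converges_nontangentially (\<lambda>n. (f ^^ n) z) \<tau>"
      using main qg_nt by blast
  qed (fact n0(2) \<eta>_disc_curve \<eta>_lipschitz \<eta>_lands forward)+
qed

end
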